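(* Let $a\in M^{p,\infty}(\mathbb{R}^{2d})$ for some $0<p<\infty$ and let $\varphi_1,\varphi_2\in\mathcal{S}(\mathbb{R}^d)$ be nonzero. Assume $\sigma_P(A_a^{\varphi_1,\varphi_2})\setminus\{0\}\neq\emptyset$. If $\lambda\in\sigma_P(A_a^{\varphi_1,\varphi_2})\setminus\{0\}$, then every eigenfunction $f\in L^2(\mathbb{R}^d)$ of $A_a^{\varphi_1,\varphi_2}$ with eigenvalue $\lambda$ satisfies $f\in\bigcap_{\gamma>0}M^\gamma(\mathbb{R}^d)$.
   Context: Short-time Fourier transform: $V_\varphi f(x,\omega)=\langle f,M_\omega T_x\varphi\rangle=\int f(y)\overline{\varphi(y-x)}e^{-2\pi iy\cdot\omega}dy$, with $T_xf(t)=f(t-x)$, $M_\omega f(t)=e^{2\pi it\cdot\omega}f(t)$. The localization operator with symbol $a$ and windows $\varphi_1,\varphi_2$ is $A_a^{\varphi_1,\varphi_2}f=\int_{\mathbb{R}^{2d}}a(x,\omega)V_{\varphi_1}f(x,\omega)M_\omega T_x\varphi_2\,dx\,d\omega$ (weakly); under the hypotheses it is a compact operator on $L^2(\mathbb{R}^d)$. $\sigma_P(T)$ denotes the set of $\lambda\in\mathbb{C}$ such that $Tf=\lambda f$ for some nonzero $f\in L^2$. For $0<p,q\le\infty$, $M^{p,q}(\mathbb{R}^n)$ is the space of $F\in\mathcal{S}'(\mathbb{R}^n)$ with $\big(\int(\int|V_gF(x,\omega)|^pdx)^{q/p}d\omega\big)^{1/q}<\infty$ (usual modifications for $\infty$)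 for a fixed $g\in\mathcal{S}(\mathbb{R}^n)\setminus\{0\}$ (independent of $g$), and $M^\gamma=M^{\gamma,\gamma}$. *)

theory Defs
  imports "HOL-Analysis.Analysis"
begin

primrec iter_dderiv :: "'b list \<Rightarrow> ('b::real_normed_vector \<Rightarrow> 'c::real_normed_vector) \<Rightarrow> 'b \<Rightarrow> 'c" where
  "iter_dderiv [] f = f"
| "iter_dderiv (v # vs) f = (\<lambda>x. frechet_derivative (iter_dderiv vs f) (at x) v)"

definition schwartz :: "('b::euclidean_space \<Rightarrow> complex) \<Rightarrow> bool" where
  "schwartz f \<longleftrightarrow>
     (\<forall>vs. set vs \<subseteq> Basis \<longrightarrow>
        (\<forall>x. iter_dderiv vs f differentiable (at x)) \<and>
        (\<forall>N::nat. \<exists>C. \<forall>x. (1 + norm x) ^ N * norm (iter_dderiv vs f x) \<le> C))"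

definition schwartz_seminorm :: "nat \<Rightarrow> ('b::euclidean_space \<Rightarrow> complex) \<Rightarrow> real" where
  "schwartz_seminorm N f =
     (\<Sum>vs\<in>{vs. set vs \<subseteq> (Basis::'b set) \<and> length vs \<le> N}.
        (SUP x. (1 + norm x) ^ N * norm (iter_dderiv vs f x)))"

text \<open>Tempered distributions: continuous linear functionals on the Schwartz space
  (bilinear action F(phi); the sesquilinear bracket is <F,psi> = F(conj psi)).\<close>
definition tempered :: "(('b::euclidean_space \<Rightarrow> complex) \<Rightarrow> complex) \<Rightarrow> bool" where
  "tempered T \<longleftrightarrow>
     (\<forall>\<phi> \<psi> c. schwartz \<phi> \<longrightarrow> schwartz \<psi> \<longrightarrow>
        T (\<lambda>x. \<phi> x + \<psi> x) = T \<phi> + T \<psi> \<and> T (\<lambda>x. c * \<phi> x) = c * T \<phi>) \<and>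
     (\<exists>C N. \<forall>\<phi>. schwartz \<phi> \<longrightarrow> cmod (T \<phi>) \<le> C * schwartz_seminorm N \<phi>)"

definition fun_distr :: "('b::euclidean_space \<Rightarrow> complex) \<Rightarrow> ('b \<Rightarrow> complex) \<Rightarrow> complex" where
  "fun_distr f \<phi> = (LINT y|lebesgue. f y * \<phi> y)"

text \<open>V_g F(x,w) = <F, M_w T_x g> = F(y |-> conj(g(y-x)) e^{-2 pi i y.w}).\<close>
definition stft :: "(('b::euclidean_space \<Rightarrow> complex) \<Rightarrow> complex) \<Rightarrow> ('b \<Rightarrow> complex) \<Rightarrow> 'b \<Rightarrow> 'b \<Rightarrow> complex" where
  "stft F g x \<omega> = F (\<lambda>y. cnj (g (y - x)) * cis (- 2 * pi * (y \<bullet> \<omega>)))"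

text \<open>Fixed window: the Gaussian (modulation spaces do not depend on the window).\<close>
definition gauss :: "'b::euclidean_space \<Rightarrow> complex" where
  "gauss x = complex_of_real (exp (- pi * (norm x)\<^sup>2))"

definition inner_Lp :: "real \<Rightarrow> ('b::euclidean_space \<Rightarrow> 'b \<Rightarrow> complex) \<Rightarrow> 'b \<Rightarrow> ennreal" where
  "inner_Lp p H \<omega> = (\<integral>\<^sup>+ x. ennreal (cmod (H x \<omega>) powr p) \<partial>lebesgue)"

definition mod_space_inf :: "real \<Rightarrow> (('b::euclidean_space \<Rightarrow> complex) \<Rightarrow> complex) \<Rightarrow> bool" where
  "mod_space_inf p F \<longleftrightarrow> tempered F \<and> (SUP \<omega>. inner_Lp p (stft F gauss) \<omega>) < \<infinity>"

definition mod_space :: "real \<Rightarrow> real \<Rightarrow> (('b::euclidean_space \<Rightarrow> complex) \<Rightarrow> complex) \<Rightarrow> bool" where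
  "mod_space p q F \<longleftrightarrow> tempered F \<and>
     (AE \<omega> in lebesgue. inner_Lp p (stft F gauss) \<omega> < \<infinity>) \<and>
     (\<integral>\<^sup>+ \<omega>. ennreal (enn2real (inner_Lp p (stft F gauss) \<omega>) powr (q / p)) \<partial>lebesgue) < \<infinity>"

definition L2 :: "('b::euclidean_space \<Rightarrow> complex) \<Rightarrow> bool" where
  "L2 f \<longleftrightarrow> f \<in> borel_measurable lebesgue \<and> integrable lebesgue (\<lambda>x. (cmod (f x))\<^sup>2)"

definition L2_inner :: "('b::euclidean_space \<Rightarrow> complex) \<Rightarrow> ('b \<Rightarrow> complex) \<Rightarrow> complex" where
  "L2_inner f h = (LINT x|lebesgue. f x * cnj (h x))"

text \<open>Duality <a, Psi> between M^infinity and M^1 realised via the orthogonality relation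
  <a,Psi> = ||g||^{-2} int V_g a(Z) conj(V_g Psi(Z)) dZ.\<close>
definition dual_pair :: "(('b::euclidean_space \<Rightarrow> complex) \<Rightarrow> complex) \<Rightarrow> ('b \<Rightarrow> complex) \<Rightarrow> complex" where
  "dual_pair a \<Psi> =
     (LINT Z|lebesgue. stft a gauss (fst Z) (snd Z) * cnj (stft (fun_distr \<Psi>) gauss (fst Z) (snd Z)))
     / complex_of_real (LINT x|lebesgue. (cmod (gauss (x::'b)))\<^sup>2)"

text \<open><A_a^{phi1,phi2} f, h> = <a, conj(V_{phi1} f) V_{phi2} h>.\<close>
definition loc_form :: "(('a::euclidean_space \<times> 'a \<Rightarrow> complex) \<Rightarrow> complex) \<Rightarrow> ('a \<Rightarrow> complex) \<Rightarrow> ('a \<Rightarrow> complex)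
      \<Rightarrow> ('a \<Rightarrow> complex) \<Rightarrow> ('a \<Rightarrow> complex) \<Rightarrow> complex" where
  "loc_form a \<phi>1 \<phi>2 f h =
     dual_pair a (\<lambda>z. cnj (stft (fun_distr f) \<phi>1 (fst z) (snd z)) * stft (fun_distr h) \<phi>2 (fst z) (snd z))"

definition loc_eigenpair :: "(('a::euclidean_space \<times> 'a \<Rightarrow> complex) \<Rightarrow> complex) \<Rightarrow> ('a \<Rightarrow> complex) \<Rightarrow> ('a \<Rightarrow> complex)
      \<Rightarrow> complex \<Rightarrow> ('a \<Rightarrow> complex) \<Rightarrow> bool" where
  "loc_eigenpair a \<phi>1 \<phi>2 lam f \<longleftrightarrow> L2 f \<and> \<not> (AE x in lebesgue. f x = 0) \<and>
     (\<forall>h. L2 h \<longrightarrow> loc_form a \<phi>1 \<phi>2 f h = lam * L2_inner f h)"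

definition loc_point_spectrum :: "(('a::euclidean_space \<times> 'a \<Rightarrow> complex) \<Rightarrow> complex) \<Rightarrow> ('a \<Rightarrow> complex)
      \<Rightarrow> ('a \<Rightarrow> complex) \<Rightarrow> complex set" where
  "loc_point_spectrum a \<phi>1 \<phi>2 = {lam. \<exists>f. loc_eigenpair a \<phi>1 \<phi>2 lam f}"

end

theory Submission
  imports Defs "HOL-Complex_Analysis.Complex_Analysis"
begin

text \<open>
  Write \<open>V\<close> for the Gaussian STFT of the symbol \<open>a\<close>. Up to an explicit factor \<open>V\<close> is holomorphic along complex
  lines, so \<open>\<bar>V\<bar>\<close> is dominated by its averages over unit balls. Hence \<open>V\<close> has an envelope \<open>b\<close> with
  \<open>\<bar>V(X, \<Omega>)\<bar> \<le> b(X) (1 + \<bar>\<Omega>\<bar>)^K\<close> that is slowly varying, \<open>b(X) \<le> b(Y) (1 + \<bar>X - Y\<bar>)^K\<close>, and satisfies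
  \<open>\<integral> b^p < \<infinity>\<close>.

  Let \<open>f\<close> be an eigenfunction. Testing the eigenvalue equation with time-frequency shifts \<open>h\<close> of a
  Schwartz function \<open>\<psi>\<close> expresses \<open>V\<^sub>\<psi> f(w)\<close> as the integral of \<open>V\<close> against the STFT of
  \<open>cnj (V\<^sub>\<phi>\<^sub>1 f) V\<^sub>\<phi>\<^sub>2 h\<close>. Integration by parts moves derivatives onto the windows only, so this STFT decays rapidly in
  frequency and is concentrated at \<open>w\<close>. Thus if \<open>\<bar>V\<^sub>\<psi> f\<bar> \<le> C b^k\<close> holds for every Schwartz window \<open>\<psi>\<close>, it also holds with
  \<open>k + 1\<close> in place of \<open>k\<close>. The case \<open>k = 0\<close> is the Cauchy-Schwarz inequality, so \<open>V\<^sub>\<psi> f\<close> is bounded by every power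
  of \<open>b\<close> and therefore lies in every \<open>L^\<gamma>\<close>.
\<close>

subsection \<open>Schwartz functions\<close>

text \<open>The hypothesis bounds the integral over \<open>X\<close> for each fixed \<Omega>,
  whereas the induction needs the supremum over \<Omega> inside the integral. Holomorphy makes this
  exchange possible: it controls a point value by a local average of |V|, and from there by an
  integral of |V|^p also when p < 1, where convexity and duality are missing. The cost is polynomial
  growth in \<Omega>, which the rapid decay of the other factor of the pairing absorbs.

  Slow variation plays the same role in position. It replaces b(z)^k by b(w)^k at the price of a
  power of 1 + |z - w|, again absorbed by rapid decay. All estimates are thus pointwise in w, and
  one pairing yields k factors b(w) from the eigenfunction and one more from the symbol.

  Since \<open>f\<close> is merely square integrable, every derivative has to fall on a window, and
  the windows change from step to step. Hence the bound must be claimed for all Schwartz windows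
  simultaneously.\<close>

definition wt :: "'b::real_normed_vector \<Rightarrow> real" where
  "wt x = 1 + norm x"

lemma wt_ge_1: "1 \<le> wt x"
  by (simp add: wt_def)

lemma wt_pos [simp]: "0 < wt x"
  by (simp add: wt_def add_pos_nonneg)

lemma wt_nonneg [simp]: "0 \<le> wt x"
  by (simp add: less_imp_le)

lemma wt_nonzero [simp]: "wt x \<noteq> 0"
  using wt_pos[of x] by linarith

lemma wt_minus [simp]: "wt (- x) = wt x"
  by (simp add: wt_def)

lemma wt_minus_commute: "wt (x - y) = wt (y - x)"
  by (simp add: wt_def norm_minus_commute)

lemma norm_le_wt: "norm x \<le> wt x"
  by (simp add: wt_def)

lemma wt_add_le: "wt (x + y) \<le> wt x * wt y"
  using norm_triangle_ineq[of x y] mult_nonneg_nonneg[OF norm_ge_zero norm_ge_zero, of x y]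
  unfolding wt_def distrib_left distrib_right by linarith

text \<open>Peetre's inequality. Every later change of centre in a polynomial weight, paid for by a
  weight in the difference of the centres, is an instance.\<close>

lemma wt_le_mult_diff: "wt x \<le> wt y * wt (x - y)"
  using wt_add_le[of y "x - y"] by simp

lemma wt_power_le_mult_diff: "wt x ^ N \<le> wt y ^ N * wt (x - y) ^ N"
  by (metis wt_le_mult_diff power_mono power_mult_distrib wt_nonneg)

lemma wt_power_pos: "0 < wt x ^ n"
  by simp

lemma borel_measurable_wt [measurable]: "wt \<in> borel_measurable borel"
  unfolding wt_def by measurable

lemma continuous_on_wt [continuous_intros]:
  "continuous_on S f \<Longrightarrow> continuous_on S (\<lambda>x. wt (f x))"
  unfolding wt_def by (intro continuous_intros)

lemma abs_inner_Basis_le_wt: "v \<in> Basis \<Longrightarrow> \<bar>x \<bullet> v\<bar> \<le> wt x"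
  using Basis_le_norm[of v x] by (simp add: wt_def)

text \<open>\<open>schwartz\<close> refers to all iterated derivatives, which have no convenient
  closed form for products. Instead one exhibits a class \<open>Q\<close> of rapidly decaying
  functions that is stable under differentiation along basis vectors; induction on the list of
  directions keeps every iterated derivative in \<open>Q\<close>.\<close>

lemma schwartz_coinduct:
  assumes "Q f"
    and deriv: "\<And>q. Q q \<Longrightarrow> \<exists>D. (\<forall>x. (q has_derivative D x) (at x)) \<and> (\<forall>v\<in>Basis. Q (\<lambda>x. D x v))"
    and bound: "\<And>q N. Q q \<Longrightarrow> \<exists>C. \<forall>x. wt x ^ N * norm (q x) \<le> C"
  shows "schwartz f"
proof -
  have diff: "q differentiable (at x)" if "Q q" for q x
    using deriv[OF that] differentiable_def by blast
  have step: "Q (\<lambda>x. frechet_derivative q (at x) v)" if q: "Q q" and v: "v \<in> Basis" for q v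
  proof -
    obtain D where D: "\<And>x. (q has_derivative D x) (at x)" and DQ: "\<forall>v\<in>Basis. Q (\<lambda>x. D x v)"
      using deriv[OF q] by blast
    have "frechet_derivative q (at x) = D x" for x
      by (rule frechet_derivative_at[OF D, symmetric])
    then show ?thesis using DQ v by simp
  qed
  have Q: "Q (iter_dderiv vs f)" if "set vs \<subseteq> Basis" for vs
    using that by (induction vs) (auto simp: assms(1) intro: step)
  show ?thesis
    unfolding schwartz_def using Q diff bound[unfolded wt_def] by blast
qed

lemma schwartz_differentiable: "schwartz f \<Longrightarrow> f differentiable (at x)"
  unfolding schwartz_def by (metis empty_set empty_subsetI iter_dderiv.simps(1))

lemma schwartz_decay:
  assumes "schwartz f"
  obtains C where "0 \<le> C" "\<And>x. norm (f x) \<le> C / wt x ^ N"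
proof -
  obtain C where C: "\<And>x. wt x ^ N * norm (f x) \<le> C"
    using assms unfolding schwartz_def wt_def
    by (metis empty_set empty_subsetI iter_dderiv.simps(1))
  have "0 \<le> C"
    using C[of 0] by (rule order_trans[rotated]) simp
  moreover have "norm (f x) \<le> C / wt x ^ N" for x
    using C[of x] by (simp add: pos_le_divide_eq mult.commute)
  ultimately show ?thesis using that by blast
qed

text \<open>The head of the list is differentiated last, an appended direction first. This
  identifies the derivatives of a derivative of \<open>f\<close> with derivatives of
  \<open>f\<close> itself.\<close>

lemma schwartz_iter_dderiv_snoc:
  "iter_dderiv (vs @ [v]) f = iter_dderiv vs (\<lambda>x. frechet_derivative f (at x) v)"
  by (induction vs) auto

lemma schwartz_dderiv:
  assumes "schwartz f" "v \<in> Basis"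
  shows "schwartz (\<lambda>x. frechet_derivative f (at x) v)"
  unfolding schwartz_def
proof (intro allI impI)
  fix vs :: "'a list" assume "set vs \<subseteq> Basis"
  then have "set (vs @ [v]) \<subseteq> Basis" using assms by auto
  then show "(\<forall>x. iter_dderiv vs (\<lambda>x. frechet_derivative f (at x) v) differentiable at x) \<and>
     (\<forall>N. \<exists>C. \<forall>x. (1 + norm x) ^ N * cmod (iter_dderiv vs (\<lambda>x. frechet_derivative f (at x) v) x) \<le> C)"
    using assms(1) unfolding schwartz_def schwartz_iter_dderiv_snoc[symmetric] by blast
qed

lemma schwartz_has_derivative:
  "schwartz f \<Longrightarrow> (f has_derivative frechet_derivative f (at x)) (at x)"
  using schwartz_differentiable frechet_derivative_works by blast

lemma schwartz_continuous_on: "schwartz f \<Longrightarrow> continuous_on S f"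
  by (meson continuous_at_imp_continuous_on differentiable_imp_continuous_within schwartz_differentiable)

lemma schwartz_borel [measurable_dest]: "schwartz f \<Longrightarrow> f \<in> borel_measurable borel"
  by (simp add: borel_measurable_continuous_onI schwartz_continuous_on)

lemma schwartz_add:
  assumes "schwartz f" "schwartz g"
  shows "schwartz (\<lambda>x. f x + g x)"
proof (rule schwartz_coinduct[where Q = "\<lambda>q. \<exists>f g. schwartz f \<and> schwartz g \<and> q = (\<lambda>x. f x + g x)"])
  show "\<exists>f' g'. schwartz f' \<and> schwartz g' \<and> (\<lambda>x. f x + g x) = (\<lambda>x. f' x + g' x)"
    using assms by blast
next
  fix q :: "'a \<Rightarrow> complex"
  assume "\<exists>f g. schwartz f \<and> schwartz g \<and> q = (\<lambda>x. f x + g x)"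
  then obtain f g where fg: "schwartz f" "schwartz g" and q: "q = (\<lambda>x. f x + g x)" by blast
  show "\<exists>D. (\<forall>x. (q has_derivative D x) (at x)) \<and>
      (\<forall>v\<in>Basis. \<exists>f g. schwartz f \<and> schwartz g \<and> (\<lambda>x. D x v) = (\<lambda>x. f x + g x))"
    unfolding q
    by (intro exI[of _ "\<lambda>x h. frechet_derivative f (at x) h + frechet_derivative g (at x) h"] conjI allI
        has_derivative_add schwartz_has_derivative fg) (use schwartz_dderiv fg in blast)
  fix N
  obtain C where C: "\<And>x. norm (f x) \<le> C / wt x ^ N" using schwartz_decay[OF fg(1), of N] by blast
  obtain D where D: "\<And>x. norm (g x) \<le> D / wt x ^ N" using schwartz_decay[OF fg(2), of N] by blast
  have "wt x ^ N * norm (q x) \<le> C + D" for x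
  proof -
    have "norm (q x) \<le> C / wt x ^ N + D / wt x ^ N"
      unfolding q using norm_triangle_ineq[of "f x" "g x"] C[of x] D[of x] by linarith
    then show ?thesis by (simp add: field_simps add_divide_distrib[symmetric])
  qed
  then show "\<exists>C. \<forall>x. wt x ^ N * norm (q x) \<le> C" by blast
qed

lemma schwartz_bounded_linear:
  assumes T: "bounded_linear T" and f: "schwartz f"
  shows "schwartz (\<lambda>x. T (f x))"
proof (rule schwartz_coinduct[where Q = "\<lambda>q. \<exists>f. schwartz f \<and> q = (\<lambda>x. T (f x))"])
  show "\<exists>f'. schwartz f' \<and> (\<lambda>x. T (f x)) = (\<lambda>x. T (f' x))" using f by blast
next
  fix q :: "'a \<Rightarrow> complex"
  assume "\<exists>f. schwartz f \<and> q = (\<lambda>x. T (f x))"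
  then obtain f where f: "schwartz f" and q: "q = (\<lambda>x. T (f x))" by blast
  show "\<exists>D. (\<forall>x. (q has_derivative D x) (at x)) \<and>
      (\<forall>v\<in>Basis. \<exists>f. schwartz f \<and> (\<lambda>x. D x v) = (\<lambda>x. T (f x)))"
    unfolding q
    by (intro exI[of _ "\<lambda>x h. T (frechet_derivative f (at x) h)"] conjI allI
        bounded_linear.has_derivative[OF T] schwartz_has_derivative f) (use schwartz_dderiv f in blast)
  fix N
  obtain C where C: "\<And>x. norm (f x) \<le> C / wt x ^ N" using schwartz_decay[OF f, of N] by blast
  obtain K where K: "0 \<le> K" "\<And>x. norm (T x) \<le> norm x * K" using bounded_linear.nonneg_bounded[OF T] by blast
  have "wt x ^ N * norm (q x) \<le> C * K" for x
  proof -
    have "norm (q x) \<le> C / wt x ^ N * K"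
      unfolding q by (rule order_trans[OF K(2) mult_right_mono[OF C K(1)]])
    then show ?thesis by (simp add: field_simps)
  qed
  then show "\<exists>C. \<forall>x. wt x ^ N * norm (q x) \<le> C" by blast
qed

lemma schwartz_cmult: "schwartz f \<Longrightarrow> schwartz (\<lambda>x. c * f x)"
  by (rule schwartz_bounded_linear[OF bounded_linear_mult_right])

lemma schwartz_cnj: "schwartz f \<Longrightarrow> schwartz (\<lambda>x. cnj (f x))"
  by (rule schwartz_bounded_linear[OF bounded_linear_cnj])

text \<open>The products alone are not stable under differentiation, because the Leibniz rule leaves
  a term without the coordinate. \<open>Q\<close> therefore carries an additional Schwartz summand.
  The coordinate costs one power of the weight, hence the decay of order \<open>Suc N\<close> for
  \<open>f\<close>.\<close>

lemma schwartz_mult_coord: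
  assumes "schwartz f"
  shows "schwartz (\<lambda>x. complex_of_real (x \<bullet> b) * f x)"
proof (rule schwartz_coinduct[where Q = "\<lambda>q. \<exists>f g. schwartz f \<and> schwartz g \<and>
      q = (\<lambda>x. complex_of_real (x \<bullet> b) * f x + g x)"])
  have "schwartz (\<lambda>x. 0 * f x)" using schwartz_cmult assms by blast
  moreover have "(\<lambda>x. complex_of_real (x \<bullet> b) * f x) = (\<lambda>x. complex_of_real (x \<bullet> b) * f x + 0 * f x)"
    by simp
  ultimately show "\<exists>f' g. schwartz f' \<and> schwartz g \<and>
     (\<lambda>x. complex_of_real (x \<bullet> b) * f x) = (\<lambda>x. complex_of_real (x \<bullet> b) * f' x + g x)"
    using assms by blast
next
  fix q :: "'a \<Rightarrow> complex"
  assume "\<exists>f g. schwartz f \<and> schwartz g \<and> q = (\<lambda>x. complex_of_real (x \<bullet> b) * f x + g x)"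
  then obtain f g where fg: "schwartz f" "schwartz g"
    and q: "q = (\<lambda>x. complex_of_real (x \<bullet> b) * f x + g x)" by blast
  define D where "D = (\<lambda>x h. complex_of_real (x \<bullet> b) * frechet_derivative f (at x) h
      + (complex_of_real (h \<bullet> b) * f x + frechet_derivative g (at x) h))"
  have "(q has_derivative D x) (at x)" for x
    unfolding q D_def add.assoc[symmetric] by (intro derivative_intros schwartz_has_derivative fg)
  moreover have "schwartz (\<lambda>x. complex_of_real (v \<bullet> b) * f x + frechet_derivative g (at x) v)" if "v \<in> Basis" for v
    by (intro schwartz_add schwartz_cmult schwartz_dderiv fg that)
  ultimately show "\<exists>D. (\<forall>x. (q has_derivative D x) (at x)) \<and> (\<forall>v\<in>Basis. \<exists>f g. schwartz f \<and> schwartz g \<and>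
      (\<lambda>x. D x v) = (\<lambda>x. complex_of_real (x \<bullet> b) * f x + g x))"
    using schwartz_dderiv[OF fg(1)] by (intro exI[of _ D]) (auto simp: D_def)
  fix N
  obtain C where C: "\<And>x. norm (f x) \<le> C / wt x ^ Suc N" using schwartz_decay[OF fg(1), of "Suc N"] by blast
  obtain D where D: "\<And>x. norm (g x) \<le> D / wt x ^ N" using schwartz_decay[OF fg(2), of N] by blast
  have "wt x ^ N * norm (q x) \<le> norm b * C + D" for x
  proof -
    have "cmod (complex_of_real (x \<bullet> b)) \<le> wt x * norm b"
      using Cauchy_Schwarz_ineq2[of x b] mult_right_mono[OF norm_le_wt[of x], of "norm b"]
      by simp
    then have "norm (complex_of_real (x \<bullet> b) * f x) \<le> (wt x * norm b) * (C / wt x ^ Suc N)"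
      unfolding norm_mult by (intro mult_mono C) auto
    also have "\<dots> = norm b * C / wt x ^ N" by (simp add: field_simps)
    finally have "norm (q x) \<le> norm b * C / wt x ^ N + D / wt x ^ N"
      unfolding q using norm_triangle_ineq[of "complex_of_real (x \<bullet> b) * f x" "g x"] D[of x] by linarith
    then show ?thesis by (simp add: field_simps add_divide_distrib[symmetric])
  qed
  then show "\<exists>C. \<forall>x. wt x ^ N * norm (q x) \<le> C" by blast
qed

lemma schwartz_seminorm_le:
  fixes f :: "'b::euclidean_space \<Rightarrow> complex"
  assumes "\<And>vs x. set vs \<subseteq> Basis \<Longrightarrow> length vs \<le> N \<Longrightarrow> wt x ^ N * norm (iter_dderiv vs f x) \<le> c vs"
  shows "schwartz_seminorm N f \<le> (\<Sum>vs\<in>{vs. set vs \<subseteq> (Basis::'b set) \<and> length vs \<le> N}. c vs)"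
  unfolding schwartz_seminorm_def
proof (rule sum_mono)
  fix vs assume "vs \<in> {vs. set vs \<subseteq> (Basis::'b set) \<and> length vs \<le> N}"
  then show "(SUP x. (1 + norm x) ^ N * cmod (iter_dderiv vs f x)) \<le> c vs"
    using assms[of vs] unfolding wt_def by (intro cSUP_least) auto
qed

lemma schwartz_seminorm_ge:
  fixes f :: "'b::euclidean_space \<Rightarrow> complex"
  assumes "schwartz f"
  shows "wt x ^ N * norm (f x) \<le> schwartz_seminorm N f"
proof -
  let ?S = "{vs. set vs \<subseteq> (Basis::'b set) \<and> length vs \<le> N}"
  let ?s = "\<lambda>vs. (SUP x. (1 + norm x) ^ N * norm (iter_dderiv vs f x))"
  have bdd: "bdd_above (range (\<lambda>x. (1 + norm x) ^ N * norm (iter_dderiv vs f x)))" if "vs \<in> ?S" for vs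
    using assms that unfolding schwartz_def bdd_above_def by (simp; metis)
  have nn: "0 \<le> ?s vs" if "vs \<in> ?S" for vs
    by (rule cSUP_upper2[OF bdd[OF that], of 0]) auto
  have "wt x ^ N * norm (f x) \<le> ?s []"
    using cSUP_upper[OF UNIV_I bdd[of "[]"]] by (simp add: wt_def)
  also have "\<dots> \<le> (\<Sum>vs\<in>?S. ?s vs)"
    using member_le_sum[of "[]" ?S ?s] nn finite_lists_length_le[OF finite_Basis, of N] by auto
  finally show ?thesis unfolding schwartz_seminorm_def .
qed

subsection \<open>Uniform Schwartz bounds for parametrised families\<close>

text \<open>Seminorm bounds that are uniform in a parameter \<open>i\<close> are needed for Gaussian families. Their iterated
  derivatives are never computed: it suffices that they stay in the span of finitely many kinds of
  base functions \<open>B\<close> under products with multipliers \<open>M\<close> of at most linear growth.\<close>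

inductive gen :: "('i \<Rightarrow> 'b \<Rightarrow> complex) set \<Rightarrow> ('i \<Rightarrow> 'b \<Rightarrow> complex) set \<Rightarrow> ('i \<Rightarrow> 'b \<Rightarrow> complex) \<Rightarrow> bool"
  for B M where
  gen_base: "g \<in> B \<Longrightarrow> gen B M g"
| gen_add: "gen B M p \<Longrightarrow> gen B M q \<Longrightarrow> gen B M (\<lambda>i y. p i y + q i y)"
| gen_mult: "m \<in> M \<Longrightarrow> gen B M q \<Longrightarrow> gen B M (\<lambda>i y. m i y * q i y)"

text \<open>\<open>W\<close> may enter a bound to any power, \<open>w\<close> only to the first.
  Growth estimates take for \<open>W\<close> a weight in the parameter and \<open>w = 1\<close>;
  remainder estimates take \<open>W = 1\<close> and a small \<open>w\<close>, whose order of
  smallness then passes unchanged to every Schwartz seminorm.\<close>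

locale gen_family =
  fixes I :: "'i set" and W w :: "'i \<Rightarrow> real"
    and B M :: "('i \<Rightarrow> 'b::euclidean_space \<Rightarrow> complex) set"
  assumes W_ge_1: "i \<in> I \<Longrightarrow> 1 \<le> W i"
    and w_nonneg: "i \<in> I \<Longrightarrow> 0 \<le> w i"
    and base_deriv: "g \<in> B \<Longrightarrow> \<exists>D. (\<forall>i\<in>I. \<forall>y. (g i has_derivative D i y) (at y)) \<and>
          (\<forall>v\<in>Basis. \<exists>q. gen B M q \<and> (\<forall>i\<in>I. \<forall>y. D i y v = q i y))"
    and mult_deriv: "m \<in> M \<Longrightarrow> \<exists>D. (\<forall>i\<in>I. \<forall>y. (m i has_derivative D i y) (at y)) \<and>
          (\<forall>v\<in>Basis. \<exists>l\<in>M. \<forall>i\<in>I. \<forall>y. D i y v = l i y)"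
    and base_bound: "g \<in> B \<Longrightarrow> \<exists>C n. \<forall>i\<in>I. \<forall>y. wt y ^ N * norm (g i y) \<le> C * W i ^ n * w i"
    and mult_bound: "m \<in> M \<Longrightarrow> \<exists>C n. \<forall>i\<in>I. \<forall>y. norm (m i y) \<le> C * W i ^ n * wt y"
begin

lemma gen_deriv:
  "gen B M q \<Longrightarrow> \<exists>D. (\<forall>i\<in>I. \<forall>y. (q i has_derivative D i y) (at y)) \<and>
          (\<forall>v\<in>Basis. \<exists>q'. gen B M q' \<and> (\<forall>i\<in>I. \<forall>y. D i y v = q' i y))"
proof (induction rule: gen.induct)
  case (gen_base g)
  then show ?case by (rule base_deriv)
next
  case (gen_add p q)
  then obtain D E where D: "\<forall>i\<in>I. \<forall>y. (p i has_derivative D i y) (at y)"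
      "\<forall>v\<in>Basis. \<exists>q'. gen B M q' \<and> (\<forall>i\<in>I. \<forall>y. D i y v = q' i y)"
    and E: "\<forall>i\<in>I. \<forall>y. (q i has_derivative E i y) (at y)"
      "\<forall>v\<in>Basis. \<exists>q'. gen B M q' \<and> (\<forall>i\<in>I. \<forall>y. E i y v = q' i y)"
    by blast
  show ?case
  proof (intro exI[of _ "\<lambda>i y h. D i y h + E i y h"] conjI ballI allI)
    fix i y assume "i \<in> I"
    then show "((\<lambda>y. p i y + q i y) has_derivative (\<lambda>h. D i y h + E i y h)) (at y)"
      using D(1) E(1) by (intro has_derivative_add) auto
  next
    fix v :: 'b assume "v \<in> Basis"
    then obtain p' q' where "gen B M p'" "\<forall>i\<in>I. \<forall>y. D i y v = p' i y" "gen B M q'" "\<forall>i\<in>I. \<forall>y. E i y v = q' i y"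
      using D(2) E(2) by meson
    then show "\<exists>q'. gen B M q' \<and> (\<forall>i\<in>I. \<forall>y. D i y v + E i y v = q' i y)"
      by (intro exI[of _ "\<lambda>i y. p' i y + q' i y"] conjI gen.gen_add) auto
  qed
next
  case (gen_mult m q)
  obtain D where D: "\<forall>i\<in>I. \<forall>y. (m i has_derivative D i y) (at y)"
      "\<forall>v\<in>Basis. \<exists>l\<in>M. \<forall>i\<in>I. \<forall>y. D i y v = l i y"
    using mult_deriv[OF gen_mult.hyps(1)] by blast
  obtain E where E: "\<forall>i\<in>I. \<forall>y. (q i has_derivative E i y) (at y)"
      "\<forall>v\<in>Basis. \<exists>q'. gen B M q' \<and> (\<forall>i\<in>I. \<forall>y. E i y v = q' i y)"
    using gen_mult.IH by blast
  show ?case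
  proof (intro exI[of _ "\<lambda>i y h. m i y * E i y h + D i y h * q i y"] conjI ballI allI)
    fix i y assume "i \<in> I"
    then show "((\<lambda>y. m i y * q i y) has_derivative (\<lambda>h. m i y * E i y h + D i y h * q i y)) (at y)"
      using D(1) E(1) by (intro has_derivative_mult) auto
  next
    fix v :: 'b assume "v \<in> Basis"
    then obtain l q' where "l \<in> M" "\<forall>i\<in>I. \<forall>y. D i y v = l i y" "gen B M q'" "\<forall>i\<in>I. \<forall>y. E i y v = q' i y"
      using D(2) E(2) by meson
    then show "\<exists>q'. gen B M q' \<and> (\<forall>i\<in>I. \<forall>y. m i y * E i y v + D i y v * q i y = q' i y)"
      using gen_mult
      by (intro exI[of _ "\<lambda>i y. m i y * q' i y + l i y * q i y"] conjI gen.gen_add gen.gen_mult) auto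
  qed
qed

text \<open>The induction has to be uniform in \<open>N\<close>: a multiplier grows like
  \<open>wt y\<close>, so the bound of a product with weight exponent \<open>N\<close> rests on the
  bound of the other factor with exponent \<open>N + 1\<close>.\<close>

lemma gen_bound:
  "gen B M q \<Longrightarrow> \<exists>C n. 0 \<le> C \<and> (\<forall>i\<in>I. \<forall>y. wt y ^ N * norm (q i y) \<le> C * W i ^ n * w i)"
proof (induction arbitrary: N rule: gen.induct)
  case (gen_base g)
  then obtain C n where C: "\<forall>i\<in>I. \<forall>y. wt y ^ N * norm (g i y) \<le> C * W i ^ n * w i"
    using base_bound by blast
  have "wt y ^ N * norm (g i y) \<le> \<bar>C\<bar> * W i ^ n * w i" if "i \<in> I" for i y
  proof -
    have "C * W i ^ n * w i \<le> \<bar>C\<bar> * W i ^ n * w i"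
      using W_ge_1[OF that] w_nonneg[OF that] by (intro mult_right_mono) auto
    then show ?thesis using C that order_trans by blast
  qed
  then show ?case by (intro exI[of _ "\<bar>C\<bar>"] exI[of _ n]) auto
next
  case (gen_add p q)
  obtain C n where C: "0 \<le> C" "\<forall>i\<in>I. \<forall>y. wt y ^ N * norm (p i y) \<le> C * W i ^ n * w i"
    using gen_add.IH(1) by blast
  obtain D k where D: "0 \<le> D" "\<forall>i\<in>I. \<forall>y. wt y ^ N * norm (q i y) \<le> D * W i ^ k * w i"
    using gen_add.IH(2) by blast
  have "wt y ^ N * norm (p i y + q i y) \<le> (C + D) * W i ^ (n + k) * w i" if i: "i \<in> I" for i y
  proof -
    have 1: "C * W i ^ n * w i \<le> C * W i ^ (n + k) * w i"
      using W_ge_1[OF i] w_nonneg[OF i] C(1) by (intro mult_right_mono mult_left_mono power_increasing) auto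
    have 2: "D * W i ^ k * w i \<le> D * W i ^ (n + k) * w i"
      using W_ge_1[OF i] w_nonneg[OF i] D(1) by (intro mult_right_mono mult_left_mono power_increasing) auto
    have "wt y ^ N * norm (p i y + q i y) \<le> wt y ^ N * norm (p i y) + wt y ^ N * norm (q i y)"
      unfolding distrib_left[symmetric] by (intro mult_left_mono norm_triangle_ineq) simp
    also have "\<dots> \<le> C * W i ^ (n + k) * w i + D * W i ^ (n + k) * w i"
      using C(2) D(2) i 1 2 by (meson add_mono order_trans)
    finally show ?thesis by (simp add: algebra_simps)
  qed
  then show ?case using C D by (intro exI[of _ "C + D"] exI[of _ "n + k"]) auto
next
  case (gen_mult m q)
  obtain C n where C: "\<forall>i\<in>I. \<forall>y. norm (m i y) \<le> C * W i ^ n * wt y"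
    using mult_bound[OF gen_mult.hyps(1)] by blast
  obtain D k where D: "0 \<le> D" "\<forall>i\<in>I. \<forall>y. wt y ^ Suc N * norm (q i y) \<le> D * W i ^ k * w i"
    using gen_mult.IH[of "Suc N"] by blast
  have "wt y ^ N * norm (m i y * q i y) \<le> (\<bar>C\<bar> * D) * W i ^ (n + k) * w i" if i: "i \<in> I" for i y
  proof -
    have Wn: "0 \<le> W i ^ n" using W_ge_1[OF i] by simp
    have "norm (m i y) \<le> \<bar>C\<bar> * W i ^ n * wt y"
      by (rule order_trans[OF C[rule_format, OF i]]) (intro mult_right_mono, auto simp: Wn)
    then have "wt y ^ N * norm (m i y * q i y) \<le> wt y ^ N * ((\<bar>C\<bar> * W i ^ n * wt y) * norm (q i y))"
      unfolding norm_mult by (intro mult_left_mono mult_right_mono) auto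
    also have "\<dots> = \<bar>C\<bar> * W i ^ n * (wt y ^ Suc N * norm (q i y))" by simp
    also have "\<dots> \<le> \<bar>C\<bar> * W i ^ n * (D * W i ^ k * w i)"
      using D(2) i Wn by (intro mult_left_mono) auto
    finally show ?thesis by (simp add: power_add algebra_simps)
  qed
  then show ?case using D by (intro exI[of _ "\<bar>C\<bar> * D"] exI[of _ "n + k"]) auto
qed

lemma gen_iter_dderiv:
  assumes "gen B M q" "set vs \<subseteq> Basis"
  shows "\<exists>q'. gen B M q' \<and> (\<forall>i\<in>I. iter_dderiv vs (q i) = q' i)"
  using assms(2)
proof (induction vs)
  case Nil
  then show ?case using assms(1) by auto
next
  case (Cons v vs)
  then obtain q1 where q1: "gen B M q1" "\<forall>i\<in>I. iter_dderiv vs (q i) = q1 i" by auto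
  obtain D where D: "\<forall>i\<in>I. \<forall>y. (q1 i has_derivative D i y) (at y)"
      "\<forall>v\<in>Basis. \<exists>q'. gen B M q' \<and> (\<forall>i\<in>I. \<forall>y. D i y v = q' i y)"
    using gen_deriv[OF q1(1)] by blast
  obtain q' where q': "gen B M q'" "\<forall>i\<in>I. \<forall>y. D i y v = q' i y" using D(2) Cons by auto
  have "iter_dderiv (v # vs) (q i) = q' i" if "i \<in> I" for i
  proof -
    have "frechet_derivative (q1 i) (at y) = D i y" for y
      by (rule frechet_derivative_at[symmetric]) (use D(1) that in blast)
    then show ?thesis using q1(2) q'(2) that by auto
  qed
  then show ?case using q' by blast
qed

lemma gen_schwartz:
  assumes "gen B M q" "i \<in> I"
  shows "schwartz (q i)"
proof (rule schwartz_coinduct[where Q = "\<lambda>f. \<exists>q. gen B M q \<and> f = q i"])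
  show "\<exists>q'. gen B M q' \<and> q i = q' i" using assms by blast
next
  fix f assume "\<exists>q. gen B M q \<and> f = q i"
  then obtain q where q: "gen B M q" "f = q i" by blast
  obtain D where D: "\<forall>i\<in>I. \<forall>y. (q i has_derivative D i y) (at y)"
      "\<forall>v\<in>Basis. \<exists>q'. gen B M q' \<and> (\<forall>i\<in>I. \<forall>y. D i y v = q' i y)"
    using gen_deriv[OF q(1)] by blast
  have "\<exists>q'. gen B M q' \<and> (\<lambda>x. D i x v) = q' i" if "v \<in> Basis" for v
    using D(2) that assms(2) by (meson ext)
  then show "\<exists>D. (\<forall>x. (f has_derivative D x) (at x)) \<and> (\<forall>v\<in>Basis. \<exists>q. gen B M q \<and> (\<lambda>x. D x v) = q i)"
    using D(1) assms(2) unfolding q(2) by blast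
  show "\<exists>C. \<forall>x. wt x ^ N * norm (f x) \<le> C" for N
    using gen_bound[OF q(1), of N] assms(2) unfolding q(2) by blast
qed

lemma gen_seminorm:
  assumes "gen B M q"
  shows "\<exists>C n. 0 \<le> C \<and> (\<forall>i\<in>I. schwartz_seminorm N (q i) \<le> C * W i ^ n * w i)"
proof -
  let ?S = "{vs. set vs \<subseteq> (Basis::'b set) \<and> length vs \<le> N}"
  have fin: "finite ?S" by (rule finite_lists_length_le) simp
  have "\<exists>C n. 0 \<le> C \<and> (\<forall>i\<in>I. \<forall>y. wt y ^ N * norm (iter_dderiv vs (q i) y) \<le> C * W i ^ n * w i)"
    if vs: "vs \<in> ?S" for vs
  proof -
    obtain q' where q': "gen B M q'" "\<forall>i\<in>I. iter_dderiv vs (q i) = q' i"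
      using gen_iter_dderiv[OF assms] vs by blast
    with gen_bound[OF q'(1), of N] show ?thesis by auto
  qed
  then have "\<forall>vs\<in>?S. \<exists>p. 0 \<le> fst p \<and>
      (\<forall>i\<in>I. \<forall>y. wt y ^ N * norm (iter_dderiv vs (q i) y) \<le> fst p * W i ^ snd p * w i)"
    by fastforce
  from bchoice[OF this] obtain p where p: "\<forall>vs\<in>?S. 0 \<le> fst (p vs) \<and>
      (\<forall>i\<in>I. \<forall>y. wt y ^ N * norm (iter_dderiv vs (q i) y) \<le> fst (p vs) * W i ^ snd (p vs) * w i)"
    by blast
  define C where "C = (\<lambda>vs. fst (p vs))"
  define n where "n = (\<lambda>vs. snd (p vs))"
  have Cn: "0 \<le> C vs \<and> (\<forall>i\<in>I. \<forall>y. wt y ^ N * norm (iter_dderiv vs (q i) y) \<le> C vs * W i ^ n vs * w i)"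
    if "vs \<in> ?S" for vs
    using p that unfolding C_def n_def by blast
  define m where "m = (\<Sum>vs\<in>?S. n vs)"
  have "schwartz_seminorm N (q i) \<le> (\<Sum>vs\<in>?S. C vs) * W i ^ m * w i" if i: "i \<in> I" for i
  proof -
    have "schwartz_seminorm N (q i) \<le> (\<Sum>vs\<in>?S. C vs * W i ^ m * w i)"
    proof (rule schwartz_seminorm_le)
      fix vs and x :: 'b assume "set vs \<subseteq> (Basis :: 'b set)" "length vs \<le> N"
      then have vs: "vs \<in> ?S" by simp
      have "n vs \<le> m" unfolding m_def using vs fin by (intro member_le_sum) auto
      then have "C vs * W i ^ n vs * w i \<le> C vs * W i ^ m * w i"
        using W_ge_1[OF i] w_nonneg[OF i] Cn[OF vs]
        by (intro mult_right_mono mult_left_mono power_increasing) auto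
      then show "wt x ^ N * cmod (iter_dderiv vs (q i) x) \<le> C vs * W i ^ m * w i"
        using Cn[OF vs] i order_trans by blast
    qed
    then show ?thesis by (simp add: sum_distrib_right)
  qed
  moreover have "0 \<le> (\<Sum>vs\<in>?S. C vs)" using Cn by (intro sum_nonneg) auto
  ultimately show ?thesis by blast
qed

end

lemma has_derivative_cexp:
  assumes "(g has_derivative g') (at x)"
  shows "((\<lambda>x. exp (g x :: complex)) has_derivative (\<lambda>h. exp (g x) * g' h)) (at x)"
  using has_derivative_compose[OF assms, of exp "(*) (exp (g x))"] DERIV_exp[of "g x"]
  unfolding has_field_derivative_def by (simp add: o_def)

lemma gauss_shift_cis:
  "gauss (y - X) * cis (- 2 * pi * (y \<bullet> \<Omega>)) =
    exp (- of_real pi * of_real ((y - X) \<bullet> (y - X)) - 2 * of_real pi * \<i> * of_real (y \<bullet> \<Omega>))"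
  unfolding gauss_def cis_conv_exp exp_of_real[symmetric] exp_add[symmetric] power2_norm_eq_inner
  by (simp add: algebra_simps)

text \<open>With m = N + c, the inequality 1 + r \<le> exp r reduces the claim to m r - \<pi> r^2
  \<le> m^2, which follows from \<pi> \<ge> 1 and the nonnegativity of (m - r)^2 + m^2 +
  r^2.\<close>

lemma poly_exp_gauss_bound:
  fixes r c :: real
  assumes "0 \<le> r" "0 \<le> c"
  shows "(1 + r) ^ N * exp (c * r - pi * r\<^sup>2) \<le> exp ((real N + c)\<^sup>2)"
proof -
  have "(1 + r) ^ N \<le> exp r ^ N"
    using assms exp_ge_add_one_self[of r] by (intro power_mono) auto
  then have "(1 + r) ^ N * exp (c * r - pi * r\<^sup>2) \<le> exp (N * r) * exp (c * r - pi * r\<^sup>2)"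
    by (intro mult_right_mono) (auto simp: exp_of_nat_mult)
  also have "\<dots> = exp ((real N + c) * r - pi * r\<^sup>2)"
    by (simp add: exp_add[symmetric] algebra_simps)
  also have "\<dots> \<le> exp ((real N + c)\<^sup>2)"
  proof -
    have "1 * r\<^sup>2 \<le> pi * r\<^sup>2" using pi_gt3 by (intro mult_right_mono) auto
    moreover have "0 \<le> ((real N + c) - r)\<^sup>2 + ((real N + c))\<^sup>2 + r\<^sup>2" by simp
    ultimately show ?thesis by (simp add: power2_eq_square algebra_simps)
  qed
  finally show ?thesis .
qed

subsection \<open>The Gaussian STFT of a tempered distribution\<close>

text \<open>The test function to which a distribution is applied in its Gaussian STFT; the Gaussian
  is real, so no conjugate appears. Writing it as one exponential of a polynomial turns derivatives
  and complex shifts into algebra in the exponent.\<close>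

definition gexp :: "'b::euclidean_space \<Rightarrow> 'b \<Rightarrow> 'b \<Rightarrow> complex" where
  "gexp X \<Omega> y = exp (- of_real pi * of_real ((y - X) \<bullet> (y - X)) - 2 * of_real pi * \<i> * of_real (y \<bullet> \<Omega>))"

lemma gexp_eq: "gexp X \<Omega> y = gauss (y - X) * cis (- 2 * pi * (y \<bullet> \<Omega>))"
  unfolding gexp_def gauss_shift_cis ..

lemma stft_gauss: "stft a gauss X \<Omega> = a (gexp X \<Omega>)"
  unfolding stft_def gexp_eq[abs_def] by (simp add: gauss_def)

lemma gexp_has_derivative:
  "(gexp X \<Omega> has_derivative
     (\<lambda>h. gexp X \<Omega> y * (- 2 * of_real pi * of_real ((y - X) \<bullet> h) - 2 * of_real pi * \<i> * of_real (h \<bullet> \<Omega>)))) (at y)"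
proof -
  have "((\<lambda>y. - complex_of_real pi * of_real ((y - X) \<bullet> (y - X)) - 2 * of_real pi * \<i> * of_real (y \<bullet> \<Omega>))
      has_derivative (\<lambda>h. - complex_of_real pi * of_real ((y - X) \<bullet> h + h \<bullet> (y - X)) - 2 * of_real pi * \<i> * of_real (h \<bullet> \<Omega>))) (at y)"
    by (auto intro!: derivative_eq_intros)
  from has_derivative_cexp[OF this] show ?thesis
    unfolding gexp_def by (rule has_derivative_eq_rhs) (auto simp: inner_commute algebra_simps)
qed

lemma norm_gexp: "norm (gexp X \<Omega> y) = exp (- pi * (norm (y - X))\<^sup>2)"
  unfolding gexp_eq norm_mult gauss_def by simp

text \<open>Each derivative of \<open>gexp X \<Omega>\<close> multiplies it by constants, by
  components of \<open>y - X\<close> and by components of \<Omega>; this dictates the three kinds of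
  multipliers. The Gaussian absorbs all powers of \<open>y - X\<close>, so the weight in
  \<open>y\<close> costs only a weight in \<open>X\<close>.\<close>

interpretation growth: gen_family UNIV "\<lambda>(X, \<Omega>). wt X * wt \<Omega>" "\<lambda>_. 1"
  "{\<lambda>(X, \<Omega>) y. gexp X \<Omega> y}"
  "range (\<lambda>c _ _. c) \<union> range (\<lambda>b (X, \<Omega>) y. complex_of_real ((y - X) \<bullet> b)) \<union>
   range (\<lambda>b (X, \<Omega>) (y :: 'b::euclidean_space). complex_of_real (\<Omega> \<bullet> b))"
proof
  fix i :: "'b \<times> 'b"
  show "1 \<le> (case i of (X, \<Omega>) \<Rightarrow> wt X * wt \<Omega>)"
    using mult_mono[OF wt_ge_1 wt_ge_1] by (auto split: prod.split)
  show "0 \<le> (1::real)" by simp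
next
  let ?M = "range (\<lambda>c _ _. c) \<union> range (\<lambda>b (X, \<Omega>) y. complex_of_real ((y - X) \<bullet> b)) \<union>
     range (\<lambda>b (X, \<Omega>) (y :: 'b). complex_of_real (\<Omega> \<bullet> b))"
  fix g :: "'b \<times> 'b \<Rightarrow> 'b \<Rightarrow> complex" assume "g \<in> {\<lambda>(X, \<Omega>) y. gexp X \<Omega> y}"
  then have g: "g = (\<lambda>(X, \<Omega>) y. gexp X \<Omega> y)" by simp
  let ?D = "\<lambda>(X, \<Omega>) y h. gexp X \<Omega> y * (- 2 * of_real pi * of_real ((y - X) \<bullet> h) - 2 * of_real pi * \<i> * of_real (h \<bullet> \<Omega>))"
  have d1: "gen {g} ?M (\<lambda>i y. (\<lambda>_ _. - 2 * of_real pi) i y * ((\<lambda>(X, \<Omega>) y. of_real ((y - X) \<bullet> v)) i y * g i y)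
        + (\<lambda>_ _. - 2 * of_real pi * \<i>) i y * ((\<lambda>(X, \<Omega>) y. of_real (\<Omega> \<bullet> v)) i y * g i y))" for v
    by (intro gen_add gen_mult gen_base) auto
  have d2: "?D i y v = (\<lambda>_ _. - 2 * of_real pi) i y * ((\<lambda>(X, \<Omega>) y. of_real ((y - X) \<bullet> v)) i y * g i y)
        + (\<lambda>_ _. - 2 * of_real pi * \<i>) i y * ((\<lambda>(X, \<Omega>) y. of_real (\<Omega> \<bullet> v)) i y * g i y)" for i :: "'b \<times> 'b" and y v
    unfolding g by (auto split: prod.split simp: inner_commute algebra_simps)
  show "\<exists>D. (\<forall>i\<in>UNIV. \<forall>y. (g i has_derivative D i y) (at y)) \<and>
         (\<forall>v\<in>Basis. \<exists>q. gen {\<lambda>(X, \<Omega>) y. gexp X \<Omega> y} ?M q \<and> (\<forall>i\<in>UNIV. \<forall>y. D i y v = q i y))"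
    unfolding g[symmetric]
  proof (intro exI[of _ ?D] conjI ballI allI)
    fix i :: "'b \<times> 'b" and y :: 'b
    show "(g i has_derivative ?D i y) (at y)"
      unfolding g by (cases i) (simp only: prod.case gexp_has_derivative)
  next
    fix v :: 'b
    show "\<exists>q. gen {g} ?M q \<and> (\<forall>i\<in>UNIV. \<forall>y. ?D i y v = q i y)"
      using d1[of v] d2[of _ _ v] by blast
  qed
  show "\<exists>C n. \<forall>i\<in>UNIV. \<forall>y. wt y ^ N * cmod (g i y) \<le> C * (case i of (X, \<Omega>) \<Rightarrow> wt X * wt \<Omega>) ^ n * 1" for N
  proof (intro exI[of _ "exp ((real N + 0)\<^sup>2)"] exI[of _ N] ballI allI)
    fix i :: "'b \<times> 'b" and y :: 'b
    obtain X \<Omega> where i: "i = (X, \<Omega>)" by (cases i)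
    have "wt y ^ N * cmod (g i y) \<le> (wt X ^ N * wt (y - X) ^ N) * exp (- pi * (norm (y - X))\<^sup>2)"
      unfolding g i by (simp add: norm_gexp wt_power_le_mult_diff)
    also have "\<dots> = wt X ^ N * ((1 + norm (y - X)) ^ N * exp (0 * norm (y - X) - pi * (norm (y - X))\<^sup>2))"
      by (simp add: wt_def)
    also have "\<dots> \<le> (wt X * wt \<Omega>) ^ N * exp ((real N + 0)\<^sup>2)"
    proof (intro mult_mono poly_exp_gauss_bound)
      show "wt X ^ N \<le> (wt X * wt \<Omega>) ^ N"
        using wt_ge_1[of \<Omega>] by (intro power_mono) auto
    qed auto
    finally show "wt y ^ N * cmod (g i y) \<le> exp ((real N + 0)\<^sup>2) * (case i of (X, \<Omega>) \<Rightarrow> wt X * wt \<Omega>) ^ N * 1"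
      by (simp add: i mult.commute)
  qed
next
  let ?M = "range (\<lambda>c _ _. c) \<union> range (\<lambda>b (X, \<Omega>) y. complex_of_real ((y - X) \<bullet> b)) \<union>
     range (\<lambda>b (X, \<Omega>) (y :: 'b). complex_of_real (\<Omega> \<bullet> b))"
  fix m :: "'b \<times> 'b \<Rightarrow> 'b \<Rightarrow> complex" assume m: "m \<in> ?M"
  have const: "(\<lambda>_ _. c) \<in> ?M" for c by auto
  consider c where "m = (\<lambda>_ _. c)" | b where "m = (\<lambda>(X, \<Omega>) y. complex_of_real ((y - X) \<bullet> b))"
    | b where "m = (\<lambda>(X, \<Omega>) y. complex_of_real (\<Omega> \<bullet> b))" using m by auto
  note cs = this
  show "\<exists>D. (\<forall>i\<in>UNIV. \<forall>y. (m i has_derivative D i y) (at y)) \<and>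
          (\<forall>v\<in>Basis. \<exists>l\<in>?M. \<forall>i\<in>UNIV. \<forall>y. D i y v = l i y)"
    using cs
  proof cases
    case 1
    then show ?thesis by (intro exI[of _ "\<lambda>_ _ _. 0"] conjI ballI bexI[OF _ const[of 0]]) auto
  next
    case 2
    have "(m i has_derivative (\<lambda>h. complex_of_real (h \<bullet> b))) (at y)" for i y
      unfolding 2 by (cases i) (auto intro!: derivative_eq_intros)
    then show ?thesis
      by (intro exI[of _ "\<lambda>_ _ h. complex_of_real (h \<bullet> b)"] conjI ballI bexI[OF _ const]) auto
  next
    case 3
    then show ?thesis by (intro exI[of _ "\<lambda>_ _ _. 0"] conjI ballI bexI[OF _ const[of 0]]) auto
  qed
  have pw: "wt X \<le> wt X * wt \<Omega> * wt y" "wt \<Omega> \<le> wt X * wt \<Omega> * wt y" "1 \<le> wt y" "wt X * wt y \<le> wt X * wt \<Omega> * wt y" for X \<Omega> y :: 'b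
  proof -
    have "wt X * (1 * 1) \<le> wt X * (wt \<Omega> * wt y)" by (intro mult_left_mono mult_mono) (auto simp: wt_ge_1)
    then show "wt X \<le> wt X * wt \<Omega> * wt y" by (simp add: mult.assoc)
    have "1 * wt \<Omega> * 1 \<le> wt X * wt \<Omega> * wt y" by (intro mult_mono) (auto simp: wt_ge_1)
    then show "wt \<Omega> \<le> wt X * wt \<Omega> * wt y" by simp
    have "wt X * 1 * wt y \<le> wt X * wt \<Omega> * wt y" by (intro mult_mono) (auto simp: wt_ge_1)
    then show "wt X * wt y \<le> wt X * wt \<Omega> * wt y" by simp
  qed (rule wt_ge_1)
  show "\<exists>C n. \<forall>i\<in>UNIV. \<forall>y. cmod (m i y) \<le> C * (case i of (X, \<Omega>) \<Rightarrow> wt X * wt \<Omega>) ^ n * wt y"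
    using cs
  proof cases
    case 1
    then show ?thesis using wt_ge_1
      by (intro exI[of _ "norm c"] exI[of _ 0]) (auto intro!: mult_le_cancel_left1[THEN iffD2])
  next
    case 2
    have "\<bar>(y - X) \<bullet> b\<bar> \<le> norm b * (wt X * wt \<Omega>) ^ 1 * wt y" for X \<Omega> y :: 'b
    proof -
      have "\<bar>(y - X) \<bullet> b\<bar> \<le> norm (y - X) * norm b" by (rule Cauchy_Schwarz_ineq2)
      also have "\<dots> \<le> (wt X * wt y) * norm b"
        using wt_add_le[of "- X" y] norm_le_wt[of "y - X"] by (intro mult_right_mono) auto
      also have "\<dots> \<le> (wt X * wt \<Omega> * wt y) * norm b" by (intro mult_right_mono pw) auto
      finally show ?thesis by (simp add: algebra_simps)
    qed
    then show ?thesis unfolding 2 by (intro exI[of _ "norm b"] exI[of _ 1]) auto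
  next
    case 3
    have "\<bar>\<Omega> \<bullet> b\<bar> \<le> norm b * (wt X * wt \<Omega>) ^ 1 * wt y" for X \<Omega> y :: 'b
    proof -
      have "\<bar>\<Omega> \<bullet> b\<bar> \<le> norm \<Omega> * norm b" by (rule Cauchy_Schwarz_ineq2)
      also have "\<dots> \<le> (wt X * wt \<Omega> * wt y) * norm b"
        by (rule mult_right_mono[OF order_trans[OF norm_le_wt pw(2)]]) simp
      finally show ?thesis by (simp add: algebra_simps)
    qed
    then show ?thesis unfolding 3 by (intro exI[of _ "norm b"] exI[of _ 1]) auto
  qed
qed

lemma schwartz_gexp: "schwartz (gexp X \<Omega>)"
  using growth.gen_schwartz[OF gen_base, of "\<lambda>(X, \<Omega>) y. gexp X \<Omega> y" "(X, \<Omega>)"] by simp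

lemma gexp_0: "gexp 0 0 = gauss"
  unfolding gexp_eq[abs_def] by simp

lemma schwartz_gauss: "schwartz gauss"
  unfolding gexp_0[symmetric] by (rule schwartz_gexp)

lemma tempered_add: "tempered T \<Longrightarrow> schwartz \<phi> \<Longrightarrow> schwartz \<psi> \<Longrightarrow> T (\<lambda>x. \<phi> x + \<psi> x) = T \<phi> + T \<psi>"
  unfolding tempered_def by blast

lemma tempered_cmult: "tempered T \<Longrightarrow> schwartz \<phi> \<Longrightarrow> T (\<lambda>x. c * \<phi> x) = c * T \<phi>"
  unfolding tempered_def by blast

text \<open>One seminorm controls \<open>a\<close>, and the seminorms of the shifted Gaussians grow
  polynomially. This a priori bound later makes the maximal function finite and provides local
  bounds on complex discs.\<close>

lemma stft_growth:
  fixes a :: "('b::euclidean_space \<Rightarrow> complex) \<Rightarrow> complex"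
  assumes "tempered a"
  obtains C K where "0 \<le> C" "\<And>X \<Omega>. norm (stft a gauss X \<Omega>) \<le> C * (wt X * wt \<Omega>) ^ K"
proof -
  obtain C N where C: "\<And>\<phi>. schwartz \<phi> \<Longrightarrow> cmod (a \<phi>) \<le> C * schwartz_seminorm N \<phi>"
    using assms unfolding tempered_def by blast
  obtain D n where D0: "0 \<le> D" "\<forall>i\<in>(UNIV :: ('b \<times> 'b) set). schwartz_seminorm N ((\<lambda>(X, \<Omega>) y. gexp X \<Omega> y) i)
      \<le> D * (case i of (X, \<Omega>) \<Rightarrow> wt X * wt \<Omega>) ^ n * 1"
    using growth.gen_seminorm[OF gen_base, of "\<lambda>(X, \<Omega>) y. gexp X \<Omega> y" N] by blast
  have D: "schwartz_seminorm N (gexp X \<Omega>) \<le> D * (wt X * wt \<Omega>) ^ n" for X \<Omega> :: 'b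
    using bspec[OF D0(2), of "(X, \<Omega>)"] by simp
  have "norm (stft a gauss X \<Omega>) \<le> (\<bar>C\<bar> * D) * (wt X * wt \<Omega>) ^ n" for X \<Omega>
  proof -
    have "0 \<le> schwartz_seminorm N (gexp X \<Omega>)"
      by (rule order_trans[OF _ schwartz_seminorm_ge[OF schwartz_gexp]]) simp
    then have "C * schwartz_seminorm N (gexp X \<Omega>) \<le> \<bar>C\<bar> * schwartz_seminorm N (gexp X \<Omega>)"
      by (intro mult_right_mono) auto
    also have "\<dots> \<le> \<bar>C\<bar> * (D * (wt X * wt \<Omega>) ^ n)" by (intro mult_left_mono D) auto
    finally show ?thesis using C[OF schwartz_gexp[of X \<Omega>]] by (simp add: stft_gauss mult.assoc)
  qed
  then show ?thesis using D0(1) by (intro that[of "\<bar>C\<bar> * D" n]) auto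
qed

text \<open>Moving the STFT point \<open>(X, \<Omega>)\<close> along the complex line through \<open>P - \<i> Q\<close> multiplies the Gaussian by
  \<open>exp (s * clin P Q (y - X))\<close>, up to the nonvanishing factor in \<open>gexp_exp_shift\<close>; this is what
  makes the STFT holomorphic along such lines.\<close>

definition clin :: "'b::euclidean_space \<Rightarrow> 'b \<Rightarrow> 'b \<Rightarrow> complex" where
  "clin P Q y = 2 * of_real pi * of_real (y \<bullet> P) - 2 * of_real pi * \<i> * of_real (y \<bullet> Q)"

lemma clin_has_derivative: "((\<lambda>y. clin P Q (y - X)) has_derivative clin P Q) (at y)"
  unfolding clin_def by (auto intro!: derivative_eq_intros)

lemma norm_clin_le: "norm (clin P Q y) \<le> 2 * pi * (norm P + norm Q) * norm y"
proof -
  have "norm (clin P Q y) \<le> 2 * pi * \<bar>y \<bullet> P\<bar> + 2 * pi * \<bar>y \<bullet> Q\<bar>"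
    unfolding clin_def by (rule order_trans[OF norm_triangle_ineq4]) (simp add: norm_mult)
  also have "\<dots> \<le> 2 * pi * (norm y * norm P) + 2 * pi * (norm y * norm Q)"
    by (intro add_mono mult_left_mono Cauchy_Schwarz_ineq2) auto
  finally show ?thesis by (simp add: algebra_simps)
qed

section \<open>Complex differentiability of the STFT along complex lines\<close>

lemma norm_exp_minus_1_le: "norm (exp (z::complex) - 1) \<le> norm z * exp (norm z)"
proof -
  have "norm (exp z - (\<Sum>k\<le>0. z ^ k / fact k)) \<le> exp \<bar>Re z\<bar> * norm z ^ Suc 0 / fact 0"
    by (rule Taylor_exp)
  also have "\<dots> \<le> exp (norm z) * norm z"
    using abs_Re_le_cmod[of z] by (auto intro!: mult_right_mono)
  finally show ?thesis by (simp add: mult.commute)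
qed

lemma norm_exp_minus_1_minus_le: "norm (exp (z::complex) - 1 - z) \<le> (norm z)\<^sup>2 * exp (norm z)"
proof -
  have "norm (exp z - (\<Sum>k\<le>1. z ^ k / fact k)) \<le> exp \<bar>Re z\<bar> * norm z ^ Suc 1 / fact 1"
    by (rule Taylor_exp)
  also have "\<dots> \<le> exp (norm z) * (norm z)\<^sup>2"
    using abs_Re_le_cmod[of z] by (auto intro!: mult_right_mono simp: power2_eq_square)
  finally show ?thesis by (simp add: mult.commute diff_diff_eq)
qed

text \<open>The Taylor remainder exp(tz) - 1 - tz and what arises from it by repeated
  differentiation in a variable on which \<open>z\<close> depends: t (exp(tz) - 1), then t^2
  exp(tz). All are of order t^2. The constant 3 leaves room for |z|^2 exp|z|, because |z| \<le>
  exp|z|.\<close>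

lemma remainder_bounds:
  fixes t z :: complex
  assumes "norm t \<le> 1"
  shows "norm (exp (t * z) - 1 - t * z) \<le> (norm t)\<^sup>2 * exp (3 * norm z)"
    and "norm (t * (exp (t * z) - 1)) \<le> (norm t)\<^sup>2 * exp (3 * norm z)"
    and "norm (t\<^sup>2 * exp (t * z)) \<le> (norm t)\<^sup>2 * exp (3 * norm z)"
proof -
  let ?r = "norm z"
  have r: "?r \<le> exp ?r" using exp_ge_add_one_self[of ?r] by linarith
  have tz: "norm (t * z) \<le> ?r"
    using mult_right_mono[OF assms, of ?r] by (simp add: norm_mult)
  then have e: "exp (norm (t * z)) \<le> exp ?r" by simp
  have e3: "exp ?r * exp ?r * exp ?r = exp (3 * ?r)" by (simp add: exp_add[symmetric])
  have e2: "exp ?r * exp ?r \<le> exp (3 * ?r)" by (simp add: exp_add[symmetric])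
  have "norm (exp (t * z) - 1 - t * z) \<le> (norm (t * z))\<^sup>2 * exp (norm (t * z))"
    by (rule norm_exp_minus_1_minus_le)
  also have "\<dots> \<le> (norm (t * z))\<^sup>2 * exp ?r" by (intro mult_left_mono e) auto
  also have "\<dots> = (norm t)\<^sup>2 * (?r * ?r * exp ?r)"
    by (simp add: norm_mult power2_eq_square algebra_simps)
  also have "\<dots> \<le> (norm t)\<^sup>2 * (exp ?r * exp ?r * exp ?r)"
    using r by (intro mult_left_mono mult_right_mono mult_mono) auto
  finally show "norm (exp (t * z) - 1 - t * z) \<le> (norm t)\<^sup>2 * exp (3 * norm z)"
    by (simp add: e3)
  have "norm (t * (exp (t * z) - 1)) \<le> norm t * (norm (t * z) * exp (norm (t * z)))"
    by (subst norm_mult) (intro mult_left_mono norm_exp_minus_1_le, auto)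
  also have "\<dots> \<le> norm t * (norm (t * z) * exp ?r)" by (intro mult_left_mono e) auto
  also have "\<dots> = (norm t)\<^sup>2 * (?r * exp ?r)"
    by (simp add: norm_mult power2_eq_square algebra_simps)
  also have "\<dots> \<le> (norm t)\<^sup>2 * (exp ?r * exp ?r)"
    using r by (intro mult_left_mono mult_right_mono) auto
  also have "\<dots> \<le> (norm t)\<^sup>2 * exp (3 * ?r)" by (intro mult_left_mono e2) auto
  finally show "norm (t * (exp (t * z) - 1)) \<le> (norm t)\<^sup>2 * exp (3 * norm z)" .
  have "norm (exp (t * z)) \<le> exp (norm (t * z))" by (rule norm_exp)
  also have "\<dots> \<le> exp (3 * ?r)" using tz by (simp add: order_trans[OF tz])
  finally have "norm (exp (t * z)) \<le> exp (3 * ?r)" .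
  then show "norm (t\<^sup>2 * exp (t * z)) \<le> (norm t)\<^sup>2 * exp (3 * norm z)"
    unfolding norm_mult norm_power by (intro mult_left_mono) auto
qed

text \<open>Since s (P - \<i> Q) = \<delta> - \<i> \<epsilon>, the added exponent is 2\<pi> (y - X)
  \<bullet> \<delta> - 2\<pi>\<i> (y - X) \<bullet> \<epsilon>. Completing the square moves the
  centre by \<delta> and the frequency by \<epsilon>, leaving a real Gaussian factor and a
  phase.\<close>

lemma gexp_exp_shift:
  fixes s :: complex
  defines "\<delta> \<equiv> \<lambda>P Q. Re s *\<^sub>R P + Im s *\<^sub>R Q" and "\<epsilon> \<equiv> \<lambda>P Q. Re s *\<^sub>R Q - Im s *\<^sub>R P"
  shows "gexp X \<Omega> y * exp (s * clin P Q (y - X)) =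
    of_real (exp (pi * (norm (\<delta> P Q))\<^sup>2)) * cis (2 * pi * (X \<bullet> \<epsilon> P Q)) * gexp (X + \<delta> P Q) (\<Omega> + \<epsilon> P Q) y"
proof -
  define d where "d = \<delta> P Q"
  define e where "e = \<epsilon> P Q"
  have 1: "s * clin P Q (y - X) = 2 * of_real pi * of_real ((y - X) \<bullet> d) - 2 * of_real pi * \<i> * of_real ((y - X) \<bullet> e)"
    unfolding clin_def d_def e_def \<delta>_def \<epsilon>_def
    by (simp add: complex_eq_iff inner_simps algebra_simps)
  have "(y - (X + d)) \<bullet> (y - (X + d)) = (y - X) \<bullet> (y - X) - 2 * ((y - X) \<bullet> d) + d \<bullet> d"
    by (simp add: inner_simps inner_commute algebra_simps)
  then have 2: "complex_of_real ((y - (X + d)) \<bullet> (y - (X + d))) =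
     of_real ((y - X) \<bullet> (y - X)) - 2 * of_real ((y - X) \<bullet> d) + of_real (d \<bullet> d)"
    by (simp only: of_real_add of_real_diff of_real_mult of_real_numeral)
  show ?thesis
    unfolding gexp_def d_def[symmetric] e_def[symmetric] exp_of_real[symmetric] cis_conv_exp
      exp_add[symmetric] power2_norm_eq_inner 1 2
    by (intro arg_cong[of _ _ exp]) (simp add: inner_add_right inner_diff_left[of y X e] algebra_simps)
qed

lemma schwartz_gexp_exp: "schwartz (\<lambda>y. gexp X \<Omega> y * exp (s * clin P Q (y - X)))"
  unfolding gexp_exp_shift by (intro schwartz_cmult schwartz_gexp)

lemma schwartz_clin_mult:
  assumes "schwartz f"
  shows "schwartz (\<lambda>y. clin P Q (y - X) * f y)"
proof -
  have "schwartz (\<lambda>y. (2 * of_real pi) * (complex_of_real (y \<bullet> P) * f y) +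
     ((- 2 * of_real pi * \<i>) * (complex_of_real (y \<bullet> Q) * f y) + (- clin P Q X) * f y))"
    by (intro schwartz_add schwartz_cmult schwartz_mult_coord assms)
  also have "(\<lambda>y. (2 * of_real pi) * (complex_of_real (y \<bullet> P) * f y) +
     ((- 2 * of_real pi * \<i>) * (complex_of_real (y \<bullet> Q) * f y) + (- clin P Q X) * f y)) =
     (\<lambda>y. clin P Q (y - X) * f y)"
    unfolding clin_def by (intro ext) (simp add: inner_diff_left algebra_simps)
  finally show ?thesis .
qed

text \<open>Differentiating \<open>e\<close> multiplies it by an affine function of
  \<open>y\<close>, and \<open>L\<close> has a constant derivative. So the three functions are
  closed under differentiation up to the multipliers: the first leads to the second, the second to
  the third, and the third to \<open>t\<close> times itself, which is why \<open>t\<close> is a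
  multiplier.\<close>

lemma remainder_family:
  fixes X \<Omega> P Q :: "'b::euclidean_space" and s :: complex
  defines "e \<equiv> \<lambda>y. gexp X \<Omega> y * exp (s * clin P Q (y - X))" and "L \<equiv> \<lambda>y. clin P Q (y - X)"
  shows "gen_family {t. norm t \<le> 1} (\<lambda>_. 1) (\<lambda>t. (norm t)\<^sup>2)
     {\<lambda>t y. e y * (exp (t * L y) - 1 - t * L y), \<lambda>t y. e y * (t * (exp (t * L y) - 1)), \<lambda>t y. e y * (t\<^sup>2 * exp (t * L y))}
     (insert (\<lambda>t _. t) (range (\<lambda>c _ _. c) \<union> range (\<lambda>b _ y. complex_of_real (y \<bullet> b))))"
    (is "gen_family ?I _ _ {?g1, ?g2, ?g3} ?M")
proof
  let ?B = "{?g1, ?g2, ?g3}"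
  define c where "c = (\<lambda>v. 2 * of_real pi * of_real (X \<bullet> v) - 2 * of_real pi * \<i> * of_real (v \<bullet> \<Omega>) + s * clin P Q v)"
  define \<alpha> where "\<alpha> = (\<lambda>v y. c v + - 2 * of_real pi * complex_of_real (y \<bullet> v))"
  have he: "(e has_derivative (\<lambda>h. e y * \<alpha> h y)) (at y)" for y
    unfolding e_def
    by (rule has_derivative_eq_rhs, rule has_derivative_mult[OF gexp_has_derivative has_derivative_cexp],
        rule has_derivative_mult_right, rule clin_has_derivative)
      (simp add: \<alpha>_def c_def fun_eq_iff inner_diff_left algebra_simps)
  have hL: "(L has_derivative clin P Q) (at y)" for y
    unfolding L_def by (rule clin_has_derivative)
  have hE: "((\<lambda>y. exp (t * L y)) has_derivative (\<lambda>h. exp (t * L y) * (t * clin P Q h))) (at y)" for t y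
    by (intro has_derivative_cexp has_derivative_mult_right hL)
  have D1: "(?g1 t has_derivative (\<lambda>h. \<alpha> h y * ?g1 t y + clin P Q h * ?g2 t y)) (at y)" for t y
    by (rule has_derivative_eq_rhs,
        rule has_derivative_mult[OF he has_derivative_diff[OF has_derivative_diff[OF hE has_derivative_const]
           has_derivative_mult_right[OF hL]]])
       (simp add: fun_eq_iff algebra_simps)
  have D2: "(?g2 t has_derivative (\<lambda>h. \<alpha> h y * ?g2 t y + clin P Q h * ?g3 t y)) (at y)" for t y
    by (rule has_derivative_eq_rhs,
        rule has_derivative_mult[OF he has_derivative_mult_right[OF has_derivative_diff[OF hE has_derivative_const]]])
       (simp add: fun_eq_iff power2_eq_square algebra_simps)
  have D3: "(?g3 t has_derivative (\<lambda>h. \<alpha> h y * ?g3 t y + clin P Q h * (t * ?g3 t y))) (at y)" for t y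
    by (rule has_derivative_eq_rhs,
        rule has_derivative_mult[OF he has_derivative_mult_right[OF hE]])
       (simp add: fun_eq_iff power2_eq_square algebra_simps)
  have const: "(\<lambda>_ _. c) \<in> ?M" for c by auto
  have coord: "(\<lambda>_ y. complex_of_real (y \<bullet> b)) \<in> ?M" for b by auto
  have tM: "(\<lambda>t _. t) \<in> ?M" by auto
  have aff: "gen ?B ?M (\<lambda>t y. \<alpha> v y * q t y)" if "gen ?B ?M q" for q v
  proof -
    have "gen ?B ?M (\<lambda>t y. c v * q t y + (- 2 * of_real pi) * (complex_of_real (y \<bullet> v) * q t y))"
      by (intro gen_add gen_mult[OF const] gen_mult[OF coord] that)
    also have "(\<lambda>t y. c v * q t y + (- 2 * of_real pi) * (complex_of_real (y \<bullet> v) * q t y)) = (\<lambda>t y. \<alpha> v y * q t y)"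
      by (simp add: \<alpha>_def algebra_simps)
    finally show ?thesis .
  qed
  have B: "gen ?B ?M ?g1" "gen ?B ?M ?g2" "gen ?B ?M ?g3" by (intro gen_base; blast)+
  fix g :: "complex \<Rightarrow> 'b \<Rightarrow> complex" assume "g \<in> ?B"
  then consider "g = ?g1" | "g = ?g2" | "g = ?g3" by blast
  note cs = this
  show "\<exists>D. (\<forall>i\<in>?I. \<forall>y. (g i has_derivative D i y) (at y)) \<and>
          (\<forall>v\<in>Basis. \<exists>q. gen ?B ?M q \<and> (\<forall>i\<in>?I. \<forall>y. D i y v = q i y))"
    using cs
  proof cases
    case 1
    have "gen ?B ?M (\<lambda>t y. \<alpha> v y * ?g1 t y + clin P Q v * ?g2 t y)" for v
      by (intro gen_add aff gen_mult[OF const] B)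
    then show ?thesis unfolding 1
      by (intro exI[of _ "\<lambda>t y h. \<alpha> h y * ?g1 t y + clin P Q h * ?g2 t y"] conjI ballI allI D1) blast
  next
    case 2
    have "gen ?B ?M (\<lambda>t y. \<alpha> v y * ?g2 t y + clin P Q v * ?g3 t y)" for v
      by (intro gen_add aff gen_mult[OF const] B)
    then show ?thesis unfolding 2
      by (intro exI[of _ "\<lambda>t y h. \<alpha> h y * ?g2 t y + clin P Q h * ?g3 t y"] conjI ballI allI D2) blast
  next
    case 3
    have "gen ?B ?M (\<lambda>t y. \<alpha> v y * ?g3 t y + clin P Q v * (t * ?g3 t y))" for v
      by (intro gen_add aff gen_mult[OF const] gen_mult[OF tM] B)
    then show ?thesis unfolding 3
      by (intro exI[of _ "\<lambda>t y h. \<alpha> h y * ?g3 t y + clin P Q h * (t * ?g3 t y)"] conjI ballI allI D3) blast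
  qed
  show "\<exists>C n. \<forall>i\<in>?I. \<forall>y. wt y ^ N * cmod (g i y) \<le> C * 1 ^ n * (norm i)\<^sup>2" for N
  proof -
    define k where "k = 2 * pi * (norm P + norm Q)"
    \<comment> \<open>The exponential growth to be beaten by the Gaussian: |s| |L| from
      \<open>e\<close> and 3 |L| from the remainder bounds, with |L| at most \<open>k\<close> times
      |y - X|.\<close>
    define m where "m = (norm s + 3) * k"
    have k0: "0 \<le> k" by (simp add: k_def)
    then have m0: "0 \<le> m" by (simp add: m_def)
    have Lk: "norm (L y) \<le> k * norm (y - X)" for y
      unfolding L_def k_def by (rule norm_clin_le)
    have gb: "wt y ^ N * cmod (g t y) \<le> (wt X ^ N * exp ((real N + m)\<^sup>2)) * (norm t)\<^sup>2" if t: "norm t \<le> 1" for t y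
    proof -
      have "cmod (g t y) \<le> norm (e y) * ((norm t)\<^sup>2 * exp (3 * norm (L y)))"
        using cs
      proof cases
        case 1 then show ?thesis
          using remainder_bounds(1)[OF t, of "L y"] by (simp add: norm_mult mult_left_mono)
      next
        case 2 then show ?thesis
          using mult_left_mono[OF remainder_bounds(2)[OF t, of "L y"], of "norm (e y)"] by (simp add: norm_mult)
      next
        case 3 then show ?thesis
          using mult_left_mono[OF remainder_bounds(3)[OF t, of "L y"], of "norm (e y)"] by (simp add: norm_mult)
      qed
      also have "norm (e y) \<le> exp (- pi * (norm (y - X))\<^sup>2) * exp (norm s * norm (L y))"
        unfolding e_def norm_mult norm_gexp L_def
        using norm_exp[of "s * clin P Q (y - X)"] by (intro mult_left_mono) (auto simp: norm_mult)
      finally have "cmod (g t y) \<le> exp (- pi * (norm (y - X))\<^sup>2) * exp (norm s * norm (L y)) * ((norm t)\<^sup>2 * exp (3 * norm (L y)))"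
        by (simp add: mult_right_mono)
      also have "\<dots> = (norm t)\<^sup>2 * exp ((norm s + 3) * norm (L y) - pi * (norm (y - X))\<^sup>2)"
        by (simp add: exp_add[symmetric] exp_diff[symmetric] algebra_simps)
      also have "\<dots> \<le> (norm t)\<^sup>2 * exp (m * norm (y - X) - pi * (norm (y - X))\<^sup>2)"
        using mult_left_mono[OF Lk[of y], of "norm s + 3"]
        by (intro mult_left_mono) (auto simp: m_def mult.assoc)
      finally have "wt y ^ N * cmod (g t y) \<le> (wt X ^ N * wt (y - X) ^ N) *
          ((norm t)\<^sup>2 * exp (m * norm (y - X) - pi * (norm (y - X))\<^sup>2))"
        by (intro mult_mono wt_power_le_mult_diff) auto
      also have "\<dots> = (norm t)\<^sup>2 * wt X ^ N * ((1 + norm (y - X)) ^ N * exp (m * norm (y - X) - pi * (norm (y - X))\<^sup>2))"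
        by (simp add: wt_def)
      also have "\<dots> \<le> (norm t)\<^sup>2 * wt X ^ N * exp ((real N + m)\<^sup>2)"
        using m0 by (intro mult_left_mono poly_exp_gauss_bound) auto
      finally show ?thesis by (simp add: algebra_simps)
    qed
    show ?thesis
      by (intro exI[of _ "wt X ^ N * exp ((real N + m)\<^sup>2)"] exI[of _ 0]) (use gb in simp)
  qed
next
  have const: "(\<lambda>_ _. c) \<in> ?M" for c by auto
  fix m :: "complex \<Rightarrow> 'b \<Rightarrow> complex" assume "m \<in> ?M"
  then consider "m = (\<lambda>t _. t)" | c where "m = (\<lambda>_ _. c)" | b where "m = (\<lambda>_ y. complex_of_real (y \<bullet> b))" by auto
  note cs = this
  show "\<exists>D. (\<forall>i\<in>?I. \<forall>y. (m i has_derivative D i y) (at y)) \<and>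
          (\<forall>v\<in>Basis. \<exists>l\<in>?M. \<forall>i\<in>?I. \<forall>y. D i y v = l i y)"
    using cs
  proof cases
    case 1
    then show ?thesis by (intro exI[of _ "\<lambda>_ _ _. 0"] conjI ballI bexI[OF _ const[of 0]]) auto
  next
    case 2
    then show ?thesis by (intro exI[of _ "\<lambda>_ _ _. 0"] conjI ballI bexI[OF _ const[of 0]]) auto
  next
    case 3
    have "(m i has_derivative (\<lambda>h. complex_of_real (h \<bullet> b))) (at y)" for i y
      unfolding 3 by (auto intro!: derivative_eq_intros)
    then show ?thesis
      by (intro exI[of _ "\<lambda>_ _ h. complex_of_real (h \<bullet> b)"] conjI ballI bexI[OF _ const]) auto
  qed
  show "\<exists>C n. \<forall>i\<in>?I. \<forall>y. cmod (m i y) \<le> C * 1 ^ n * wt y"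
    using cs
  proof cases
    case 1
    then show ?thesis using wt_ge_1 by (intro exI[of _ 1] exI[of _ 0]) (auto intro: order_trans)
  next
    case 2
    have "norm c \<le> norm c * wt y" for y :: 'b using mult_left_mono[OF wt_ge_1[of y], of "norm c"] by simp
    then show ?thesis unfolding 2 by (intro exI[of _ "norm c"] exI[of _ 0]) auto
  next
    case 3
    have "\<bar>y \<bullet> b\<bar> \<le> norm b * wt y" for y :: 'b
      using Cauchy_Schwarz_ineq2[of y b] mult_right_mono[OF norm_le_wt[of y], of "norm b"]
      by (simp add: mult.commute)
    then show ?thesis unfolding 3 by (intro exI[of _ "norm b"] exI[of _ 0]) auto
  qed
qed auto

text \<open>By linearity, the difference quotient minus the proposed derivative is
  \<open>a (r t) / t\<close> with the Taylor remainder \<open>r t\<close>. Every seminorm of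
  \<open>r t\<close> is O(|t|^2), so the continuity of \<open>a\<close> makes this O(|t|).\<close>

lemma tempered_gexp_has_field_derivative:
  fixes a :: "('b::euclidean_space \<Rightarrow> complex) \<Rightarrow> complex"
  assumes "tempered a"
  shows "((\<lambda>s. a (\<lambda>y. gexp X \<Omega> y * exp (s * clin P Q (y - X)))) has_field_derivative
     a (\<lambda>y. clin P Q (y - X) * (gexp X \<Omega> y * exp (s * clin P Q (y - X))))) (at s)"
proof -
  define e where "e = (\<lambda>s y. gexp X \<Omega> y * exp (s * clin P Q (y - X)))"
  define L where "L = (\<lambda>y. clin P Q (y - X))"
  define r where "r = (\<lambda>t y. e s y * (exp (t * L y) - 1 - t * L y))"
  have Se: "schwartz (e s)" for s unfolding e_def by (rule schwartz_gexp_exp)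
  have SL: "schwartz (\<lambda>y. L y * e s y)" unfolding L_def by (rule schwartz_clin_mult[OF Se])
  obtain C N where C: "\<And>\<phi>. schwartz \<phi> \<Longrightarrow> cmod (a \<phi>) \<le> C * schwartz_seminorm N \<phi>"
    using assms unfolding tempered_def by blast
  let ?B = "{\<lambda>t y. e s y * (exp (t * L y) - 1 - t * L y), \<lambda>t y. e s y * (t * (exp (t * L y) - 1)), \<lambda>t y. e s y * (t\<^sup>2 * exp (t * L y))}"
  let ?M = "(insert (\<lambda>t _. t) (range (\<lambda>c _ _. c) \<union> range (\<lambda>b _ y. complex_of_real (y \<bullet> b))))"
  have g: "gen ?B ?M r" unfolding r_def by (intro gen_base) auto
  interpret gen_family "{t. norm t \<le> 1}" "\<lambda>_. 1" "\<lambda>t. (norm t)\<^sup>2" ?B ?M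
    unfolding e_def L_def by (rule remainder_family)
  obtain D n where D: "\<forall>t\<in>{t. norm t \<le> 1}. schwartz_seminorm N (r t) \<le> D * 1 ^ n * (norm t)\<^sup>2"
    using gen_seminorm[OF g, of N] by blast
  have bd: "norm ((a (e (s + t)) - a (e s)) / t - a (\<lambda>y. L y * e s y)) \<le> \<bar>C\<bar> * D * norm t"
    if t: "norm t \<le> 1" "t \<noteq> 0" for t
  proof -
    have Sr: "schwartz (r t)" using gen_schwartz[OF g, of t] t by simp
    have "e (s + t) = (\<lambda>y. r t y + (1 * e s y + t * (L y * e s y)))"
      unfolding r_def e_def L_def by (simp add: fun_eq_iff exp_add algebra_simps)
    then have "a (e (s + t)) = a (r t) + (a (e s) + t * a (\<lambda>y. L y * e s y))"
      by (simp only: tempered_add[OF assms] tempered_cmult[OF assms] Sr Se SL schwartz_add schwartz_cmult mult_1_left)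
    then have "(a (e (s + t)) - a (e s)) / t - a (\<lambda>y. L y * e s y) = a (r t) / t"
      using t by (simp add: field_simps)
    moreover have "norm (a (r t)) \<le> \<bar>C\<bar> * D * (norm t)\<^sup>2"
    proof -
      have "0 \<le> schwartz_seminorm N (r t)"
        by (rule order_trans[OF _ schwartz_seminorm_ge[OF Sr, of 0]]) simp
      then have "C * schwartz_seminorm N (r t) \<le> \<bar>C\<bar> * schwartz_seminorm N (r t)"
        by (intro mult_right_mono) auto
      also have "\<dots> \<le> \<bar>C\<bar> * (D * (norm t)\<^sup>2)" using D t by (intro mult_left_mono) auto
      finally show ?thesis using C[OF Sr] by (simp add: mult.assoc)
    qed
    ultimately show ?thesis using t by (simp add: norm_divide field_simps power2_eq_square)
  qed
  have "((\<lambda>t. (a (e (s + t)) - a (e s)) / t - a (\<lambda>y. L y * e s y)) \<longlongrightarrow> 0) (at 0)"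
  proof (rule Lim_null_comparison)
    show "\<forall>\<^sub>F t in at 0. norm ((a (e (s + t)) - a (e s)) / t - a (\<lambda>y. L y * e s y)) \<le> \<bar>C\<bar> * D * norm t"
      unfolding eventually_at using bd by (intro exI[of _ 1]) auto
    show "((\<lambda>t. \<bar>C\<bar> * D * norm t) \<longlongrightarrow> 0) (at 0)"
      by (auto intro!: tendsto_eq_intros)
  qed
  then have "((\<lambda>s. a (e s)) has_field_derivative a (\<lambda>y. L y * e s y)) (at s)"
    unfolding DERIV_def by (rule LIM_zero_cancel)
  then show ?thesis
    unfolding e_def L_def .
qed

text \<open>Cauchy's integral formula at the centre, with the norm taken inside. The nonnegative
  integral is used so that further parameters can be integrated by Tonelli.\<close>

lemma circle_mean_norm_le:
  assumes "h holomorphic_on UNIV"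
  shows "ennreal (norm (h 0)) \<le> (\<integral>\<^sup>+ t. indicator {0..1} t * ennreal (norm (h (cis (2 * pi * t)))) \<partial>lborel)"
proof -
  have conth: "continuous_on S h" for S
    using assms holomorphic_on_imp_continuous_on continuous_on_subset by blast
  have "((\<lambda>u. h u / (u - 0)) has_contour_integral (2 * of_real pi * \<i> * h 0)) (circlepath 0 1)"
    by (rule Cauchy_integral_circlepath) (use assms conth holomorphic_on_subset in auto)
  then have "((\<lambda>t. h (circlepath 0 1 t) / circlepath 0 1 t * vector_derivative (circlepath 0 1) (at t within {0..1}))
      has_integral (2 * of_real pi * \<i> * h 0)) {0..1}"
    unfolding has_contour_integral_def by simp
  moreover have "h (circlepath 0 1 t) / circlepath 0 1 t * vector_derivative (circlepath 0 1) (at t within {0..1}) =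
      (2 * of_real pi * \<i>) * h (cis (2 * pi * t))" if "t \<in> {0..1}" for t
    using that vector_derivative_circlepath01[of t 0 1] unfolding circlepath cis_conv_exp
    by (simp add: mult.commute mult.left_commute)
  ultimately have "((\<lambda>t. (2 * of_real pi * \<i>) * h (cis (2 * pi * t))) has_integral (2 * of_real pi * \<i>) * h 0) {0..1}"
    by (subst has_integral_cong[of _ _ "\<lambda>t. h (circlepath 0 1 t) / circlepath 0 1 t * vector_derivative (circlepath 0 1) (at t within {0..1})"]) auto
  then have hi: "((\<lambda>t. h (cis (2 * pi * t))) has_integral h 0) {0..1}"
    by (subst (asm) has_integral_mult_right_iff) auto
  have cont: "continuous_on {0..1} (\<lambda>t. h (cis (2 * pi * t)))"
    by (intro continuous_on_compose2[OF conth[of UNIV]] continuous_intros) auto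
  have int: "set_integrable lborel {0..1} (\<lambda>t. h (cis (2 * pi * t)))"
    by (rule borel_integrable_atLeastAtMost') (rule cont)
  have "h 0 = (LINT t:{0..1}|lborel. h (cis (2 * pi * t)))"
    using set_borel_integral_eq_integral(2)[OF int] hi by (simp add: integral_unique)
  then have "ennreal (norm (h 0)) \<le> (\<integral>\<^sup>+ t. norm (indicat_real {0..1} t *\<^sub>R h (cis (2 * pi * t))) \<partial>lborel)"
    using int unfolding set_lebesgue_integral_def set_integrable_def
    by (simp only: integral_norm_bound_ennreal)
  also have "\<dots> = (\<integral>\<^sup>+ t. indicator {0..1} t * ennreal (norm (h (cis (2 * pi * t)))) \<partial>lborel)"
    by (intro nn_integral_cong) (auto split: split_indicator)
  finally show ?thesis .
qed

section \<open>Invariance of Lebesgue measure under translations, shears and rotations\<close>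

lemma nn_integral_lborel_translate:
  fixes f :: "'b::euclidean_space \<Rightarrow> ennreal"
  assumes [measurable]: "f \<in> borel_measurable borel"
  shows "(\<integral>\<^sup>+x. f (c + x) \<partial>lborel) = (\<integral>\<^sup>+x. f x \<partial>lborel)"
proof -
  have "(\<integral>\<^sup>+x. f x \<partial>lborel) = (\<integral>\<^sup>+x. f x \<partial>distr lborel borel ((+) c))"
    by (simp add: lborel_distr_plus)
  also have "\<dots> = (\<integral>\<^sup>+x. f (c + x) \<partial>lborel)" by (subst nn_integral_distr) auto
  finally show ?thesis ..
qed

lemma nn_integral_lborel_pair:
  fixes f :: "'b::euclidean_space \<times> 'c::euclidean_space \<Rightarrow> ennreal"
  assumes [measurable]: "f \<in> borel_measurable borel"
  shows "(\<integral>\<^sup>+z. f z \<partial>lborel) = (\<integral>\<^sup>+x. (\<integral>\<^sup>+y. f (x, y) \<partial>lborel) \<partial>lborel)"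
    and "(\<integral>\<^sup>+z. f z \<partial>lborel) = (\<integral>\<^sup>+y. (\<integral>\<^sup>+x. f (x, y) \<partial>lborel) \<partial>lborel)"
proof -
  have m: "f \<in> borel_measurable (lborel \<Otimes>\<^sub>M lborel)" by (simp add: lborel_prod)
  show "(\<integral>\<^sup>+z. f z \<partial>lborel) = (\<integral>\<^sup>+x. (\<integral>\<^sup>+y. f (x, y) \<partial>lborel) \<partial>lborel)"
    using lborel.nn_integral_fst[OF m] by (simp add: lborel_prod)
  show "(\<integral>\<^sup>+z. f z \<partial>lborel) = (\<integral>\<^sup>+y. (\<integral>\<^sup>+x. f (x, y) \<partial>lborel) \<partial>lborel)"
    using lborel_pair.nn_integral_snd[OF m] by (simp add: lborel_prod)
qed

lemma borel_measurable_continuous_comp: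
  fixes f :: "'b::topological_space \<Rightarrow> 'c::topological_space" and g :: "'a::topological_space \<Rightarrow> 'b"
  assumes "f \<in> borel_measurable borel" "continuous_on UNIV g"
  shows "(\<lambda>x. f (g x)) \<in> borel_measurable borel"
  using measurable_compose[OF borel_measurable_continuous_onI[OF assms(2)] assms(1)] .

text \<open>With one variable fixed, a shear is a translation in the other, so Tonelli reduces the
  claim to translation invariance.\<close>

lemma nn_integral_shear:
  fixes f :: "'b::euclidean_space \<times> 'b \<Rightarrow> ennreal"
  assumes f: "f \<in> borel_measurable borel"
  shows "(\<integral>\<^sup>+z. f (fst z + c *\<^sub>R snd z, snd z) \<partial>lborel) = (\<integral>\<^sup>+z. f z \<partial>lborel)"
    and "(\<integral>\<^sup>+z. f (fst z, snd z + c *\<^sub>R fst z) \<partial>lborel) = (\<integral>\<^sup>+z. f z \<partial>lborel)"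
proof -
  have "(\<integral>\<^sup>+z. f (fst z + c *\<^sub>R snd z, snd z) \<partial>lborel) = (\<integral>\<^sup>+y. (\<integral>\<^sup>+x. f (c *\<^sub>R y + x, y) \<partial>lborel) \<partial>lborel)"
    by (subst nn_integral_lborel_pair(2))
       (auto intro!: borel_measurable_continuous_comp[OF f] continuous_intros simp: add.commute)
  also have "\<dots> = (\<integral>\<^sup>+y. (\<integral>\<^sup>+x. f (x, y) \<partial>lborel) \<partial>lborel)"
    by (intro nn_integral_cong nn_integral_lborel_translate borel_measurable_continuous_comp[OF f] continuous_intros)
  also have "\<dots> = (\<integral>\<^sup>+z. f z \<partial>lborel)" by (rule nn_integral_lborel_pair(2)[OF f, symmetric])
  finally show "(\<integral>\<^sup>+z. f (fst z + c *\<^sub>R snd z, snd z) \<partial>lborel) = (\<integral>\<^sup>+z. f z \<partial>lborel)" .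
  have "(\<integral>\<^sup>+z. f (fst z, snd z + c *\<^sub>R fst z) \<partial>lborel) = (\<integral>\<^sup>+x. (\<integral>\<^sup>+y. f (x, c *\<^sub>R x + y) \<partial>lborel) \<partial>lborel)"
    by (subst nn_integral_lborel_pair(1))
       (auto intro!: borel_measurable_continuous_comp[OF f] continuous_intros simp: add.commute)
  also have "\<dots> = (\<integral>\<^sup>+x. (\<integral>\<^sup>+y. f (x, y) \<partial>lborel) \<partial>lborel)"
    by (intro nn_integral_cong nn_integral_lborel_translate borel_measurable_continuous_comp[OF f] continuous_intros)
  also have "\<dots> = (\<integral>\<^sup>+z. f z \<partial>lborel)" by (rule nn_integral_lborel_pair(1)[OF f, symmetric])
  finally show "(\<integral>\<^sup>+z. f (fst z, snd z + c *\<^sub>R fst z) \<partial>lborel) = (\<integral>\<^sup>+z. f z \<partial>lborel)" .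
qed

text \<open>Multiplication by \<open>s\<close> when the pair (P, Q) is identified with P - \<i> Q.
  For |s| = 1 it is an orthogonal rotation, and it describes how the STFT point moves along a
  complex line.\<close>

definition rot :: "complex \<Rightarrow> 'b::euclidean_space \<times> 'b \<Rightarrow> 'b \<times> 'b" where
  "rot s z = (Re s *\<^sub>R fst z + Im s *\<^sub>R snd z, Re s *\<^sub>R snd z - Im s *\<^sub>R fst z)"

lemma continuous_on_rot [continuous_intros]:
  "continuous_on S f \<Longrightarrow> continuous_on S g \<Longrightarrow> continuous_on S (\<lambda>x. rot (f x) (g x))"
  unfolding rot_def by (intro continuous_intros)

lemma norm_rot: "norm (rot s z) = norm s * norm z"
proof -
  have sq: "(norm u)\<^sup>2 = fst u \<bullet> fst u + snd u \<bullet> snd u" for u :: "'a \<times> 'a"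
    by (simp add: norm_prod_def power2_norm_eq_inner)
  have "(norm (rot s z))\<^sup>2 = (norm s * norm z)\<^sup>2"
    unfolding power_mult_distrib cmod_power2 sq unfolding rot_def
    by (simp add: inner_simps inner_commute power2_eq_square algebra_simps)
  then show ?thesis by (simp add: power2_eq_iff_nonneg)
qed

text \<open>A rotation by an angle that is not a multiple of \<open>\<pi>\<close> is a product of three shears.\<close>

lemma nn_integral_rot:
  fixes f :: "'b::euclidean_space \<times> 'b \<Rightarrow> ennreal"
  assumes f: "f \<in> borel_measurable borel" and s: "norm s = 1" "Im s \<noteq> 0"
  shows "(\<integral>\<^sup>+z. f (rot s z) \<partial>lborel) = (\<integral>\<^sup>+z. f z \<partial>lborel)"
proof -
  \<comment> \<open>For s = cis \<theta> this is tan(\<theta>/2), the parameter of the two outer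
    shears; the middle shear has parameter - sin \<theta>.\<close>
  define c where "c = (1 - Re s) / Im s"
  define A where "A = (\<lambda>z :: 'b \<times> 'b. (fst z + c *\<^sub>R snd z, snd z))"
  define B where "B = (\<lambda>z :: 'b \<times> 'b. (fst z, snd z + (- Im s) *\<^sub>R fst z))"
  have s1: "(Re s)\<^sup>2 + (Im s)\<^sup>2 = 1" using s(1) cmod_power2[of s] by simp
  have c1: "1 - c * Im s = Re s" using s(2) by (simp add: c_def)
  have c2: "c + c * (1 - c * Im s) = Im s"
  proof -
    have "c + c * (1 - c * Im s) = c * (1 + Re s)" unfolding c1 by (simp add: algebra_simps)
    also have "\<dots> = (1 - (Re s)\<^sup>2) / Im s" by (simp add: c_def power2_eq_square algebra_simps)
    also have "\<dots> = (Im s)\<^sup>2 / Im s" using s1 by (simp add: algebra_simps)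
    finally show ?thesis using s(2) by (simp add: power2_eq_square)
  qed
  have rot: "rot s z = A (B (A z))" for z
  proof -
    have "fst (A (B (A z))) = (1 - c * Im s) *\<^sub>R fst z + (c *\<^sub>R snd z + (c * (1 - c * Im s)) *\<^sub>R snd z)"
      unfolding A_def B_def by (simp add: algebra_simps)
    also have "\<dots> = (1 - c * Im s) *\<^sub>R fst z + (c + c * (1 - c * Im s)) *\<^sub>R snd z"
      by (simp only: scaleR_add_left)
    finally have "fst (A (B (A z))) = (1 - c * Im s) *\<^sub>R fst z + (c + c * (1 - c * Im s)) *\<^sub>R snd z" .
    moreover have "snd (A (B (A z))) = (1 - c * Im s) *\<^sub>R snd z - Im s *\<^sub>R fst z"
      unfolding A_def B_def by (simp add: algebra_simps)
    ultimately show ?thesis unfolding rot_def c1 c2[unfolded c1] by (simp add: prod_eq_iff c1 c2[unfolded c1])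
  qed
  have cA: "continuous_on UNIV A" and cB: "continuous_on UNIV B"
    unfolding A_def B_def by (intro continuous_intros)+
  have m1: "(\<lambda>z. f (A z)) \<in> borel_measurable borel" by (rule borel_measurable_continuous_comp[OF f cA])
  have m2: "(\<lambda>z. f (A (B z))) \<in> borel_measurable borel" by (rule borel_measurable_continuous_comp[OF m1 cB])
  have "(\<integral>\<^sup>+z. f (A (B (A z))) \<partial>lborel) = (\<integral>\<^sup>+z. f (A (B z)) \<partial>lborel)"
    using nn_integral_shear(1)[OF m2, of c] by (simp add: A_def)
  also have "\<dots> = (\<integral>\<^sup>+z. f (A z) \<partial>lborel)"
    using nn_integral_shear(2)[OF m1, of "- Im s"] by (simp add: B_def)
  also have "\<dots> = (\<integral>\<^sup>+z. f z \<partial>lborel)"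
    using nn_integral_shear(1)[OF f, of c] by (simp add: A_def)
  finally show ?thesis by (simp add: rot)
qed

lemma tempered_gexp_clin:
  assumes "tempered a"
  shows "a (\<lambda>y. gexp X \<Omega> y * exp (s * clin P Q (y - X))) =
    of_real (exp (pi * (norm (fst (rot s (P, Q))))\<^sup>2)) * cis (2 * pi * (X \<bullet> snd (rot s (P, Q)))) *
      stft a gauss (X + fst (rot s (P, Q))) (\<Omega> + snd (rot s (P, Q)))"
  unfolding gexp_exp_shift stft_gauss rot_def fst_conv snd_conv
  by (rule tempered_cmult[OF assms schwartz_gexp])

text \<open>Holomorphy on single complex lines does not by itself give joint continuity. However,
  the growth bound controls all lines of unit direction through a point by the same constant on the
  unit disc, so Cauchy's estimate gives a Lipschitz bound at the point that is uniform in the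
  direction. Division by the continuous nonvanishing shift factor returns to the STFT.\<close>

lemma continuous_stft_gauss:
  fixes a :: "('b::euclidean_space \<Rightarrow> complex) \<Rightarrow> complex"
  assumes "tempered a"
  shows "continuous_on UNIV (\<lambda>z. stft a gauss (fst z) (snd z))"
proof -
  obtain C K where C: "0 \<le> C" "\<And>X \<Omega>. norm (stft a gauss X \<Omega>) \<le> C * (wt X * wt \<Omega>) ^ K"
    using stft_growth[OF assms] by blast
  have "isCont (\<lambda>z. stft a gauss (fst z) (snd z)) (X, \<Omega>)" for X \<Omega>
  proof -
    define H where "H = (\<lambda>w. a (\<lambda>y. gexp X \<Omega> y * exp (clin (fst w) (snd w) (y - X))))"
    \<comment> \<open>A shift of length at most 1 has Gaussian factor at most exp \<pi> and at most
      doubles each weight. The added 1 provides the strict inequality required by the open ball in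
      Cauchy's estimate.\<close>
    define D where "D = exp pi * (C * ((2 * wt X) * (2 * wt \<Omega>)) ^ K) + 1"
    have HV: "H w = of_real (exp (pi * (norm (fst w))\<^sup>2)) * cis (2 * pi * (X \<bullet> snd w)) *
        stft a gauss (X + fst w) (\<Omega> + snd w)" for w
      using tempered_gexp_clin[OF assms, of X \<Omega> 1 "fst w" "snd w"] by (simp add: H_def rot_def)
    have D0: "0 \<le> exp pi * (C * ((2 * wt X) * (2 * wt \<Omega>)) ^ K)"
      using C(1) by (intro mult_nonneg_nonneg zero_le_power) auto
    have lip: "norm (H w - H 0) \<le> (2 * D) * norm w" if w: "norm w \<le> 1/2" for w
    proof (cases "w = 0")
      case False
      define P where "P = fst (w /\<^sub>R norm w)"
      define Q where "Q = snd (w /\<^sub>R norm w)"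
      have nPQ: "norm (P, Q) = 1" unfolding P_def Q_def prod.collapse using False by simp
      define h where "h = (\<lambda>s. a (\<lambda>y. gexp X \<Omega> y * exp (s * clin P Q (y - X))))"
      have der: "(h has_field_derivative a (\<lambda>y. clin P Q (y - X) * (gexp X \<Omega> y * exp (s * clin P Q (y - X))))) (at s)" for s
        unfolding h_def by (rule tempered_gexp_has_field_derivative[OF assms])
      then have hol: "h holomorphic_on S" for S
        unfolding holomorphic_on_def field_differentiable_def
        using has_field_derivative_at_within by blast
      have hb: "norm (h s) < D" if s: "norm s \<le> 1" for s
      proof -
        define d where "d = rot s (P, Q)"
        have nd: "norm d \<le> 1" using s nPQ by (simp add: d_def norm_rot)
        have n1: "norm (fst d) \<le> 1" using nd norm_fst_le[of "fst d" "snd d"] by simp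
        have n2: "norm (snd d) \<le> 1" using nd norm_snd_le[of "snd d" "fst d"] by simp
        have "norm (h s) = exp (pi * (norm (fst d))\<^sup>2) * norm (stft a gauss (X + fst d) (\<Omega> + snd d))"
          unfolding h_def tempered_gexp_clin[OF assms] d_def[symmetric] by (simp add: norm_mult)
        also have "\<dots> \<le> exp pi * (C * (wt (X + fst d) * wt (\<Omega> + snd d)) ^ K)"
          using n1 by (intro mult_mono C) (auto simp: power_le_one)
        also have "\<dots> \<le> exp pi * (C * ((2 * wt X) * (2 * wt \<Omega>)) ^ K)"
        proof (intro mult_left_mono power_mono mult_mono)
          show "wt (X + fst d) \<le> 2 * wt X"
            using norm_triangle_mono[OF order_refl[of "norm X"] n1] norm_ge_zero[of X] unfolding wt_def by argo
          show "wt (\<Omega> + snd d) \<le> 2 * wt \<Omega>"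
            using norm_triangle_mono[OF order_refl[of "norm \<Omega>"] n2] norm_ge_zero[of \<Omega>] unfolding wt_def by argo
        qed (use C(1) in auto)
        finally show ?thesis unfolding D_def by simp
      qed
      have derb: "norm (deriv h s) \<le> 2 * D" if s: "norm s \<le> 1/2" for s
      proof -
        have "norm ((deriv ^^ 1) h s) \<le> fact 1 * D / (1/2) ^ 1"
        proof (rule Cauchy_higher_deriv_bound[where y = 0])
          show "continuous_on (cball s (1/2)) h" using hol holomorphic_on_imp_continuous_on by blast
          show "h v \<in> ball 0 D" if "v \<in> ball s (1/2)" for v
          proof -
            have "norm v \<le> norm s + dist s v"
              using norm_triangle_ineq2[of v s] by (simp add: dist_norm norm_minus_commute)
            then have "norm v \<le> 1" using that s by simp
            then show ?thesis using hb by simp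
          qed
        qed (use hol in auto)
        then show ?thesis by simp
      qed
      have "norm (h (of_real (norm w)) - h 0) \<le> 2 * D * norm (of_real (norm w) - (0::complex))"
      proof (rule field_differentiable_bound[where S = "cball 0 (1/2)" and f' = "deriv h"])
        show "(h has_field_derivative deriv h s) (at s within cball 0 (1/2))" if "s \<in> cball 0 (1/2)" for s
          using der[of s] DERIV_imp_deriv has_field_derivative_at_within by metis
      qed (use w derb in auto)
      moreover have "h (of_real (norm w)) = H w"
      proof -
        have "of_real (norm w) * clin P Q y = clin (fst w) (snd w) y" for y
        proof -
          have "y \<bullet> fst w = norm w * (y \<bullet> P)" "y \<bullet> snd w = norm w * (y \<bullet> Q)"
            using False by (simp_all add: P_def Q_def)
          then show ?thesis unfolding clin_def by (simp add: algebra_simps)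
        qed
        then show ?thesis by (simp add: h_def H_def)
      qed
      moreover have "h 0 = H 0" by (simp add: h_def H_def clin_def)
      ultimately show ?thesis by simp
    qed simp
    have "((\<lambda>w. H w - H 0) \<longlongrightarrow> 0) (at 0)"
    proof (rule Lim_null_comparison)
      show "\<forall>\<^sub>F w in at 0. norm (H w - H 0) \<le> (2 * D) * norm w"
        unfolding eventually_at using lip by (intro exI[of _ "1/2"]) auto
      show "((\<lambda>w::'b\<times>'b. (2 * D) * norm w) \<longlongrightarrow> 0) (at 0)"
        by (auto intro!: tendsto_eq_intros)
    qed
    then have "(H \<longlongrightarrow> H 0) (at 0)" by (rule LIM_zero_cancel)
    then have "((\<lambda>w. H w / (of_real (exp (pi * (norm (fst w))\<^sup>2)) * cis (2 * pi * (X \<bullet> snd w)))) \<longlongrightarrow>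
        H 0 / (of_real (exp (pi * (norm (fst (0::'b\<times>'b)))\<^sup>2)) * cis (2 * pi * (X \<bullet> snd (0::'b\<times>'b))))) (at 0)"
      by (intro tendsto_intros) auto
    also have "H 0 / (of_real (exp (pi * (norm (fst (0::'b\<times>'b)))\<^sup>2)) * cis (2 * pi * (X \<bullet> snd (0::'b\<times>'b)))) = stft a gauss X \<Omega>"
      by (simp add: HV)
    also have "(\<lambda>w. H w / (of_real (exp (pi * (norm (fst w))\<^sup>2)) * cis (2 * pi * (X \<bullet> snd w)))) =
        (\<lambda>w. stft a gauss (fst ((X, \<Omega>) + w)) (snd ((X, \<Omega>) + w)))"
      by (simp add: HV)
    finally show ?thesis
      unfolding isCont_def using LIM_offset_zero_iff[of "(X, \<Omega>)" "\<lambda>z. stft a gauss (fst z) (snd z)"] by simp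
  qed
  then show ?thesis by (auto simp: continuous_on_eq_continuous_at)
qed

subsection \<open>An integrable envelope for the symbol\<close>

text \<open>Here \<open>b\<close> is the supremum of \<open>G\<close>, finite by assumption, so it
  may be absorbed. For p \<le> 1 the inequality G \<le> b^(1-p) G^p turns the average of
  \<open>G\<close> into one of G^p, and b^(1-p) is cancelled. For p > 1 values below a level
  \<open>s\<close> are estimated by \<open>s\<close>, values above it by s^(1-p) G^p.\<close>

lemma sup_powr_le_nn_integral:
  fixes G :: "'c::euclidean_space \<Rightarrow> real" and p C m b :: real
  assumes p: "0 < p" and C: "0 < C" and m: "0 < m" "emeasure lborel (ball (0::'c) 1) = ennreal m"
    and G [measurable]: "G \<in> borel_measurable borel" and G0: "\<And>z. 0 \<le> G z"
    and Gb: "\<And>z. G z \<le> b" and bG: "\<And>c. (\<And>z. G z \<le> c) \<Longrightarrow> b \<le> c"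
    and sub: "\<And>z. ennreal (G z) \<le> ennreal C * (\<integral>\<^sup>+u. indicator (ball 0 1) u * ennreal (G (z + u)) \<partial>lborel)"
  shows "ennreal (b powr p) \<le> ennreal (C + 2 * C * (2 * C * m) powr (p - 1)) * (\<integral>\<^sup>+u. ennreal (G u powr p) \<partial>lborel)"
proof -
  let ?T = "\<integral>\<^sup>+u. ennreal (G u powr p) \<partial>lborel"
  let ?D = "C + 2 * C * (2 * C * m) powr (p - 1)"
  have D0: "0 < ?D" using C by (intro add_pos_nonneg) auto
  have b0: "0 \<le> b" using G0 Gb order_trans by blast
  have tr: "(\<integral>\<^sup>+u. ennreal (G (z + u) powr p) \<partial>lborel) = ?T" for z
    by (rule nn_integral_lborel_translate) measurable
  show ?thesis
  proof (cases "b = 0 \<or> ?T = \<infinity>")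
    case True
    then show ?thesis
    proof
      assume "?T = \<infinity>"
      then show ?thesis using D0 by (simp add: ennreal_mult_top)
    qed simp
  next
    case False
    then have bp: "0 < b" using b0 by simp
    obtain \<tau> where \<tau>: "0 \<le> \<tau>" "?T = ennreal \<tau>"
      using False by (cases ?T) auto
    have "b powr p \<le> ?D * \<tau>"
    proof (cases "p \<le> 1")
      case True
      have Gp: "G v \<le> b powr (1 - p) * G v powr p" for v
      proof (cases "G v = 0")
        case False
        then have "G v = G v powr (1 - p) * G v powr p"
          using G0[of v] by (simp add: powr_add[symmetric])
        also have "\<dots> \<le> b powr (1 - p) * G v powr p"
          using True G0 Gb by (intro mult_right_mono powr_mono2) auto
        finally show ?thesis .
      qed simp
      have "G z \<le> C * b powr (1 - p) * \<tau>" for z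
      proof -
        have "ennreal (G z) \<le> ennreal C * (\<integral>\<^sup>+u. indicator (ball 0 1) u * ennreal (G (z + u)) \<partial>lborel)" by (rule sub)
        also have "\<dots> \<le> ennreal C * (\<integral>\<^sup>+u. ennreal (b powr (1 - p)) * ennreal (G (z + u) powr p) \<partial>lborel)"
          using Gp by (intro mult_left_mono nn_integral_mono)
             (auto split: split_indicator simp: ennreal_mult[symmetric] intro!: ennreal_leI)
        also have "\<dots> = ennreal C * (ennreal (b powr (1 - p)) * ?T)"
          by (subst nn_integral_cmult) (auto simp: tr)
        also have "\<dots> = ennreal (C * b powr (1 - p) * \<tau>)"
          using \<tau> C by (simp add: ennreal_mult mult.assoc)
        finally show ?thesis using \<tau> C by (subst (asm) ennreal_le_iff) auto
      qed
      then have "b \<le> C * b powr (1 - p) * \<tau>" by (rule bG)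
      moreover have "b = b powr (1 - p) * b powr p" using bp by (simp add: powr_add[symmetric])
      ultimately have "b powr (1 - p) * b powr p \<le> b powr (1 - p) * (C * \<tau>)" by (simp add: algebra_simps)
      then have "b powr p \<le> C * \<tau>" using bp by simp
      also have "\<dots> \<le> ?D * \<tau>" using \<tau> C by (intro mult_right_mono) auto
      finally show ?thesis .
    next
      case False
      \<comment> \<open>The level at which the part below contributes C s m = b/2, which is moved to
        the left-hand side.\<close>
      define s where "s = b / (2 * C * m)"
      have s: "0 < s" using bp C m by (simp add: s_def)
      have Gp: "G v \<le> s + s powr (1 - p) * G v powr p" for v
      proof (cases "G v \<le> s")
        case True
        then show ?thesis by (simp add: add_increasing2)
      next
        case *: False
        then have "G v = G v powr (1 - p) * G v powr p"
          using s by (simp add: powr_add[symmetric])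
        also have "\<dots> \<le> s powr (1 - p) * G v powr p"
          using False * s by (intro mult_right_mono powr_mono2') auto
        finally show ?thesis using s by simp
      qed
      have "G z \<le> C * (s * m + s powr (1 - p) * \<tau>)" for z
      proof -
        have "ennreal (G z) \<le> ennreal C * (\<integral>\<^sup>+u. indicator (ball 0 1) u * ennreal (G (z + u)) \<partial>lborel)" by (rule sub)
        also have "\<dots> \<le> ennreal C * (\<integral>\<^sup>+u. ennreal s * indicator (ball 0 1) u
            + ennreal (s powr (1 - p)) * ennreal (G (z + u) powr p) \<partial>lborel)"
          using Gp s by (intro mult_left_mono nn_integral_mono)
             (auto split: split_indicator simp: ennreal_mult[symmetric] ennreal_plus[symmetric] simp del: ennreal_plus intro!: ennreal_leI)
        also have "\<dots> = ennreal C * (ennreal s * ennreal m + ennreal (s powr (1 - p)) * ?T)"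
        proof (subst nn_integral_add)
          show "(\<lambda>u. ennreal s * indicator (ball (0::'c) 1) u) \<in> borel_measurable lborel"
            by (intro borel_measurable_times_ennreal borel_measurable_indicator) auto
        qed (auto simp: nn_integral_cmult nn_integral_cmult_indicator tr m)
        also have "\<dots> = ennreal (C * (s * m + s powr (1 - p) * \<tau>))"
          using \<tau> C s m by (simp add: ennreal_mult ennreal_plus)
        finally show ?thesis using \<tau> C s m by (subst (asm) ennreal_le_iff) auto
      qed
      then have "b \<le> C * (s * m + s powr (1 - p) * \<tau>)" by (rule bG)
      also have "\<dots> = b / 2 + C * s powr (1 - p) * \<tau>"
        using C m by (simp add: s_def field_simps)
      finally have 1: "b \<le> 2 * C * s powr (1 - p) * \<tau>" by simp
      have 2: "s powr (1 - p) = b powr (1 - p) * (2 * C * m) powr (p - 1)"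
      proof -
        have "s powr (1 - p) = b powr (1 - p) * inverse ((2 * C * m) powr (1 - p))"
          unfolding s_def powr_divide by (rule divide_inverse)
        also have "inverse ((2 * C * m) powr (1 - p)) = (2 * C * m) powr (p - 1)"
          by (simp add: powr_minus[symmetric])
        finally show ?thesis .
      qed
      have "b powr (1 - p) * b powr p = b" using bp by (simp add: powr_add[symmetric])
      then have "b powr (1 - p) * b powr p \<le> b powr (1 - p) * (2 * C * (2 * C * m) powr (p - 1) * \<tau>)"
        using 1 unfolding 2 by (simp add: algebra_simps)
      then have "b powr p \<le> 2 * C * (2 * C * m) powr (p - 1) * \<tau>" using bp by simp
      also have "\<dots> \<le> ?D * \<tau>" using \<tau> C by (intro mult_right_mono) auto
      finally show ?thesis .
    qed
    then have "ennreal (b powr p) \<le> ennreal (?D * \<tau>)" by (rule ennreal_leI)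
    also have "\<dots> = ennreal ?D * ?T" unfolding \<tau>(2) using D0 \<tau>(1) by (intro ennreal_mult) auto
    finally show ?thesis .
  qed
qed

lemma emeasure_unit_ball:
  obtains m where "0 < m" "emeasure lborel (ball (0::'c::euclidean_space) 1) = ennreal m"
proof
  have f: "emeasure lborel (ball (0::'c) 1) < \<infinity>" using emeasure_bounded_finite[of "ball (0::'c) 1"] by simp
  show "emeasure lborel (ball (0::'c) 1) = ennreal (measure lborel (ball (0::'c) 1))"
    using f by (simp add: emeasure_eq_ennreal_measure less_top)
  show "0 < measure lborel (ball (0::'c) 1)"
    by (metis content_ball_pos zero_less_one measure_completion sets_lborel borel_open open_ball lmeasurable_ball)
qed

text \<open>For each \<eta> in the unit ball the circle mean bounds V(z) by values on the rotated
  points z + \<open>rot\<close> \<eta>, up to the factor exp \<pi> from the complex shift.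
  Integration over \<eta> and exchange with the angle give the ball average, since each rotation
  preserves both the ball and Lebesgue measure.\<close>

lemma stft_ball_mean:
  fixes a :: "('b::euclidean_space \<Rightarrow> complex) \<Rightarrow> complex"
  assumes "tempered a"
  defines "V \<equiv> \<lambda>z. stft a gauss (fst z) (snd z)"
  obtains C where "0 < C" "\<And>z. ennreal (norm (V z)) \<le>
     ennreal C * (\<integral>\<^sup>+u. indicator (ball 0 1) u * ennreal (norm (V (z + u))) \<partial>lborel)"
proof -
  obtain m where m: "0 < m" "emeasure lborel (ball (0::'b \<times> 'b) 1) = ennreal m"
    by (rule emeasure_unit_ball)
  have contV: "continuous_on S V" for S
    unfolding V_def using continuous_stft_gauss[OF assms(1)] continuous_on_subset by blast
  have "ennreal (norm (V z)) \<le> ennreal (exp pi / m) * (\<integral>\<^sup>+u. indicator (ball 0 1) u * ennreal (norm (V (z + u))) \<partial>lborel)" for z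
  proof -
    let ?B = "ball (0 :: 'b \<times> 'b) 1"
    define k where "k = (\<integral>\<^sup>+u. indicator ?B u * ennreal (norm (V (z + u))) \<partial>lborel)"
    obtain X \<Omega> where z: "z = (X, \<Omega>)" by (cases z)
    have pt: "ennreal (norm (V z)) \<le>
        (\<integral>\<^sup>+t. indicator {0..1} t * ennreal (exp pi * norm (V (z + rot (cis (2 * pi * t)) \<eta>))) \<partial>lborel)"
      if \<eta>: "\<eta> \<in> ?B" for \<eta>
    proof -
      obtain P Q where PQ: "\<eta> = (P, Q)" by (cases \<eta>)
      define h where "h = (\<lambda>s. a (\<lambda>y. gexp X \<Omega> y * exp (s * clin P Q (y - X))))"
      have hol: "h holomorphic_on UNIV"
        unfolding holomorphic_on_def field_differentiable_def h_def
        using tempered_gexp_has_field_derivative[OF assms(1)] has_field_derivative_at_within by blast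
      have hV: "norm (h s) = exp (pi * (norm (fst (rot s \<eta>)))\<^sup>2) * norm (V (z + rot s \<eta>))" for s
        unfolding h_def tempered_gexp_clin[OF assms(1)] V_def z PQ by (simp add: norm_mult)
      have "norm (V z) = norm (h 0)" by (simp add: hV rot_def zero_prod_def[symmetric])
      also have "ennreal \<dots> \<le> (\<integral>\<^sup>+ t. indicator {0..1} t * ennreal (norm (h (cis (2 * pi * t)))) \<partial>lborel)"
        by (rule circle_mean_norm_le[OF hol])
      also have "\<dots> \<le> (\<integral>\<^sup>+t. indicator {0..1} t * ennreal (exp pi * norm (V (z + rot (cis (2 * pi * t)) \<eta>))) \<partial>lborel)"
      proof (intro nn_integral_mono mult_left_mono ennreal_leI)
        fix t :: real
        have "norm (fst (rot (cis (2 * pi * t)) \<eta>)) \<le> norm (rot (cis (2 * pi * t)) \<eta>)"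
          using norm_fst_le[of "fst (rot (cis (2 * pi * t)) \<eta>)" "snd (rot (cis (2 * pi * t)) \<eta>)"] by simp
        also have "\<dots> \<le> 1" using \<eta> by (simp add: norm_rot)
        finally have "(norm (fst (rot (cis (2 * pi * t)) \<eta>)))\<^sup>2 \<le> 1" by (simp add: power_le_one)
        then show "norm (h (cis (2 * pi * t))) \<le> exp pi * norm (V (z + rot (cis (2 * pi * t)) \<eta>))"
          unfolding hV by (intro mult_right_mono) auto
      qed simp
      finally show ?thesis .
    qed
    define F where "F = (\<lambda>(t::real, \<eta>). indicator {0..1} t * (indicator ?B (rot (cis (2 * pi * t)) \<eta>) *
        ennreal (exp pi * norm (V (z + rot (cis (2 * pi * t)) \<eta>)))))"
    have mF: "F \<in> borel_measurable borel"
    proof -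
      have 1: "(\<lambda>p :: real \<times> ('b \<times> 'b). indicator {0..1} (fst p) :: ennreal) \<in> borel_measurable borel"
        by (rule borel_measurable_continuous_comp[of "indicator {0..1}"]) (auto intro!: continuous_intros)
      have 2: "(\<lambda>p :: real \<times> ('b \<times> 'b). indicator ?B (rot (cis (2 * pi * fst p)) (snd p)) :: ennreal) \<in> borel_measurable borel"
        by (rule borel_measurable_continuous_comp[of "indicator ?B"]) (auto intro!: continuous_intros borel_measurable_indicator)
      have 3: "(\<lambda>p :: real \<times> ('b \<times> 'b). exp pi * norm (V (z + rot (cis (2 * pi * fst p)) (snd p)))) \<in> borel_measurable borel"
        by (intro borel_measurable_continuous_onI continuous_intros continuous_on_compose2[OF contV[of UNIV]]) auto
      show ?thesis unfolding F_def split_beta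
        by (intro borel_measurable_times_ennreal 1 2 measurable_compose[OF 3 measurable_ennreal])
    qed
    have "ennreal m * ennreal (norm (V z)) = (\<integral>\<^sup>+\<eta>. ennreal (norm (V z)) * indicator ?B \<eta> \<partial>lborel)"
      by (subst nn_integral_cmult_indicator) (auto simp: m mult.commute)
    also have "\<dots> \<le> (\<integral>\<^sup>+\<eta>. (\<integral>\<^sup>+t. F (t, \<eta>) \<partial>lborel) \<partial>lborel)"
    proof (intro nn_integral_mono)
      fix \<eta>
      have "indicator ?B (rot (cis (2 * pi * t)) \<eta>) = (indicator ?B \<eta> :: ennreal)" for t
        by (simp add: indicator_def norm_rot)
      then show "ennreal (norm (V z)) * indicator ?B \<eta> \<le> (\<integral>\<^sup>+t. F (t, \<eta>) \<partial>lborel)"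
        using pt[of \<eta>] by (cases "\<eta> \<in> ?B") (simp_all add: F_def)
    qed
    also have "\<dots> = (\<integral>\<^sup>+t. (\<integral>\<^sup>+\<eta>. F (t, \<eta>) \<partial>lborel) \<partial>lborel)"
      using nn_integral_lborel_pair[OF mF] by simp
    also have "\<dots> = (\<integral>\<^sup>+t. indicator {0..1} t * (ennreal (exp pi) * k) \<partial>(lborel :: real measure))"
    proof (rule nn_integral_cong_AE)
      \<comment> \<open>At these parameters the rotation is by a multiple of \<pi>, where the
        factorisation into shears breaks down; they form a null set.\<close>
      have "AE t in (lborel :: real measure). t \<noteq> 0 \<and> t \<noteq> 1/2 \<and> t \<noteq> 1"
        using AE_lborel_singleton[of "0::real"] AE_lborel_singleton[of "1/2::real"] AE_lborel_singleton[of "1::real"]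
        by eventually_elim auto
      then show "AE t in lborel. (\<integral>\<^sup>+\<eta>. F (t, \<eta>) \<partial>lborel) = indicator {0..1} t * (ennreal (exp pi) * k)"
      proof eventually_elim
        fix t :: real assume t: "t \<noteq> 0 \<and> t \<noteq> 1/2 \<and> t \<noteq> 1"
        show "(\<integral>\<^sup>+\<eta>. F (t, \<eta>) \<partial>lborel) = indicator {0..1} t * (ennreal (exp pi) * k)"
        proof (cases "t \<in> {0..1}")
          case True
          have ns: "sin (2 * pi * t) \<noteq> 0"
          proof
            assume "sin (2 * pi * t) = 0"
            then obtain i :: int where "2 * pi * t = of_int i * pi" unfolding sin_zero_iff_int2 by blast
            then have i: "2 * t = of_int i" by simp
            have "0 \<le> real_of_int i" "real_of_int i \<le> 2" unfolding i[symmetric] using True by auto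
            then have "0 \<le> i" "i \<le> 2" by linarith+
            then have "i = 0 \<or> i = 1 \<or> i = 2" by arith
            with i t show False by auto
          qed
          let ?f = "\<lambda>u. indicator ?B u * ennreal (exp pi * norm (V (z + u)))"
          have mf: "?f \<in> borel_measurable borel"
            by (intro borel_measurable_times_ennreal borel_measurable_indicator measurable_compose[OF _ measurable_ennreal] borel_measurable_continuous_onI
               continuous_intros continuous_on_compose2[OF contV[of UNIV]]) auto
          have "(\<integral>\<^sup>+\<eta>. F (t, \<eta>) \<partial>lborel) = (\<integral>\<^sup>+\<eta>. ?f (rot (cis (2 * pi * t)) \<eta>) \<partial>lborel)"
            using True by (simp add: F_def)
          also have "\<dots> = (\<integral>\<^sup>+u. ?f u \<partial>lborel)"
            by (rule nn_integral_rot[OF mf]) (use ns in auto)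
          also have "\<dots> = (\<integral>\<^sup>+u. ennreal (exp pi) * (indicator ?B u * ennreal (norm (V (z + u)))) \<partial>lborel)"
            by (intro nn_integral_cong) (simp add: ennreal_mult ac_simps)
          also have "\<dots> = ennreal (exp pi) * k"
            unfolding k_def
          proof (intro nn_integral_cmult borel_measurable_times_ennreal borel_measurable_indicator)
            have "continuous_on UNIV (\<lambda>u. norm (V (z + u)))"
              by (intro continuous_intros continuous_on_compose2[OF contV[of UNIV]]) auto
            then show "(\<lambda>u. ennreal (norm (V (z + u)))) \<in> borel_measurable lborel"
              by (simp add: borel_measurable_continuous_onI)
          qed simp
          finally show ?thesis using True by simp
        qed (simp add: F_def)
      qed
    qed
    also have "\<dots> = ennreal (exp pi) * k"
      by (subst nn_integral_multc) auto
    finally have "ennreal m * ennreal (norm (V z)) \<le> ennreal (exp pi) * k" .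
    then have "ennreal (1 / m) * (ennreal m * ennreal (norm (V z))) \<le> ennreal (1 / m) * (ennreal (exp pi) * k)"
      by (rule mult_left_mono) simp
    then show ?thesis using m(1) unfolding k_def
      by (simp add: mult.assoc[symmetric] ennreal_mult[symmetric])
  qed
  then show ?thesis using m(1) by (intro that[of "exp pi / m"]) auto
qed

text \<open>The exponent 2 \<open>DIM\<close> assigns two powers of the weight to every coordinate,
  so the integrand is dominated by a product of the functions 1 / (1 + |t|)^2 and the integral
  factorises.\<close>

lemma nn_integral_wt_powr_finite:
  assumes "2 * real DIM('b::euclidean_space) \<le> s"
  shows "(\<integral>\<^sup>+x. ennreal (wt (x :: 'b) powr (- s)) \<partial>lborel) < \<infinity>"
proof -
  define g where "g = (\<lambda>t::real. 1 / (1 + \<bar>t\<bar>)\<^sup>2)"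
  have g1: "(\<integral>\<^sup>+t. ennreal (g t) * indicator {0..} t \<partial>lborel) = ennreal (0 - (- 1))"
  proof -
    have "(\<integral>\<^sup>+t. ennreal (1 / (1 + t)\<^sup>2) * indicator {0..} t \<partial>lborel) = ennreal (0 - (- 1 / (1 + 0)))"
    proof (rule nn_integral_FTC_atLeast)
      show "((\<lambda>t::real. - 1 / (1 + t)) has_real_derivative 1 / (1 + t)\<^sup>2) (at t)" if "0 \<le> t" for t
        using that by (auto intro!: derivative_eq_intros simp: power2_eq_square)
      show "((\<lambda>t::real. - 1 / (1 + t)) \<longlongrightarrow> 0) at_top"
        by (intro tendsto_divide_0[OF tendsto_const] filterlim_at_top_imp_at_infinity filterlim_tendsto_add_at_top[OF tendsto_const] filterlim_ident)
    qed auto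
    moreover have "(\<integral>\<^sup>+t. ennreal (g t) * indicator {0..} t \<partial>lborel) = (\<integral>\<^sup>+t. ennreal (1 / (1 + t)\<^sup>2) * indicator {0..} t \<partial>lborel)"
      by (intro nn_integral_cong) (auto simp: g_def split: split_indicator)
    ultimately show ?thesis by simp
  qed
  have mg [measurable]: "g \<in> borel_measurable borel" unfolding g_def by measurable
  have "(\<integral>\<^sup>+t. ennreal (g t) \<partial>lborel) \<le> (\<integral>\<^sup>+t. ennreal (g t) * indicator {0..} t + ennreal (g (-t)) * indicator {0..} (-t) \<partial>lborel)"
    by (intro nn_integral_mono) (auto split: split_indicator simp: g_def)
  also have "\<dots> = (\<integral>\<^sup>+t. ennreal (g t) * indicator {0..} t \<partial>lborel) + (\<integral>\<^sup>+t. ennreal (g (-t)) * indicator {0..} (-t) \<partial>lborel)"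
    by (intro nn_integral_add) measurable
  also have "(\<integral>\<^sup>+t. ennreal (g (-t)) * indicator {0..} (-t) \<partial>lborel) = (\<integral>\<^sup>+t. ennreal (g t) * indicator {0..} t \<partial>lborel)"
    using nn_integral_real_affine[of "\<lambda>t. ennreal (g t) * indicator {0..} t" "-1" 0] by simp
  finally have "(\<integral>\<^sup>+t. ennreal (g t) \<partial>lborel) \<le> ennreal (0 - (- 1)) + ennreal (0 - (- 1))" unfolding g1 .
  then have g: "(\<integral>\<^sup>+t. ennreal (g t) \<partial>lborel) < \<infinity>" by (rule order.strict_trans1) simp
  have "(\<integral>\<^sup>+x. ennreal (wt (x :: 'b) powr (- s)) \<partial>lborel) \<le> (\<integral>\<^sup>+x. (\<Prod>b\<in>Basis. ennreal (g ((x::'b) \<bullet> b))) \<partial>lborel)"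
  proof (intro nn_integral_mono)
    fix x :: 'b
    have "wt x powr (- s) \<le> wt x powr (- real (2 * DIM('b)))"
      using assms wt_ge_1 by (intro powr_mono) auto
    also have "\<dots> = 1 / wt x ^ (2 * DIM('b))" by (simp add: powr_minus powr_realpow divide_inverse del: of_nat_mult)
    also have "\<dots> = (\<Prod>b\<in>(Basis::'b set). 1 / (wt x)\<^sup>2)" by (simp add: power_mult power_one_over)
    also have "\<dots> \<le> (\<Prod>b\<in>Basis. g (x \<bullet> b))"
    proof (intro prod_mono conjI)
      fix b :: 'b assume "b \<in> Basis"
      then have "1 + \<bar>x \<bullet> b\<bar> \<le> wt x" using Basis_le_norm[of b x] by (simp add: wt_def)
      then show "1 / (wt x)\<^sup>2 \<le> g (x \<bullet> b)"
        unfolding g_def by (intro divide_left_mono power_mono mult_pos_pos zero_less_power) auto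
    qed simp
    finally have "ennreal (wt x powr (- s)) \<le> ennreal (\<Prod>b\<in>Basis. g (x \<bullet> b))" by (rule ennreal_leI)
    also have "\<dots> = (\<Prod>b\<in>Basis. ennreal (g (x \<bullet> b)))" by (intro prod_ennreal[symmetric]) (simp add: g_def)
    finally show "ennreal (wt x powr (- s)) \<le> (\<Prod>b\<in>Basis. ennreal (g (x \<bullet> b)))" .
  qed
  also have "\<dots> = (\<Prod>b\<in>(Basis :: 'b set). (\<integral>\<^sup>+t. ennreal (g t) \<partial>lborel))"
    by (rule nn_integral_lborel_prod) auto
  also have "\<dots> < \<infinity>"
    using g by (simp add: power_less_top_ennreal)
  finally show ?thesis .
qed

text \<open>Provides the measurability of the envelope, which is a supremum over an uncountable
  family.\<close>

lemma slowly_varying_continuous: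
  fixes b :: "'b::real_normed_vector \<Rightarrow> real"
  assumes b: "\<And>X Y. b X \<le> b Y * wt (X - Y) ^ K"
  shows "continuous_on UNIV b"
  unfolding continuous_on_eq_continuous_at[OF open_UNIV]
proof
  fix Y :: 'b
  have w: "((\<lambda>X. wt (X - Y) ^ K) \<longlongrightarrow> 1) (at Y)"
    unfolding wt_def by (rule tendsto_eq_intros refl | simp)+
  show "isCont b Y"
    unfolding isCont_def
  proof (rule tendsto_sandwich)
    show "((\<lambda>X. b Y / wt (X - Y) ^ K) \<longlongrightarrow> b Y) (at Y)"
      using tendsto_divide[OF tendsto_const w, of "b Y"] by simp
    show "((\<lambda>X. b Y * wt (X - Y) ^ K) \<longlongrightarrow> b Y) (at Y)"
      using tendsto_mult[OF tendsto_const w, of "b Y"] by simp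
    show "\<forall>\<^sub>F X in at Y. b Y / wt (X - Y) ^ K \<le> b X"
      using b[of Y] by (auto simp: pos_divide_le_eq wt_minus_commute[of Y])
    show "\<forall>\<^sub>F X in at Y. b X \<le> b Y * wt (X - Y) ^ K"
      using b by auto
  qed
qed

text \<open>The envelope is the Peetre maximal function of the STFT of \<open>a\<close>, with a polynomial weight in
  the frequency variable as well.\<close>

lemma stft_envelope:
  fixes a :: "('b::euclidean_space \<Rightarrow> complex) \<Rightarrow> complex" and p :: real
  assumes p: "0 < p" and a: "mod_space_inf p a"
  obtains b K where "\<And>X. 0 \<le> b X" "\<And>X Y. b X \<le> b Y * wt (X - Y) ^ K"
    "\<And>X \<Omega>. norm (stft a gauss X \<Omega>) \<le> b X * wt \<Omega> ^ K"
    "(\<integral>\<^sup>+X. ennreal (b X powr p) \<partial>lborel) < \<infinity>"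
proof -
  have ta: "tempered a" using a by (simp add: mod_space_inf_def)
  define V where "V = (\<lambda>z. stft a gauss (fst z) (snd z))"
  define S where "S = (SUP \<omega>. inner_Lp p (stft a gauss) \<omega>)"
  have S: "S < \<infinity>" using a by (simp add: mod_space_inf_def S_def)
  obtain C0 K0 where C0: "0 \<le> C0" "\<And>X \<Omega>. norm (stft a gauss X \<Omega>) \<le> C0 * (wt X * wt \<Omega>) ^ K0"
    using stft_growth[OF ta] by blast
  obtain C1 where C1: "0 < C1" "\<And>z. ennreal (norm (V z)) \<le>
     ennreal C1 * (\<integral>\<^sup>+u. indicator (ball 0 1) u * ennreal (norm (V (z + u))) \<partial>lborel)"
    using stft_ball_mean[OF ta] unfolding V_def by blast
  have contV: "continuous_on UNIV V" unfolding V_def by (rule continuous_stft_gauss[OF ta])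
  have [measurable]: "V \<in> borel_measurable borel" by (rule borel_measurable_continuous_onI[OF contV])
  \<comment> \<open>\<open>K0\<close> makes the maximal function finite by the growth bound; the
    second summand makes the p-th powers of the weights integrable, in position as well as in
    frequency.\<close>
  define K where "K = K0 + nat \<lceil>2 * real DIM('b) / p\<rceil>"
  have Kp: "2 * real DIM('b) \<le> real K * p"
  proof -
    have "2 * real DIM('b) / p \<le> real K" unfolding K_def by linarith
    then show ?thesis using p by (simp add: pos_divide_le_eq)
  qed
  define w where "w = (\<lambda>X z. 1 / (wt (X - fst z :: 'b) ^ K * wt (snd z :: 'b) ^ K))"
  have w_pos: "0 < w X z" for X z unfolding w_def by simp
  define G where "G = (\<lambda>X z. norm (V z) * w X z)"
  define b where "b = (\<lambda>X. SUP z. G X z)"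
  have G0: "0 \<le> G X z" for X z unfolding G_def using w_pos[of X z] by simp
  have G_le: "G X z \<le> c \<longleftrightarrow> norm (V z) \<le> c * (wt (X - fst z) ^ K * wt (snd z) ^ K)" for X z c
    unfolding G_def w_def by (simp add: pos_divide_le_eq)
  have bdd: "bdd_above (range (G X))" for X
  proof (rule bdd_aboveI2)
    fix z
    have "norm (V z) \<le> C0 * (wt (fst z) * wt (snd z)) ^ K0" unfolding V_def by (rule C0)
    also have "\<dots> \<le> C0 * ((wt X * wt (X - fst z)) * wt (snd z)) ^ K"
    proof (intro mult_left_mono C0)
      have "wt (fst z) \<le> wt X * wt (X - fst z)" using wt_le_mult_diff[of "fst z" X] by (simp add: wt_minus_commute)
      then have "(wt (fst z) * wt (snd z)) ^ K0 \<le> ((wt X * wt (X - fst z)) * wt (snd z)) ^ K0"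
        by (intro power_mono mult_right_mono) auto
      also have "\<dots> \<le> ((wt X * wt (X - fst z)) * wt (snd z)) ^ K"
      proof (rule power_increasing)
        have "1 * 1 * 1 \<le> wt X * wt (X - fst z) * wt (snd z)" by (intro mult_mono) (auto simp: wt_ge_1)
        then show "1 \<le> wt X * wt (X - fst z) * wt (snd z)" by simp
      qed (simp add: K_def)
      finally show "(wt (fst z) * wt (snd z)) ^ K0 \<le> ((wt X * wt (X - fst z)) * wt (snd z)) ^ K" .
    qed
    finally show "G X z \<le> C0 * wt X ^ K" unfolding G_le by (simp add: power_mult_distrib algebra_simps)
  qed
  have Gb: "G X z \<le> b X" for X z unfolding b_def by (rule cSUP_upper[OF UNIV_I bdd])
  have bG: "b X \<le> c" if "\<And>z. G X z \<le> c" for X c unfolding b_def by (rule cSUP_least) (auto intro: that)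
  have b0: "0 \<le> b X" for X using order_trans[OF G0 Gb] .
  have slow: "b X \<le> b Y * wt (X - Y) ^ K" for X Y
  proof (rule bG)
    fix z
    have "norm (V z) \<le> b Y * (wt (Y - fst z) ^ K * wt (snd z) ^ K)" using Gb[of Y z] unfolding G_le .
    also have "\<dots> \<le> b Y * ((wt (X - fst z) ^ K * wt (X - Y) ^ K) * wt (snd z) ^ K)"
      using wt_power_le_mult_diff[of "Y - fst z" K "X - fst z"] b0
      by (intro mult_left_mono mult_right_mono) (auto simp: wt_minus_commute)
    finally show "G X z \<le> b Y * wt (X - Y) ^ K" unfolding G_le by (simp add: algebra_simps)
  qed
  have Vb: "norm (stft a gauss X \<Omega>) \<le> b X * wt \<Omega> ^ K" for X \<Omega>
    using Gb[of X "(X, \<Omega>)"] unfolding G_le by (simp add: V_def wt_def)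
  obtain m where m: "0 < m" "emeasure lborel (ball (0::'b \<times> 'b) 1) = ennreal m"
    by (rule emeasure_unit_ball)
  \<comment> \<open>Moving \<open>z\<close> by less than 1 changes each of the two weight factors in
    \<open>w X\<close> by at most 2^K.\<close>
  define C where "C = C1 * 4 ^ K"
  have C: "0 < C" using C1 by (simp add: C_def)
  define D where "D = C + 2 * C * (2 * C * m) powr (p - 1)"
  have [measurable]: "w X \<in> borel_measurable borel" for X
    unfolding w_def by (intro borel_measurable_continuous_onI continuous_intros) auto
  have [measurable]: "G X \<in> borel_measurable borel" for X unfolding G_def by measurable
  have mball: "(\<lambda>u. indicator (ball (0::'b\<times>'b) 1) u * ennreal (g (z + u))) \<in> borel_measurable borel"
    if g: "g \<in> borel_measurable borel" for g z
  proof -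
    have "(\<lambda>u. g (z + u)) \<in> borel_measurable borel"
      by (rule borel_measurable_continuous_comp[OF g]) (intro continuous_intros)
    then show ?thesis
      by (intro borel_measurable_times_ennreal borel_measurable_indicator measurable_compose[OF _ measurable_ennreal]) auto
  qed
  have mbV: "(\<lambda>u. indicator (ball 0 1) u * ennreal (norm (V (z + u)))) \<in> borel_measurable borel" for z
    by (rule mball) measurable
  have mbG: "(\<lambda>u. indicator (ball 0 1) u * ennreal (G X (z + u))) \<in> borel_measurable borel" for X z
    by (rule mball) measurable
  have ptw: "ennreal (b X powr p) \<le> ennreal D * (\<integral>\<^sup>+u. ennreal (G X u powr p) \<partial>lborel)" for X
    unfolding D_def
  proof (rule sup_powr_le_nn_integral[OF p C m _ G0 Gb bG])
    fix z
    have w4: "w X z \<le> 4 ^ K * w X (z + u)" if u: "u \<in> ball 0 1" for u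
    proof -
      have "norm (fst u) \<le> 1" using u norm_fst_le[of "fst u" "snd u"] by simp
      then have f: "wt (fst u) \<le> 2" by (simp add: wt_def)
      have "norm (snd u) \<le> 1" using u norm_snd_le[of "snd u" "fst u"] by simp
      then have s: "wt (snd u) \<le> 2" by (simp add: wt_def)
      have "wt (X - fst (z + u)) \<le> wt (X - fst z) * wt (fst u)"
        using wt_add_le[of "X - fst z" "- fst u"] by (simp add: diff_diff_eq)
      also have "\<dots> \<le> wt (X - fst z) * 2" using f by (intro mult_left_mono) auto
      finally have 1: "wt (X - fst (z + u)) ^ K \<le> (wt (X - fst z) * 2) ^ K" by (intro power_mono) auto
      have "wt (snd (z + u)) \<le> wt (snd z) * wt (snd u)" using wt_add_le[of "snd z" "snd u"] by simp
      also have "\<dots> \<le> wt (snd z) * 2" using s by (intro mult_left_mono) auto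
      finally have 2: "wt (snd (z + u)) ^ K \<le> (wt (snd z) * 2) ^ K" by (intro power_mono) auto
      have "wt (X - fst (z + u)) ^ K * wt (snd (z + u)) ^ K \<le> (wt (X - fst z) * 2) ^ K * (wt (snd z) * 2) ^ K"
        by (intro mult_mono 1 2) auto
      also have "\<dots> = 4 ^ K * (wt (X - fst z) ^ K * wt (snd z) ^ K)"
      proof -
        have "(4::real) ^ K = 2 ^ K * 2 ^ K" by (simp add: power_mult_distrib[symmetric])
        then show ?thesis by (simp add: power_mult_distrib)
      qed
      finally have *: "wt (X - fst (z + u)) ^ K * wt (snd (z + u)) ^ K \<le> 4 ^ K * (wt (X - fst z) ^ K * wt (snd z) ^ K)" .
      have frac: "1 / A \<le> c * (1 / B)" if "0 < A" "0 < B" "B \<le> c * A" for A B c :: real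
        using that by (simp add: field_simps)
      show ?thesis unfolding w_def by (rule frac) (use * in auto)
    qed
    have "ennreal (G X z) = ennreal (norm (V z)) * ennreal (w X z)"
      unfolding G_def using w_pos[of X z] by (intro ennreal_mult) auto
    also have "\<dots> \<le> (ennreal C1 * (\<integral>\<^sup>+u. indicator (ball 0 1) u * ennreal (norm (V (z + u))) \<partial>lborel)) * ennreal (w X z)"
      by (intro mult_right_mono C1) auto
    also have "\<dots> = ennreal C1 * (\<integral>\<^sup>+u. indicator (ball 0 1) u * ennreal (norm (V (z + u))) * ennreal (w X z) \<partial>lborel)"
      by (subst nn_integral_multc) (auto simp: mult.assoc mbV)
    also have "\<dots> \<le> ennreal C1 * (\<integral>\<^sup>+u. ennreal (4 ^ K) * (indicator (ball 0 1) u * ennreal (G X (z + u))) \<partial>lborel)"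
    proof (intro mult_left_mono nn_integral_mono)
      fix u
      show "indicator (ball 0 1) u * ennreal (norm (V (z + u))) * ennreal (w X z)
          \<le> ennreal (4 ^ K) * (indicator (ball 0 1) u * ennreal (G X (z + u)))"
      proof (cases "u \<in> ball 0 1")
        case True
        have "norm (V (z + u)) * w X z \<le> 4 ^ K * G X (z + u)"
          unfolding G_def using mult_left_mono[OF w4[OF True], of "norm (V (z + u))"] by (simp add: algebra_simps)
        then show ?thesis using True w_pos[of X z] G0[of X "z + u"]
          by (simp add: ennreal_mult[symmetric] ennreal_leI)
      qed simp
    qed simp
    also have "\<dots> = ennreal C1 * (ennreal (4 ^ K) * (\<integral>\<^sup>+u. indicator (ball 0 1) u * ennreal (G X (z + u)) \<partial>lborel))"
      by (subst nn_integral_cmult) (auto simp: mbG)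
    also have "\<dots> = ennreal C * (\<integral>\<^sup>+u. indicator (ball 0 1) u * ennreal (G X (z + u)) \<partial>lborel)"
      unfolding C_def using C1(1) by (simp add: ennreal_mult mult.assoc)
    finally show "ennreal (G X z) \<le> ennreal C * (\<integral>\<^sup>+u. indicator (ball 0 1) u * ennreal (G X (z + u)) \<partial>lborel)" .
  qed (auto simp: D_def)
  define s where "s = real K * p"
  define A where "A = (\<integral>\<^sup>+x. ennreal (wt (x :: 'b) powr (- s)) \<partial>lborel)"
  have A: "A < \<infinity>" unfolding A_def s_def by (rule nn_integral_wt_powr_finite[OF Kp])
  have mw: "(\<lambda>x::'b. wt x powr (- s)) \<in> borel_measurable borel" by measurable
  have Gp: "G X u powr p = norm (V u) powr p * wt (snd u) powr (- s) * wt (X - fst u) powr (- s)" for X u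
  proof -
    have k: "(1 / wt x ^ K) powr p = wt x powr (- s)" for x :: 'b
    proof -
      have "1 / wt x ^ K = wt x powr (- real K)" by (simp add: powr_minus powr_realpow divide_inverse)
      then show ?thesis by (simp add: powr_powr s_def)
    qed
    have "G X u = norm (V u) * (1 / wt (snd u) ^ K) * (1 / wt (X - fst u) ^ K)" unfolding G_def w_def by simp
    then show ?thesis by (simp only: powr_mult k)
  qed
  define F where "F = (\<lambda>(X, u). ennreal (norm (V u) powr p * wt (snd u) powr (- s) * wt (X - fst u) powr (- s)))"
  have mF: "F \<in> borel_measurable borel"
  proof -
    have 1: "(\<lambda>x :: 'b \<times> ('b \<times> 'b). norm (V (snd x)) powr p) \<in> borel_measurable borel"
      by (rule borel_measurable_continuous_comp[where f = "\<lambda>u. norm (V u) powr p"]) (measurable, intro continuous_intros)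
    have 2: "(\<lambda>x :: 'b \<times> ('b \<times> 'b). wt (snd (snd x)) powr (- s)) \<in> borel_measurable borel"
      by (rule borel_measurable_continuous_comp[OF mw]) (intro continuous_intros)
    have 3: "(\<lambda>x :: 'b \<times> ('b \<times> 'b). wt (fst x - fst (snd x)) powr (- s)) \<in> borel_measurable borel"
      by (rule borel_measurable_continuous_comp[OF mw]) (intro continuous_intros)
    show ?thesis unfolding F_def split_beta
      by (intro measurable_compose[OF _ measurable_ennreal] borel_measurable_times 1 2 3)
  qed
  have mF2: "(\<lambda>X. F (X, u)) \<in> borel_measurable borel" for u
    by (rule borel_measurable_continuous_comp[OF mF]) (intro continuous_intros)
  have mF3: "(\<lambda>u. F (X, u)) \<in> borel_measurable borel" for X
    by (rule borel_measurable_continuous_comp[OF mF]) (intro continuous_intros)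
  have inner: "(\<integral>\<^sup>+X. F (X, u) \<partial>lborel) = ennreal (norm (V u) powr p * wt (snd u) powr (- s)) * A" for u
  proof -
    have "(\<integral>\<^sup>+X. F (X, u) \<partial>lborel) = (\<integral>\<^sup>+X. ennreal (norm (V u) powr p * wt (snd u) powr (- s)) * ennreal (wt (- fst u + X) powr (- s)) \<partial>lborel)"
      unfolding F_def by (intro nn_integral_cong) (simp add: ennreal_mult)
    also have "\<dots> = ennreal (norm (V u) powr p * wt (snd u) powr (- s)) * (\<integral>\<^sup>+X. ennreal (wt (- fst u + X) powr (- s)) \<partial>lborel)"
      by (rule nn_integral_cmult) measurable
    also have "(\<integral>\<^sup>+X. ennreal (wt (- fst u + X) powr (- s)) \<partial>lborel) = A"
      unfolding A_def by (rule nn_integral_lborel_translate) measurable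
    finally show ?thesis .
  qed
  have mVp: "(\<lambda>u. norm (V u) powr p * wt (snd u) powr (- s)) \<in> borel_measurable borel"
    by (intro borel_measurable_times borel_measurable_continuous_comp[OF mw]) (measurable, intro continuous_intros)
  \<comment> \<open>The p-th power of \<open>G\<close> is |V|^p times a weight in position and one
    in frequency. Integrating first in \<open>X\<close>, the former yields one factor
    \<open>A\<close>. Bounding the position slices of |V|^p by \<open>S\<close> leaves the latter,
    which yields the second \<open>A\<close>.\<close>
  have "(\<integral>\<^sup>+X. ennreal (b X powr p) \<partial>lborel) \<le> (\<integral>\<^sup>+X. ennreal D * (\<integral>\<^sup>+u. F (X, u) \<partial>lborel) \<partial>lborel)"
    using ptw unfolding Gp F_def by (intro nn_integral_mono) auto
  also have "\<dots> = ennreal D * (\<integral>\<^sup>+X. (\<integral>\<^sup>+u. F (X, u) \<partial>lborel) \<partial>lborel)"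
  proof (rule nn_integral_cmult)
    show "(\<lambda>X. \<integral>\<^sup>+u. F (X, u) \<partial>lborel) \<in> borel_measurable lborel"
      using mF by (intro lborel.borel_measurable_nn_integral) (simp add: lborel_prod)
  qed
  also have "(\<integral>\<^sup>+X. (\<integral>\<^sup>+u. F (X, u) \<partial>lborel) \<partial>lborel) = (\<integral>\<^sup>+u. (\<integral>\<^sup>+X. F (X, u) \<partial>lborel) \<partial>lborel)"
    using nn_integral_lborel_pair[OF mF] by simp
  also have "\<dots> = (\<integral>\<^sup>+u. ennreal (norm (V u) powr p * wt (snd u) powr (- s)) * A \<partial>lborel)"
    unfolding inner ..
  also have "\<dots> = (\<integral>\<^sup>+u. ennreal (norm (V u) powr p * wt (snd u) powr (- s)) \<partial>lborel) * A"
    by (intro nn_integral_multc) (use mVp in measurable)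
  also have "(\<integral>\<^sup>+u. ennreal (norm (V u) powr p * wt (snd u) powr (- s)) \<partial>lborel) =
      (\<integral>\<^sup>+\<Omega>. (\<integral>\<^sup>+X. ennreal (norm (V (X, \<Omega>)) powr p * wt \<Omega> powr (- s)) \<partial>lborel) \<partial>lborel)"
    using nn_integral_lborel_pair(2)[OF measurable_compose[OF mVp measurable_ennreal]] by simp
  also have "\<dots> \<le> (\<integral>\<^sup>+\<Omega>. S * ennreal (wt (\<Omega> :: 'b) powr (- s)) \<partial>lborel)"
  proof (intro nn_integral_mono)
    fix \<Omega> :: 'b
    have mV1: "(\<lambda>X. norm (V (X, \<Omega>)) powr p) \<in> borel_measurable borel"
      by (rule borel_measurable_continuous_comp[where f = "\<lambda>u. norm (V u) powr p"]) (measurable, intro continuous_intros)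
    have "(\<integral>\<^sup>+X. ennreal (norm (V (X, \<Omega>)) powr p * wt \<Omega> powr (- s)) \<partial>lborel) =
       (\<integral>\<^sup>+X. ennreal (norm (V (X, \<Omega>)) powr p) \<partial>lborel) * ennreal (wt \<Omega> powr (- s))"
      by (subst nn_integral_multc[symmetric]) (use mV1 in \<open>auto simp: ennreal_mult\<close>)
    also have "(\<integral>\<^sup>+X. ennreal (norm (V (X, \<Omega>)) powr p) \<partial>lborel) = inner_Lp p (stft a gauss) \<Omega>"
      unfolding inner_Lp_def V_def by (simp add: nn_integral_completion)
    also have "\<dots> * ennreal (wt \<Omega> powr (- s)) \<le> S * ennreal (wt \<Omega> powr (- s))"
      unfolding S_def by (intro mult_right_mono SUP_upper) auto
    finally show "(\<integral>\<^sup>+X. ennreal (norm (V (X, \<Omega>)) powr p * wt \<Omega> powr (- s)) \<partial>lborel) \<le> S * ennreal (wt \<Omega> powr (- s))" .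
  qed
  also have "\<dots> = S * A" unfolding A_def by (rule nn_integral_cmult) measurable
  finally have "(\<integral>\<^sup>+X. ennreal (b X powr p) \<partial>lborel) \<le> ennreal D * (S * A * A)"
    by (simp add: mult_left_mono mult_right_mono)
  also have "\<dots> < \<infinity>" using S A by (simp add: ennreal_mult_less_top)
  finally show ?thesis by (intro that[of b K] b0 slow Vb)
qed

subsection \<open>Integration by parts\<close>

lemma lborel_translate:
  fixes f :: "'b::euclidean_space \<Rightarrow> 'c::{banach, second_countable_topology}"
  assumes [measurable]: "f \<in> borel_measurable borel"
  shows "integrable lborel (\<lambda>x. f (x + c)) \<longleftrightarrow> integrable lborel f"
    and "(LINT x|lborel. f (x + c)) = (LINT x|lborel. f x)"
proof -
  have d: "distr lborel borel ((+) c) = (lborel :: 'b measure)" by (rule lborel_distr_plus)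
  have "integrable (distr lborel borel ((+) c)) f \<longleftrightarrow> integrable lborel (\<lambda>x. f (c + x))"
    by (rule integrable_distr_eq) auto
  then show "integrable lborel (\<lambda>x. f (x + c)) \<longleftrightarrow> integrable lborel f"
    unfolding d by (simp add: add.commute)
  have "integral\<^sup>L (distr lborel borel ((+) c)) f = (LINT x|lborel. f (c + x))"
    by (rule integral_distr) auto
  then show "(LINT x|lborel. f (x + c)) = (LINT x|lborel. f x)"
    unfolding d by (simp add: add.commute)
qed

lemma has_vector_derivative_iff_quotient:
  fixes F :: "real \<Rightarrow> 'c::real_normed_vector"
  shows "(F has_vector_derivative D) (at 0) \<longleftrightarrow> ((\<lambda>h. (F h - F 0) /\<^sub>R h) \<longlongrightarrow> D) (at 0)"
proof -
  have "norm (F h - F 0 - h *\<^sub>R D) / norm h = norm ((F h - F 0) /\<^sub>R h - D)" if "h \<noteq> 0" for h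
  proof -
    have "F h - F 0 - h *\<^sub>R D = h *\<^sub>R ((F h - F 0) /\<^sub>R h - D)" using that by (simp add: algebra_simps)
    then have "norm (F h - F 0 - h *\<^sub>R D) = \<bar>h\<bar> * norm ((F h - F 0) /\<^sub>R h - D)" by (metis norm_scaleR)
    then show ?thesis using that by simp
  qed
  then have "((\<lambda>h. norm (F h - F 0 - h *\<^sub>R D) / norm h) \<longlongrightarrow> 0) (at 0) \<longleftrightarrow>
      ((\<lambda>h. norm ((F h - F 0) /\<^sub>R h - D)) \<longlongrightarrow> 0) (at 0)"
    by (intro filterlim_cong) (auto simp: eventually_at intro!: exI[of _ 1])
  then show ?thesis
    unfolding has_vector_derivative_def has_derivative_at
    by (simp add: bounded_linear_scaleR_left tendsto_norm_zero_iff LIM_zero_iff)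
qed

text \<open>Dominated convergence along sequences; the mean value inequality on (-1, 1) bounds every
  difference quotient by the same majorant \<open>D\<close> that bounds the derivatives.\<close>

lemma integral_has_vector_derivative_0:
  fixes K :: "real \<Rightarrow> 'a::euclidean_space \<Rightarrow> complex"
  assumes int: "\<And>t. \<bar>t\<bar> < 1 \<Longrightarrow> integrable lborel (K t)"
    and der: "\<And>t y. \<bar>t\<bar> < 1 \<Longrightarrow> ((\<lambda>t. K t y) has_vector_derivative K' t y) (at t)"
    and bd: "\<And>t y. \<bar>t\<bar> < 1 \<Longrightarrow> norm (K' t y) \<le> D y"
    and D: "integrable lborel D" and mK': "K' 0 \<in> borel_measurable lborel"
  shows "((\<lambda>t. LINT y|lborel. K t y) has_vector_derivative (LINT y|lborel. K' 0 y)) (at 0)"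
  unfolding has_vector_derivative_iff_quotient tendsto_at_iff_sequentially
proof (intro allI impI)
  fix u :: "nat \<Rightarrow> real" assume u0: "\<forall>i. u i \<in> UNIV - {0}" and u: "u \<longlonglongrightarrow> 0"
  obtain N where N: "\<And>n. N \<le> n \<Longrightarrow> \<bar>u n\<bar> < 1"
    using LIMSEQ_D[OF u, of 1] by auto
  define q where "q = (\<lambda>n y. (K (u (n + N)) y - K 0 y) /\<^sub>R u (n + N))"
  have i: "integrable lborel (K (u (n + N)))" "integrable lborel (K 0)" for n
    using int N[of "n + N"] by auto
  have "(\<lambda>n. LINT y|lborel. q n y) \<longlonglongrightarrow> (LINT y|lborel. K' 0 y)"
  proof (rule integral_dominated_convergence[OF mK' _ D])
    show "q n \<in> borel_measurable lborel" for n
      unfolding q_def using i(1)[of n] i(2) by (intro borel_measurable_scaleR borel_measurable_diff) auto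
    show "AE y in lborel. (\<lambda>n. q n y) \<longlonglongrightarrow> K' 0 y"
    proof (rule AE_I2)
      fix y
      have "((\<lambda>h. (K h y - K 0 y) /\<^sub>R h) \<longlongrightarrow> K' 0 y) (at 0)"
        using der[of 0 y] by (simp add: has_vector_derivative_iff_quotient)
      then have "(\<lambda>n. (K (u n) y - K 0 y) /\<^sub>R u n) \<longlonglongrightarrow> K' 0 y"
        using u0 u unfolding tendsto_at_iff_sequentially by (auto simp: o_def)
      then show "(\<lambda>n. q n y) \<longlonglongrightarrow> K' 0 y"
        unfolding q_def by (rule LIMSEQ_ignore_initial_segment)
    qed
    show "AE y in lborel. norm (q n y) \<le> D y" for n
    proof (rule AE_I2)
      fix y
      let ?h = "u (n + N)"
      have h: "?h \<noteq> 0" "\<bar>?h\<bar> < 1" using u0 N[of "n + N"] by auto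
      have "norm (K ?h y - K 0 y) \<le> D y * norm (?h - 0)"
      proof (rule differentiable_bound[where S = "{-1<..<1}" and f = "\<lambda>t. K t y" and f' = "\<lambda>t h. h *\<^sub>R K' t y"])
        show "((\<lambda>t. K t y) has_derivative (\<lambda>h. h *\<^sub>R K' x y)) (at x within {-1<..<1})" if "x \<in> {-1<..<1}" for x
          by (rule has_derivative_at_withinI) (use der[of x y] that in \<open>simp add: has_vector_derivative_def abs_less_iff\<close>)
        show "onorm (\<lambda>h. h *\<^sub>R K' x y) \<le> D y" if "x \<in> {-1<..<1}" for x
        proof (rule onorm_le)
          fix h :: real
          have "norm (K' x y) \<le> D y" using bd[of x y] that by (simp add: abs_less_iff)
          then have "norm (K' x y) * \<bar>h\<bar> \<le> D y * \<bar>h\<bar>" by (rule mult_right_mono) simp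
          then show "norm (h *\<^sub>R K' x y) \<le> D y * norm h"
            by (simp add: mult.commute)
        qed
      qed (use h in auto)
      then show "norm (q n y) \<le> D y"
        unfolding q_def norm_scaleR using h by (simp add: inverse_eq_divide pos_divide_le_eq)
    qed
  qed
  moreover have "(LINT y|lborel. q n y) = ((LINT y|lborel. K (u (n + N)) y) - (LINT y|lborel. K 0 y)) /\<^sub>R u (n + N)" for n
    unfolding q_def using i(1)[of n] i(2) by simp
  ultimately have "(\<lambda>n. ((LINT y|lborel. K (u (n + N)) y) - (LINT y|lborel. K 0 y)) /\<^sub>R u (n + N)) \<longlonglongrightarrow> (LINT y|lborel. K' 0 y)"
    by simp
  then have "(\<lambda>n. ((LINT y|lborel. K (u n) y) - (LINT y|lborel. K 0 y)) /\<^sub>R u n) \<longlonglongrightarrow> (LINT y|lborel. K' 0 y)"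
    by (rule LIMSEQ_offset)
  then show "((\<lambda>h. ((LINT y|lborel. K h y) - (LINT y|lborel. K 0 y)) /\<^sub>R h) \<circ> u) \<longlonglongrightarrow> (LINT y|lborel. K' 0 y)"
    by (simp add: o_def)
qed

text \<open>A derivative along one fixed direction at every point. Differentiation under the
  integral sign delivers exactly this for the STFT of a square-integrable function, and integration
  by parts consumes exactly this.\<close>

definition has_dir_deriv :: "('b::real_normed_vector \<Rightarrow> complex) \<Rightarrow> 'b \<Rightarrow> ('b \<Rightarrow> complex) \<Rightarrow> bool" where
  "has_dir_deriv U v U' \<longleftrightarrow> (\<forall>z. ((\<lambda>t. U (z + t *\<^sub>R v)) has_vector_derivative U' z) (at 0))"

lemma has_dir_deriv_at:
  assumes "has_dir_deriv U v U'"
  shows "((\<lambda>t. U (z + t *\<^sub>R v)) has_vector_derivative U' (z + t *\<^sub>R v)) (at t)"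
proof -
  have "((\<lambda>s. U ((z + t *\<^sub>R v) + s *\<^sub>R v)) has_vector_derivative U' (z + t *\<^sub>R v)) (at (t - t))"
    using assms unfolding has_dir_deriv_def by simp
  moreover have "((\<lambda>s. s - t) has_vector_derivative 1) (at t)"
    by (auto intro!: derivative_eq_intros simp: has_vector_derivative_def)
  ultimately have "((\<lambda>s. U ((z + t *\<^sub>R v) + s *\<^sub>R v)) \<circ> (\<lambda>s. s - t) has_vector_derivative (1 *\<^sub>R U' (z + t *\<^sub>R v))) (at t)"
    by (intro vector_diff_chain_at)
  moreover have "(\<lambda>s. U ((z + t *\<^sub>R v) + s *\<^sub>R v)) \<circ> (\<lambda>s. s - t) = (\<lambda>s. U (z + s *\<^sub>R v))"
    by (simp add: fun_eq_iff algebra_simps)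
  ultimately show ?thesis by simp
qed

lemma has_dir_deriv_mult:
  assumes "has_dir_deriv U v U'" "has_dir_deriv W v W'"
  shows "has_dir_deriv (\<lambda>z. U z * W z) v (\<lambda>z. U z * W' z + U' z * W z)"
  unfolding has_dir_deriv_def
proof
  fix z
  from has_vector_derivative_mult[OF assms[unfolded has_dir_deriv_def, rule_format, of z]]
  show "((\<lambda>t. U (z + t *\<^sub>R v) * W (z + t *\<^sub>R v)) has_vector_derivative U z * W' z + U' z * W z) (at 0)" by simp
qed

lemma has_dir_deriv_cnj:
  assumes "has_dir_deriv U v U'"
  shows "has_dir_deriv (\<lambda>z. cnj (U z)) v (\<lambda>z. cnj (U' z))"
  using assms unfolding has_dir_deriv_def by (intro allI has_vector_derivative_cnj) auto

lemma has_dir_deriv_shift: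
  assumes "has_dir_deriv U v U'"
  shows "has_dir_deriv (\<lambda>z. U (z - c)) v (\<lambda>z. U' (z - c))"
  unfolding has_dir_deriv_def
proof
  fix z
  have "((\<lambda>t. U ((z - c) + t *\<^sub>R v)) has_vector_derivative U' (z - c)) (at 0)"
    using assms unfolding has_dir_deriv_def by blast
  then show "((\<lambda>t. U (z + t *\<^sub>R v - c)) has_vector_derivative U' (z - c)) (at 0)"
    by (simp add: diff_add_eq)
qed

lemma has_dir_deriv_schwartz:
  assumes "schwartz f"
  shows "has_dir_deriv f v (\<lambda>z. frechet_derivative f (at z) v)"
  unfolding has_dir_deriv_def
proof
  fix z
  have 1: "(f has_derivative frechet_derivative f (at z)) (at (z + 0 *\<^sub>R v))"
    using schwartz_has_derivative[OF assms, of z] by simp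
  have 2: "((\<lambda>t. z + t *\<^sub>R v) has_derivative (\<lambda>t. t *\<^sub>R v)) (at 0)"
    by (auto intro!: derivative_eq_intros)
  have "((\<lambda>t. f (z + t *\<^sub>R v)) has_derivative (\<lambda>t. frechet_derivative f (at z) (t *\<^sub>R v))) (at 0)"
    by (rule has_derivative_compose[OF 2 1])
  moreover have "frechet_derivative f (at z) (t *\<^sub>R v) = t *\<^sub>R frechet_derivative f (at z) v" for t
    by (rule linear_scale) (rule linear_frechet_derivative[OF schwartz_differentiable[OF assms]])
  ultimately show "((\<lambda>t. f (z + t *\<^sub>R v)) has_vector_derivative frechet_derivative f (at z) v) (at 0)"
    unfolding has_vector_derivative_def by simp
qed

lemma has_vector_derivative_cis_linear:
  "((\<lambda>t. cis (a + b * t)) has_vector_derivative (\<i> * of_real b * cis (a + b * t))) (at t)"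
proof -
  have "((\<lambda>z. exp (\<i> * (of_real a + of_real b * z))) has_field_derivative (exp (\<i> * (of_real a + of_real b * of_real t)) * (\<i> * of_real b))) (at (of_real t))"
    by (auto intro!: derivative_eq_intros)
  from has_vector_derivative_real_field[OF this] show ?thesis
    by (simp add: cis_conv_exp mult.commute)
qed

lemma has_dir_deriv_char:
  "has_dir_deriv (\<lambda>z. cis (- 2 * pi * (z \<bullet> \<Omega>))) v (\<lambda>z. - (2 * of_real pi * \<i> * of_real (v \<bullet> \<Omega>)) * cis (- 2 * pi * (z \<bullet> \<Omega>)))"
  unfolding has_dir_deriv_def
proof
  fix z :: 'a
  show "((\<lambda>t. cis (- 2 * pi * ((z + t *\<^sub>R v) \<bullet> \<Omega>))) has_vector_derivative
      - (2 * of_real pi * \<i> * of_real (v \<bullet> \<Omega>)) * cis (- 2 * pi * (z \<bullet> \<Omega>))) (at 0)"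
    using has_vector_derivative_cis_linear[of "- 2 * pi * (z \<bullet> \<Omega>)" "- 2 * pi * (v \<bullet> \<Omega>)" 0]
    by (simp add: inner_add_left algebra_simps)
qed

text \<open>The integral of a directional derivative vanishes: by Fubini it equals the integral over \<open>z\<close>
  of the increment of the function from \<open>z\<close> to \<open>z + v\<close>.\<close>

lemma has_dir_deriv_integral_eq_0:
  fixes U :: "'b::euclidean_space \<Rightarrow> complex"
  assumes d: "has_dir_deriv U v U'" and U: "integrable lborel U" and U': "integrable lborel U'"
  shows "(LINT z|lborel. U' z) = 0"
proof -
  have mU [measurable]: "U \<in> borel_measurable borel" and mU' [measurable]: "U' \<in> borel_measurable borel"
    using U U' by auto
  define g where "g = (\<lambda>(t::real, z). indicator {0..1} t *\<^sub>R U' (z + t *\<^sub>R v))"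
  have mg: "g \<in> borel_measurable (lborel \<Otimes>\<^sub>M lborel)"
  proof -
    have "(\<lambda>p :: real \<times> 'b. U' (snd p + fst p *\<^sub>R v)) \<in> borel_measurable borel"
      by (rule borel_measurable_continuous_comp[OF mU']) (intro continuous_intros)
    moreover have "(\<lambda>p :: real \<times> 'b. indicator {0..1} (fst p) :: real) \<in> borel_measurable borel"
      by (rule borel_measurable_continuous_comp[of "indicator {0..1}"]) (auto intro!: continuous_intros)
    ultimately show ?thesis unfolding g_def split_beta by (simp add: lborel_prod)
  qed
  have gi: "integrable lborel (\<lambda>z. g (t, z))" for t
    unfolding g_def using lborel_translate(1)[OF mU', of "t *\<^sub>R v"] U' by simp
  have g1: "(LINT z|lborel. g (t, z)) = indicator {0..1} t *\<^sub>R (LINT z|lborel. U' z)" for t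
    unfolding g_def using lborel_translate(2)[OF mU', of "t *\<^sub>R v"] by simp
  have g2: "(LINT z|lborel. norm (g (t, z))) = indicator {0..1} t *\<^sub>R (LINT z|lborel. norm (U' z))" for t
    unfolding g_def using lborel_translate(2)[of "\<lambda>z. norm (U' z)" "t *\<^sub>R v"] by simp
  have int01: "integrable lborel (\<lambda>t::real. indicator {0..1} t *\<^sub>R (c :: 'c::{banach,second_countable_topology}))" for c
    by (intro integrable_scaleR_left integrable_real_indicator) auto
  have int: "integrable (lborel \<Otimes>\<^sub>M lborel) g"
    by (rule lborel_pair.Fubini_integrable[OF mg]) (use gi g2 int01 in auto)
  have "(LINT z|lborel. (LINT t|lborel. g (t, z))) = (LINT t|lborel. (LINT z|lborel. g (t, z)))"
    using lborel_pair.Fubini_integral[of "\<lambda>t z. g (t, z)"] int by simp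
  also have "\<dots> = (LINT z|lborel. U' z)" unfolding g1 by simp
  finally have "(LINT z|lborel. U' z) = (LINT z|lborel. (LINT t|lborel. g (t, z)))" ..
  also have "\<dots> = (LINT z|lborel. U (z + v) - U z)"
  proof (rule integral_cong_AE)
    have mgs: "(\<lambda>(z, t). g (t, z)) \<in> borel_measurable (lborel \<Otimes>\<^sub>M lborel)"
      using measurable_pair_swap[OF mg] .
    show "(\<lambda>z. LINT t|lborel. g (t, z)) \<in> borel_measurable lborel"
      by (rule lborel.borel_measurable_lebesgue_integral) (use mgs in simp)
    have "(\<lambda>z. U (z + v)) \<in> borel_measurable borel"
      by (rule borel_measurable_continuous_comp[OF mU]) (intro continuous_intros)
    then show "(\<lambda>z. U (z + v) - U z) \<in> borel_measurable lborel" by simp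
    \<comment> \<open>The derivative need not be continuous, so the fundamental theorem yields only
      a gauge integral over the segment. Integrability along almost every segment, from Fubini,
      identifies it with the Lebesgue integral.\<close>
    have "AE z in lborel. integrable lborel (\<lambda>t. g (t, z))"
      using lborel_pair.AE_integrable_snd[of "\<lambda>t z. g (t, z)"] int by simp
    then show "AE z in lborel. (LINT t|lborel. g (t, z)) = U (z + v) - U z"
    proof eventually_elim
      fix z assume "integrable lborel (\<lambda>t. g (t, z))"
      then have si: "set_integrable lborel {0..1} (\<lambda>t. U' (z + t *\<^sub>R v))"
        unfolding set_integrable_def g_def by simp
      have "((\<lambda>t. U' (z + t *\<^sub>R v)) has_integral (U (z + 1 *\<^sub>R v) - U (z + 0 *\<^sub>R v))) {0..1}"
        by (rule fundamental_theorem_of_calculus)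
          (auto intro: has_vector_derivative_at_within has_dir_deriv_at[OF d])
      then show "(LINT t|lborel. g (t, z)) = U (z + v) - U z"
        using set_borel_integral_eq_integral(2)[OF si]
        unfolding set_lebesgue_integral_def g_def by (simp add: integral_unique)
    qed
  qed
  also have "\<dots> = 0"
    using U lborel_translate[OF mU, of v] by simp
  finally show ?thesis .
qed

subsection \<open>The STFT of square-integrable functions\<close>

lemma integrable_inverse_wt_power:
  assumes "2 * DIM('b::euclidean_space) \<le> N"
  shows "integrable lborel (\<lambda>y::'b. 1 / wt (y - x) ^ N)"
proof -
  have m: "(\<lambda>y::'b. 1 / wt y ^ N) \<in> borel_measurable borel" by measurable
  have "(1 / wt y ^ N) = wt y powr (- real N)" for y :: 'b
    by (simp add: powr_minus powr_realpow divide_inverse)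
  then have "(\<integral>\<^sup>+y. ennreal (norm (1 / wt (y::'b) ^ N)) \<partial>lborel) < \<infinity>"
    using nn_integral_wt_powr_finite[where 'b='b, of "real N"] assms by simp
  then have "integrable lborel (\<lambda>y::'b. 1 / wt y ^ N)"
    using m by (intro integrableI_bounded) auto
  then show ?thesis using lborel_translate(1)[OF m, of "- x"] by simp
qed

text \<open>Borel functions compose measurably with the continuous maps occurring in parametrised
  integrals such as (x, y) \<mapsto> y - x, whereas Lebesgue measurable ones need not. The analysis
  is done for such representatives and transferred to \<open>L2\<close> at the end.\<close>

definition L2_borel :: "('b::euclidean_space \<Rightarrow> complex) \<Rightarrow> bool" where
  "L2_borel f \<longleftrightarrow> f \<in> borel_measurable borel \<and> integrable lborel (\<lambda>y. (norm (f y))\<^sup>2)"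

text \<open>Rests on |f g| \<le> |f|^2 + |g|^2. Decay of order \<open>DIM\<close> becomes the
  integrable order 2 \<open>DIM\<close> after squaring, and by translation invariance the bound does
  not depend on the centre \<open>x\<close>; this uniformity is what makes STFTs bounded.\<close>

lemma L2_borel_mult:
  fixes f g :: "'b::euclidean_space \<Rightarrow> complex"
  assumes f: "L2_borel f" and g: "g \<in> borel_measurable borel"
    and b: "\<And>y. norm (g y) \<le> C / wt (y - x) ^ DIM('b)"
  shows "integrable lborel (\<lambda>y. f y * g y)"
    and "norm (LINT y|lborel. f y * g y) \<le>
      (LINT y|lborel. (norm (f y))\<^sup>2) + C\<^sup>2 * (LINT y|lborel. 1 / wt (y :: 'b) ^ (2 * DIM('b)))"
proof -
  let ?D = "\<lambda>y. (norm (f y))\<^sup>2 + C\<^sup>2 * (1 / wt (y - x) ^ (2 * DIM('b)))"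
  have iw: "integrable lborel (\<lambda>y::'b. 1 / wt (y - x) ^ (2 * DIM('b)))" by (rule integrable_inverse_wt_power) simp
  have D: "integrable lborel ?D"
    using f iw unfolding L2_borel_def by (intro Bochner_Integration.integrable_add integrable_mult_right) auto
  have le: "norm (f y * g y) \<le> ?D y" for y
  proof -
    have "norm (f y * g y) \<le> (norm (f y))\<^sup>2 + (norm (g y))\<^sup>2"
    proof -
      have "0 \<le> (norm (f y) - norm (g y))\<^sup>2 + (norm (f y))\<^sup>2 + (norm (g y))\<^sup>2" by simp
      then show ?thesis by (simp add: norm_mult power2_diff)
    qed
    also have "(norm (g y))\<^sup>2 \<le> (C / wt (y - x) ^ DIM('b))\<^sup>2" by (intro power_mono b) auto
    also have "\<dots> = C\<^sup>2 * (1 / wt (y - x) ^ (2 * DIM('b)))" by (simp add: power_divide power_mult[symmetric] mult.commute)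
    finally show ?thesis by simp
  qed
  show i: "integrable lborel (\<lambda>y. f y * g y)"
  proof (rule Bochner_Integration.integrable_bound[OF D])
    have "(\<lambda>y. f y * g y) \<in> borel_measurable borel"
      using f g unfolding L2_borel_def by (intro borel_measurable_times) auto
    then show "(\<lambda>y. f y * g y) \<in> borel_measurable lborel" by simp
    show "AE y in lborel. norm (f y * g y) \<le> norm (?D y)" using le by (intro AE_I2) (simp add: order_trans[OF _ abs_ge_self])
  qed
  have "norm (LINT y|lborel. f y * g y) \<le> (LINT y|lborel. norm (f y * g y))" by (rule integral_norm_bound)
  also have "\<dots> \<le> (LINT y|lborel. ?D y)" by (intro integral_mono integrable_norm i D le)
  also have "\<dots> = (LINT y|lborel. (norm (f y))\<^sup>2) + C\<^sup>2 * (LINT y|lborel. 1 / wt (y - x) ^ (2 * DIM('b)))"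
  proof (subst Bochner_Integration.integral_add)
    show "integrable lborel (\<lambda>y. (norm (f y))\<^sup>2)" using f by (simp add: L2_borel_def)
    show "integrable lborel (\<lambda>y. C\<^sup>2 * (1 / wt (y - x) ^ (2 * DIM('b))))" using iw by (rule integrable_mult_right)
  qed (simp only: integral_mult_right_zero)
  also have "(LINT y|lborel. 1 / wt (y - x) ^ (2 * DIM('b))) = (LINT y|lborel. 1 / wt (y :: 'b) ^ (2 * DIM('b)))"
    using lborel_translate(2)[of "\<lambda>y::'b. 1 / wt y ^ (2 * DIM('b))" "- x"] by simp
  finally show "norm (LINT y|lborel. f y * g y) \<le>
      (LINT y|lborel. (norm (f y))\<^sup>2) + C\<^sup>2 * (LINT y|lborel. 1 / wt (y :: 'b) ^ (2 * DIM('b)))" .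
qed

definition st :: "('b::euclidean_space \<Rightarrow> complex) \<Rightarrow> ('b \<Rightarrow> complex) \<Rightarrow> 'b \<times> 'b \<Rightarrow> complex" where
  "st f \<psi> z = (LINT y|lborel. f y * (cnj (\<psi> (y - fst z)) * cis (- 2 * pi * (y \<bullet> snd z))))"

lemma borel_measurable_shift:
  fixes f :: "'b::euclidean_space \<Rightarrow> complex"
  assumes "f \<in> borel_measurable borel"
  shows "(\<lambda>y. f (y - x)) \<in> borel_measurable borel"
  by (rule borel_measurable_continuous_comp[OF assms]) (intro continuous_intros)

lemma borel_measurable_char: "(\<lambda>y. cis (c * (y \<bullet> \<xi>))) \<in> borel_measurable borel"
  by (intro borel_measurable_continuous_onI continuous_intros)

lemma borel_measurable_cnj: "f \<in> borel_measurable M \<Longrightarrow> (\<lambda>x. cnj (f x)) \<in> borel_measurable M"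
  by (rule measurable_compose[of f _ borel]) (auto intro: borel_measurable_continuous_onI continuous_intros)

lemma borel_measurable_window:
  fixes \<psi> :: "'b::euclidean_space \<Rightarrow> complex"
  shows "\<psi> \<in> borel_measurable borel \<Longrightarrow> (\<lambda>y. cnj (\<psi> (y - x)) * cis (- 2 * pi * (y \<bullet> \<xi>))) \<in> borel_measurable borel"
  by (intro borel_measurable_times borel_measurable_cnj borel_measurable_shift borel_measurable_char)

lemma st_integrable:
  assumes "L2_borel f" "schwartz \<psi>"
  shows "integrable lborel (\<lambda>y. f y * (cnj (\<psi> (y - x)) * cis (- 2 * pi * (y \<bullet> \<xi>))))"
proof -
  obtain C where "\<And>x. norm (\<psi> x) \<le> C / wt x ^ DIM('a)" using schwartz_decay[OF assms(2), of "DIM('a)"] by blast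
  then show ?thesis
    by (intro L2_borel_mult(1)[OF assms(1)] borel_measurable_window schwartz_borel assms) (auto simp: norm_mult)
qed

lemma st_bounded:
  assumes "L2_borel f" "schwartz \<psi>"
  obtains A where "0 \<le> A" "\<And>z. norm (st f \<psi> z) \<le> A"
proof -
  obtain C where C: "\<And>x. norm (\<psi> x) \<le> C / wt x ^ DIM('a)" using schwartz_decay[OF assms(2), of "DIM('a)"] by blast
  have b: "norm (st f \<psi> z) \<le> (LINT y|lborel. (norm (f y))\<^sup>2) + C\<^sup>2 * (LINT y|lborel. 1 / wt (y :: 'a) ^ (2 * DIM('a)))" for z
    unfolding st_def using C
    by (intro L2_borel_mult(2)[OF assms(1)] borel_measurable_window schwartz_borel assms) (auto simp: norm_mult)
  have "0 \<le> (LINT y|lborel. (norm (f y))\<^sup>2) + C\<^sup>2 * (LINT y|lborel. 1 / wt (y :: 'a) ^ (2 * DIM('a)))"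
    using order_trans[OF norm_ge_zero b[of 0]] .
  then show ?thesis using b by (rule that)
qed

lemma st_borel:
  assumes f: "f \<in> borel_measurable borel" and g: "\<psi> \<in> borel_measurable borel"
  shows "st f \<psi> \<in> borel_measurable borel"
proof -
  have "(\<lambda>p :: ('a \<times> 'a) \<times> 'a. f (snd p) * (cnj (\<psi> (snd p - fst (fst p))) * cis (- 2 * pi * (snd p \<bullet> snd (fst p))))) \<in> borel_measurable borel"
  proof (intro borel_measurable_times borel_measurable_cnj)
    show "(\<lambda>p :: ('a \<times> 'a) \<times> 'a. f (snd p)) \<in> borel_measurable borel"
      by (rule borel_measurable_continuous_comp[OF f]) (intro continuous_intros)
    show "(\<lambda>p :: ('a \<times> 'a) \<times> 'a. \<psi> (snd p - fst (fst p))) \<in> borel_measurable borel"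
      by (rule borel_measurable_continuous_comp[OF g]) (intro continuous_intros)
    show "(\<lambda>p :: ('a \<times> 'a) \<times> 'a. cis (- 2 * pi * (snd p \<bullet> snd (fst p)))) \<in> borel_measurable borel"
      by (intro borel_measurable_continuous_onI continuous_intros)
  qed
  then have "(\<lambda>z. LINT y|lborel. f y * (cnj (\<psi> (y - fst z)) * cis (- 2 * pi * (y \<bullet> snd z)))) \<in> borel_measurable lborel"
    by (intro lborel.borel_measurable_lebesgue_integral) (simp add: split_beta lborel_prod)
  then show ?thesis unfolding st_def[abs_def] by simp
qed

lemma st_cmult: "st f (\<lambda>y. c * \<psi> y) z = cnj c * st f \<psi> z"
  unfolding st_def by (subst integral_mult_right_zero[symmetric]) (simp add: algebra_simps)

section \<open>Derivatives of the STFT\<close>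

lemma L2_borel_norm_mult_integrable:
  fixes f :: "'b::euclidean_space \<Rightarrow> complex"
  assumes "L2_borel f"
  shows "integrable lborel (\<lambda>y. norm (f y) * (C / wt (y - x) ^ DIM('b)))"
proof -
  have "(\<lambda>y::'b. complex_of_real (1 / wt (y - x) ^ DIM('b))) \<in> borel_measurable borel"
    by (intro borel_measurable_continuous_onI continuous_intros) auto
  then have "integrable lborel (\<lambda>y. f y * complex_of_real (1 / wt (y - x) ^ DIM('b)))"
    by (intro L2_borel_mult(1)[OF assms, of _ 1 x]) (auto simp: norm_divide norm_power)
  then have "integrable lborel (\<lambda>y. C * norm (f y * complex_of_real (1 / wt (y - x) ^ DIM('b))))"
    by (intro integrable_mult_right integrable_norm) auto
  then show ?thesis by (simp add: norm_mult norm_divide norm_power field_simps)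
qed

text \<open>The position enters only through the window at y - x, so the derivative falls on the
  window and brings the factor -1, with no regularity of \<open>f\<close> involved.\<close>

lemma st_has_dir_deriv_fst:
  fixes f :: "'b::euclidean_space \<Rightarrow> complex"
  assumes f: "L2_borel f" and p: "schwartz \<psi>" and b: "b \<in> Basis"
  shows "has_dir_deriv (st f \<psi>) (b, 0) (st f (\<lambda>y. (- 1) * frechet_derivative \<psi> (at y) b))"
  unfolding has_dir_deriv_def
proof
  fix z :: "'b \<times> 'b"
  obtain x \<xi> where z: "z = (x, \<xi>)" by (cases z)
  define \<psi>' where "\<psi>' = (\<lambda>y. (- 1) * frechet_derivative \<psi> (at y) b)"
  have sp': "schwartz \<psi>'" unfolding \<psi>'_def by (intro schwartz_cmult schwartz_dderiv p b)
  define K where "K = (\<lambda>t y. f y * (cnj (\<psi> (y - (x + t *\<^sub>R b))) * cis (- 2 * pi * (y \<bullet> \<xi>))))"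
  define K' where "K' = (\<lambda>t y. f y * (cnj (\<psi>' (y - (x + t *\<^sub>R b))) * cis (- 2 * pi * (y \<bullet> \<xi>))))"
  let ?d = "DIM('b)"
  obtain C where C: "0 \<le> C" "\<And>x. norm (\<psi>' x) \<le> C / wt x ^ ?d" using schwartz_decay[OF sp', of ?d] by blast
  have "((\<lambda>t. LINT y|lborel. K t y) has_vector_derivative (LINT y|lborel. K' 0 y)) (at 0)"
  proof (rule integral_has_vector_derivative_0)
    show "integrable lborel (K t)" for t unfolding K_def by (rule st_integrable[OF f p])
    show "((\<lambda>t. K t y) has_vector_derivative K' t y) (at t)" for t y
    proof -
      have "((\<lambda>t. \<psi> ((y - x) + t *\<^sub>R (- b))) has_vector_derivative
          frechet_derivative \<psi> (at ((y - x) + t *\<^sub>R (- b))) (- b)) (at t)"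
        by (rule has_dir_deriv_at[OF has_dir_deriv_schwartz[OF p]])
      moreover have "frechet_derivative \<psi> (at u) (- b) = - frechet_derivative \<psi> (at u) b" for u
        by (rule linear_neg[OF linear_frechet_derivative[OF schwartz_differentiable[OF p]]])
      ultimately have "((\<lambda>t. \<psi> (y - (x + t *\<^sub>R b))) has_vector_derivative \<psi>' (y - (x + t *\<^sub>R b))) (at t)"
        unfolding \<psi>'_def by (simp add: algebra_simps)
      then have "((\<lambda>t. cnj (\<psi> (y - (x + t *\<^sub>R b)))) has_vector_derivative cnj (\<psi>' (y - (x + t *\<^sub>R b)))) (at t)"
        by (rule has_vector_derivative_cnj)
      then show ?thesis unfolding K_def K'_def
        by (intro has_vector_derivative_mult_right has_vector_derivative_mult_left)
    qed
    \<comment> \<open>A single majorant for all |t| < 1 is required: moving the centre by less than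
      1 changes the weight by a factor at most 2, whence 2 ^ \<open>DIM\<close>.\<close>
    show "norm (K' t y) \<le> norm (f y) * (C * 2 ^ ?d / wt (y - x) ^ ?d)" if t: "\<bar>t\<bar> < 1" for t y
    proof -
      have "wt (t *\<^sub>R b) \<le> 2" using t b by (simp add: wt_def)
      then have "wt (y - (x + t *\<^sub>R b)) * wt (t *\<^sub>R b) \<le> wt (y - (x + t *\<^sub>R b)) * 2"
        by (rule mult_left_mono) simp
      moreover have "wt (y - x) \<le> wt (y - (x + t *\<^sub>R b)) * wt (t *\<^sub>R b)"
        using wt_add_le[of "y - (x + t *\<^sub>R b)" "t *\<^sub>R b"] by (simp add: diff_diff_eq[symmetric])
      ultimately have "wt (y - x) \<le> wt (y - (x + t *\<^sub>R b)) * 2" by linarith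
      then have "wt (y - x) ^ ?d \<le> (wt (y - (x + t *\<^sub>R b)) * 2) ^ ?d" by (intro power_mono) auto
      then have w: "wt (y - x) ^ ?d \<le> 2 ^ ?d * wt (y - (x + t *\<^sub>R b)) ^ ?d" by (simp add: power_mult_distrib mult.commute)
      have "norm (\<psi>' (y - (x + t *\<^sub>R b))) \<le> C / wt (y - (x + t *\<^sub>R b)) ^ ?d" by (rule C)
      also have "\<dots> \<le> C * 2 ^ ?d / wt (y - x) ^ ?d"
      proof -
        have "C / A \<le> C * k / B" if "0 < A" "0 < B" "B \<le> k * A" for A B k :: real
          using mult_left_mono[OF that(3) C(1)] that by (simp add: field_simps)
        from this[OF _ _ w] show ?thesis by simp
      qed
      finally have "norm (f y) * norm (\<psi>' (y - (x + t *\<^sub>R b))) \<le> norm (f y) * (C * 2 ^ ?d / wt (y - x) ^ ?d)"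
        by (rule mult_left_mono) simp
      then show ?thesis unfolding K'_def by (simp add: norm_mult)
    qed
    show "integrable lborel (\<lambda>y. norm (f y) * (C * 2 ^ ?d / wt (y - x) ^ ?d))"
      by (rule L2_borel_norm_mult_integrable[OF f])
    show "K' 0 \<in> borel_measurable lborel"
      unfolding K'_def using st_integrable[OF f sp'] by (rule borel_measurable_integrable)
  qed
  then show "((\<lambda>t. st f \<psi> (z + t *\<^sub>R (b, 0))) has_vector_derivative st f \<psi>' z) (at 0)"
    unfolding st_def K_def K'_def z by simp
qed

text \<open>Differentiating the character brings down y \<bullet> b. This splits into (y - x)
  \<bullet> b, which is absorbed into the window, and x \<bullet> b, which stays in front as a
  factor.\<close>

lemma st_has_dir_deriv_snd:
  fixes f :: "'b::euclidean_space \<Rightarrow> complex"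
  assumes f: "L2_borel f" and p: "schwartz \<psi>" and b: "b \<in> Basis"
  shows "has_dir_deriv (st f \<psi>) (0, b)
    (\<lambda>z. - (2 * of_real pi * \<i>) * (st f (\<lambda>y. complex_of_real (y \<bullet> b) * \<psi> y) z + of_real (fst z \<bullet> b) * st f \<psi> z))"
  unfolding has_dir_deriv_def
proof
  fix z :: "'b \<times> 'b"
  obtain x \<xi> where z: "z = (x, \<xi>)" by (cases z)
  define \<psi>' where "\<psi>' = (\<lambda>y. complex_of_real (y \<bullet> b) * \<psi> y)"
  have sp': "schwartz \<psi>'" unfolding \<psi>'_def by (intro schwartz_mult_coord p)
  define K where "K = (\<lambda>t y. f y * (cnj (\<psi> (y - x)) * cis (- 2 * pi * (y \<bullet> (\<xi> + t *\<^sub>R b)))))"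
  define K' where "K' = (\<lambda>t y. f y * (cnj (\<psi> (y - x)) * (\<i> * of_real (- 2 * pi * (y \<bullet> b)) * cis (- 2 * pi * (y \<bullet> (\<xi> + t *\<^sub>R b))))))"
  let ?d = "DIM('b)"
  \<comment> \<open>One order of decay beyond \<open>DIM\<close> pays for the coordinate, since |y
    \<bullet> b| \<le> \<open>wt x * wt (y - x)\<close>.\<close>
  obtain C where C: "0 \<le> C" "\<And>x. norm (\<psi> x) \<le> C / wt x ^ Suc ?d" using schwartz_decay[OF p, of "Suc ?d"] by blast
  have K'0: "K' 0 = (\<lambda>y. - (2 * of_real pi * \<i>) * (f y * (cnj (\<psi>' (y - x)) * cis (- 2 * pi * (y \<bullet> \<xi>)))
        + of_real (x \<bullet> b) * (f y * (cnj (\<psi> (y - x)) * cis (- 2 * pi * (y \<bullet> \<xi>))))))"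
    unfolding K'_def \<psi>'_def by (intro ext) (simp add: inner_diff_left algebra_simps)
  have i1: "integrable lborel (\<lambda>y. f y * (cnj (\<psi>' (y - x)) * cis (- 2 * pi * (y \<bullet> \<xi>))))"
    and i2: "integrable lborel (\<lambda>y. of_real (x \<bullet> b) * (f y * (cnj (\<psi> (y - x)) * cis (- 2 * pi * (y \<bullet> \<xi>)))))"
    by (intro integrable_mult_right st_integrable f p sp')+
  have "((\<lambda>t. LINT y|lborel. K t y) has_vector_derivative (LINT y|lborel. K' 0 y)) (at 0)"
  proof (rule integral_has_vector_derivative_0)
    show "integrable lborel (K t)" for t unfolding K_def by (rule st_integrable[OF f p])
    show "((\<lambda>t. K t y) has_vector_derivative K' t y) (at t)" for t y
    proof -
      have "((\<lambda>t. cis (- 2 * pi * (y \<bullet> \<xi>) + (- 2 * pi * (y \<bullet> b)) * t)) has_vector_derivative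
          \<i> * of_real (- 2 * pi * (y \<bullet> b)) * cis (- 2 * pi * (y \<bullet> \<xi>) + (- 2 * pi * (y \<bullet> b)) * t)) (at t)"
        by (rule has_vector_derivative_cis_linear)
      moreover have "- 2 * pi * (y \<bullet> \<xi>) + (- 2 * pi * (y \<bullet> b)) * t = - 2 * pi * (y \<bullet> (\<xi> + t *\<^sub>R b))" for t
        by (simp add: inner_add_right algebra_simps)
      ultimately have "((\<lambda>t. cis (- 2 * pi * (y \<bullet> (\<xi> + t *\<^sub>R b)))) has_vector_derivative
          \<i> * of_real (- 2 * pi * (y \<bullet> b)) * cis (- 2 * pi * (y \<bullet> (\<xi> + t *\<^sub>R b)))) (at t)"
        by simp
      then show ?thesis unfolding K_def K'_def
        by (intro has_vector_derivative_mult_right)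
    qed
    show "norm (K' t y) \<le> norm (f y) * (C * (2 * pi * wt x) / wt (y - x) ^ ?d)" for t y
    proof -
      have "\<bar>y \<bullet> b\<bar> \<le> wt x * wt (y - x)"
        using abs_inner_Basis_le_wt[OF b, of y] wt_le_mult_diff[of y x] by linarith
      then have "norm (\<psi> (y - x)) * (2 * pi * \<bar>y \<bullet> b\<bar>) \<le> (C / wt (y - x) ^ Suc ?d) * (2 * pi * (wt x * wt (y - x)))"
        by (intro mult_mono C) (auto intro!: divide_nonneg_nonneg C)
      also have "\<dots> = C * (2 * pi * wt x) / wt (y - x) ^ ?d" by (simp add: field_simps)
      finally have "norm (f y) * (norm (\<psi> (y - x)) * (2 * pi * \<bar>y \<bullet> b\<bar>)) \<le> norm (f y) * (C * (2 * pi * wt x) / wt (y - x) ^ ?d)"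
        by (rule mult_left_mono) simp
      then show ?thesis unfolding K'_def by (simp add: norm_mult abs_mult)
    qed
    show "integrable lborel (\<lambda>y. norm (f y) * (C * (2 * pi * wt x) / wt (y - x) ^ ?d))"
      by (rule L2_borel_norm_mult_integrable[OF f])
    show "K' 0 \<in> borel_measurable lborel"
      unfolding K'0 by (intro borel_measurable_integrable integrable_mult_right Bochner_Integration.integrable_add i1 i2)
  qed
  moreover have "(LINT y|lborel. K' 0 y) = - (2 * of_real pi * \<i>) * (st f \<psi>' z + of_real (fst z \<bullet> b) * st f \<psi> z)"
    unfolding K'0 st_def z using i1 i2 by (simp add: Bochner_Integration.integral_add)
  ultimately show "((\<lambda>t. st f \<psi> (z + t *\<^sub>R (0, b))) has_vector_derivative
      - (2 * of_real pi * \<i>) * (st f \<psi>' z + of_real (fst z \<bullet> b) * st f \<psi> z)) (at 0)"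
    unfolding K_def st_def[of f \<psi> "z + _"] unfolding z by simp
qed

text \<open>In the frequency direction the two derivatives separately produce factors that are not
  translation invariant; these cancel in the product.\<close>

lemma st_product_has_dir_deriv:
  fixes \<psi> \<phi> :: "'b::euclidean_space \<Rightarrow> complex" and v :: "'b \<times> 'b"
  assumes p: "schwartz \<psi>" and q: "schwartz \<phi>" and v: "v \<in> Basis"
  obtains \<psi>' \<phi>' where "schwartz \<psi>'" "schwartz \<phi>'"
    "\<And>f h. L2_borel f \<Longrightarrow> L2_borel h \<Longrightarrow> has_dir_deriv (\<lambda>z. cnj (st f \<psi> z) * st h \<phi> z) v
       (\<lambda>z. cnj (st f \<psi>' z) * st h \<phi> z + cnj (st f \<psi> z) * st h \<phi>' z)"
proof -
  from v consider b where "b \<in> Basis" "v = (b, 0)" | b where "b \<in> Basis" "v = (0, b)"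
    unfolding Basis_prod_def by blast
  then show ?thesis
  proof cases
    case 1
    let ?D = "\<lambda>\<psi> y. (- 1) * frechet_derivative \<psi> (at y) b"
    show ?thesis
    proof (rule that[of "?D \<psi>" "?D \<phi>"])
      show "schwartz (?D \<psi>)" "schwartz (?D \<phi>)" by (intro schwartz_cmult schwartz_dderiv p q 1)+
      fix f h :: "'b \<Rightarrow> complex" assume fh: "L2_borel f" "L2_borel h"
      show "has_dir_deriv (\<lambda>z. cnj (st f \<psi> z) * st h \<phi> z) v
         (\<lambda>z. cnj (st f (?D \<psi>) z) * st h \<phi> z + cnj (st f \<psi> z) * st h (?D \<phi>) z)"
        using has_dir_deriv_mult[OF has_dir_deriv_cnj[OF st_has_dir_deriv_fst[OF fh(1) p 1(1)]] st_has_dir_deriv_fst[OF fh(2) q 1(1)]]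
        unfolding 1(2) by (simp add: add.commute)
    qed
  next
    case 2
    \<comment> \<open>As \<open>st\<close> is conjugate linear in the window, the constant
      2\<pi>\<i> acts as -2\<pi>\<i> in the second factor and as 2\<pi>\<i> in the conjugated first
      one. The two x \<bullet> b terms carry these opposite signs and cancel.\<close>
    let ?D = "\<lambda>\<psi> y. (2 * of_real pi * \<i>) * (complex_of_real (y \<bullet> b) * \<psi> y)"
    show ?thesis
    proof (rule that[of "?D \<psi>" "?D \<phi>"])
      show "schwartz (?D \<psi>)" "schwartz (?D \<phi>)" by (intro schwartz_cmult schwartz_mult_coord p q)+
      fix f h :: "'b \<Rightarrow> complex" assume fh: "L2_borel f" "L2_borel h"
      show "has_dir_deriv (\<lambda>z. cnj (st f \<psi> z) * st h \<phi> z) v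
         (\<lambda>z. cnj (st f (?D \<psi>) z) * st h \<phi> z + cnj (st f \<psi> z) * st h (?D \<phi>) z)"
        using has_dir_deriv_mult[OF has_dir_deriv_cnj[OF st_has_dir_deriv_snd[OF fh(1) p 2(1)]] st_has_dir_deriv_snd[OF fh(2) q 2(1)]]
        unfolding 2(2) st_cmult by (simp add: algebra_simps)
    qed
  qed
qed

text \<open>The weight is at most 1 + \<open>DIM\<close> times the larger of 1 and the largest
  coordinate modulus. This maximum is attained, so one of the assumed bounds applies directly to its
  power.\<close>

lemma wt_power_mult_le:
  fixes x :: "'b::euclidean_space"
  assumes r: "0 \<le> r" "r \<le> B" and b: "\<And>v. v \<in> Basis \<Longrightarrow> \<bar>v \<bullet> x\<bar> ^ M * r \<le> B"
  shows "wt x ^ M * r \<le> (1 + real DIM('b)) ^ M * B"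
proof -
  define m where "m = Max (insert 1 ((\<lambda>v. \<bar>v \<bullet> x\<bar>) ` Basis))"
  have m_in: "m \<in> insert 1 ((\<lambda>v. \<bar>v \<bullet> x\<bar>) ` Basis)" unfolding m_def by (rule Max_in) auto
  have m1: "1 \<le> m" unfolding m_def by (rule Max_ge) auto
  have mv: "\<bar>v \<bullet> x\<bar> \<le> m" if "v \<in> Basis" for v unfolding m_def using that by (intro Max_ge) auto
  have "norm x \<le> (\<Sum>v\<in>Basis. \<bar>x \<bullet> v\<bar>)" by (rule norm_le_l1)
  also have "\<dots> \<le> (\<Sum>v\<in>(Basis::'b set). m)" using mv by (intro sum_mono) (simp add: inner_commute)
  finally have "wt x \<le> (1 + real DIM('b)) * m" using m1 unfolding wt_def by (simp add: algebra_simps)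
  then have "wt x ^ M \<le> ((1 + real DIM('b)) * m) ^ M" by (intro power_mono) auto
  then have "wt x ^ M * r \<le> ((1 + real DIM('b)) * m) ^ M * r" by (rule mult_right_mono[OF _ r(1)])
  also have "\<dots> = (1 + real DIM('b)) ^ M * (m ^ M * r)" by (simp add: power_mult_distrib)
  also have "m ^ M * r \<le> B" using m_in r b by auto
  finally show ?thesis by (simp add: mult_left_mono)
qed

text \<open>Rapid decay in the frequency variable from an abstract integration by parts rule.\<close>

lemma frequency_decay:
  fixes J :: "('i \<Rightarrow> 'b::euclidean_space \<Rightarrow> complex) set" and \<beta> :: "'i \<Rightarrow> real"
  assumes \<beta>: "\<And>i. 0 \<le> \<beta> i"
    and base: "\<And>j. j \<in> J \<Longrightarrow> \<exists>C. \<forall>i \<Omega>. norm (j i \<Omega>) \<le> C * \<beta> i"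
    and step: "\<And>j v. j \<in> J \<Longrightarrow> v \<in> Basis \<Longrightarrow> \<exists>j1\<in>J. \<exists>j2\<in>J. \<exists>j3\<in>J.
       \<forall>i \<Omega>. \<bar>v \<bullet> \<Omega>\<bar> * norm (j i \<Omega>) \<le> norm (j1 i \<Omega>) + norm (j2 i \<Omega>) + norm (j3 i \<Omega>)"
    and j: "j \<in> J"
  obtains C where "0 \<le> C" "\<And>i \<Omega>. wt \<Omega> ^ M * norm (j i \<Omega>) \<le> C * \<beta> i"
proof -
  have coord: "\<exists>C. \<forall>i \<Omega>. \<bar>v \<bullet> \<Omega>\<bar> ^ M * norm (j i \<Omega>) \<le> C * \<beta> i" if v: "v \<in> Basis" and "j \<in> J" for v j M
    using that(2)
  proof (induction M arbitrary: j)
    case 0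
    then show ?case using base by simp
  next
    case (Suc M)
    obtain j1 j2 j3 where J: "j1 \<in> J" "j2 \<in> J" "j3 \<in> J"
      and le: "\<forall>i \<Omega>. \<bar>v \<bullet> \<Omega>\<bar> * norm (j i \<Omega>) \<le> norm (j1 i \<Omega>) + norm (j2 i \<Omega>) + norm (j3 i \<Omega>)"
      using step[OF Suc.prems v] by blast
    obtain C1 where C1: "\<forall>i \<Omega>. \<bar>v \<bullet> \<Omega>\<bar> ^ M * norm (j1 i \<Omega>) \<le> C1 * \<beta> i" using Suc.IH[OF J(1)] by blast
    obtain C2 where C2: "\<forall>i \<Omega>. \<bar>v \<bullet> \<Omega>\<bar> ^ M * norm (j2 i \<Omega>) \<le> C2 * \<beta> i" using Suc.IH[OF J(2)] by blast
    obtain C3 where C3: "\<forall>i \<Omega>. \<bar>v \<bullet> \<Omega>\<bar> ^ M * norm (j3 i \<Omega>) \<le> C3 * \<beta> i" using Suc.IH[OF J(3)] by blast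
    have "\<bar>v \<bullet> \<Omega>\<bar> ^ Suc M * norm (j i \<Omega>) \<le> (C1 + C2 + C3) * \<beta> i" for i \<Omega>
    proof -
      have "\<bar>v \<bullet> \<Omega>\<bar> ^ Suc M * norm (j i \<Omega>) = \<bar>v \<bullet> \<Omega>\<bar> ^ M * (\<bar>v \<bullet> \<Omega>\<bar> * norm (j i \<Omega>))" by simp
      also have "\<dots> \<le> \<bar>v \<bullet> \<Omega>\<bar> ^ M * (norm (j1 i \<Omega>) + norm (j2 i \<Omega>) + norm (j3 i \<Omega>))"
        using le by (intro mult_left_mono) auto
      also have "\<dots> \<le> C1 * \<beta> i + C2 * \<beta> i + C3 * \<beta> i"
        unfolding distrib_left using C1 C2 C3 by (intro add_mono) auto
      finally show ?thesis by (simp add: algebra_simps)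
    qed
    then show ?case by blast
  qed
  then have "\<forall>v\<in>Basis. \<exists>C. \<forall>i \<Omega>. \<bar>v \<bullet> \<Omega>\<bar> ^ M * norm (j i \<Omega>) \<le> C * \<beta> i" using j by blast
  from bchoice[OF this] obtain c where
    c: "\<forall>v\<in>Basis. \<forall>i \<Omega>. \<bar>v \<bullet> \<Omega>\<bar> ^ M * norm (j i \<Omega>) \<le> c v * \<beta> i" by blast
  obtain C0 where C0: "\<forall>i \<Omega>. norm (j i \<Omega>) \<le> C0 * \<beta> i" using base[OF j] by blast
  define B where "B = \<bar>C0\<bar> + (\<Sum>v\<in>(Basis::'b set). \<bar>c v\<bar>)"
  have B0: "\<bar>C0\<bar> \<le> B" unfolding B_def by (simp add: sum_nonneg)
  have Bv: "\<bar>c v\<bar> \<le> B" if "v \<in> Basis" for v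
    unfolding B_def using that member_le_sum[of v Basis "\<lambda>v. \<bar>c v\<bar>"] by (simp add: add_increasing)
  have "wt \<Omega> ^ M * norm (j i \<Omega>) \<le> (1 + real DIM('b)) ^ M * (B * \<beta> i)" for i \<Omega>
  proof (rule wt_power_mult_le)
    have "C0 * \<beta> i \<le> B * \<beta> i" using B0 \<beta> by (intro mult_right_mono) auto
    then show "norm (j i \<Omega>) \<le> B * \<beta> i" using C0 order_trans by blast
    fix v :: 'b assume v: "v \<in> Basis"
    have "c v * \<beta> i \<le> B * \<beta> i" using Bv[OF v] \<beta> by (intro mult_right_mono) auto
    then show "\<bar>v \<bullet> \<Omega>\<bar> ^ M * norm (j i \<Omega>) \<le> B * \<beta> i" using c v order_trans by blast
  qed simp
  moreover have "0 \<le> (1 + real DIM('b)) ^ M * B" using B0 by auto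
  ultimately show ?thesis by (intro that[of "(1 + real DIM('b)) ^ M * B"]) (auto simp: mult.assoc)
qed

section \<open>Rapid decay of the STFT of a Schwartz function\<close>

lemma L2_borel_schwartz:
  fixes f :: "'b::euclidean_space \<Rightarrow> complex"
  assumes "schwartz f"
  shows "L2_borel f"
  unfolding L2_borel_def
proof
  show m: "f \<in> borel_measurable borel" by (rule schwartz_borel[OF assms])
  obtain C where C: "\<And>x. norm (f x) \<le> C / wt x ^ DIM('b)" using schwartz_decay[OF assms, of "DIM('b)"] by blast
  have i: "integrable lborel (\<lambda>y::'b. C\<^sup>2 * (1 / wt (y - 0) ^ (2 * DIM('b))))"
    by (intro integrable_mult_right integrable_inverse_wt_power) simp
  show "integrable lborel (\<lambda>y. (norm (f y))\<^sup>2)"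
  proof (rule Bochner_Integration.integrable_bound[OF i])
    show "(\<lambda>y. (norm (f y))\<^sup>2) \<in> borel_measurable lborel" using m by simp
    show "AE y in lborel. norm ((norm (f y))\<^sup>2) \<le> norm (C\<^sup>2 * (1 / wt (y - 0) ^ (2 * DIM('b))))"
    proof (rule AE_I2)
      fix y :: 'b
      have "(norm (f y))\<^sup>2 \<le> (C / wt y ^ DIM('b))\<^sup>2" by (intro power_mono C) auto
      also have "\<dots> = C\<^sup>2 * (1 / wt (y - 0) ^ (2 * DIM('b)))"
        by (simp add: power_divide power_mult[symmetric] mult.commute)
      finally show "norm ((norm (f y))\<^sup>2) \<le> norm (C\<^sup>2 * (1 / wt (y - 0) ^ (2 * DIM('b))))" by simp
    qed
  qed
qed

text \<open>The integral of the derivative of the integrand along \<open>b\<close> vanishes. The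
  character contributes 2\<pi>\<i> (b \<bullet> \<xi>) times the STFT, the other factors the two
  terms on the right; 2\<pi> \<ge> 1 is then dropped.\<close>

lemma schwartz_product_st_step:
  fixes \<psi> \<phi> :: "'b::euclidean_space \<Rightarrow> complex"
  assumes p: "schwartz \<psi>" and q: "schwartz \<phi>" and b: "b \<in> Basis"
  shows "\<bar>b \<bullet> \<xi>\<bar> * norm (st \<psi> \<phi> (x, \<xi>)) \<le>
    norm (st (\<lambda>y. frechet_derivative \<psi> (at y) b) \<phi> (x, \<xi>)) + norm (st \<psi> (\<lambda>y. frechet_derivative \<phi> (at y) b) (x, \<xi>))"
proof -
  define \<psi>' where "\<psi>' = (\<lambda>y. frechet_derivative \<psi> (at y) b)"
  define \<phi>' where "\<phi>' = (\<lambda>y. frechet_derivative \<phi> (at y) b)"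
  have p': "schwartz \<psi>'" and q': "schwartz \<phi>'" unfolding \<psi>'_def \<phi>'_def by (intro schwartz_dderiv p q b)+
  define e where "e = (\<lambda>y::'b. cis (- 2 * pi * (y \<bullet> \<xi>)))"
  define c where "c = 2 * of_real pi * \<i> * complex_of_real (b \<bullet> \<xi>)"
  define U where "U = (\<lambda>y. \<psi> y * (cnj (\<phi> (y - x)) * e y))"
  define U1 where "U1 = (\<lambda>y. \<psi>' y * (cnj (\<phi> (y - x)) * e y))"
  define U2 where "U2 = (\<lambda>y. \<psi> y * (cnj (\<phi>' (y - x)) * e y))"
  have iU: "integrable lborel U" and iU1: "integrable lborel U1" and iU2: "integrable lborel U2"
    unfolding U_def U1_def U2_def e_def by (intro st_integrable L2_borel_schwartz p q p' q')+
  have he: "has_dir_deriv e b (\<lambda>y. - c * e y)" unfolding e_def c_def by (rule has_dir_deriv_char)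
  have "has_dir_deriv U b (\<lambda>y. \<psi> y * (cnj (\<phi> (y - x)) * (- c * e y) + cnj (\<phi>' (y - x)) * e y) + \<psi>' y * (cnj (\<phi> (y - x)) * e y))"
    unfolding U_def \<psi>'_def \<phi>'_def
    by (intro has_dir_deriv_mult has_dir_deriv_schwartz[OF p] has_dir_deriv_cnj has_dir_deriv_shift[OF has_dir_deriv_schwartz[OF q]] he)
  also have "(\<lambda>y. \<psi> y * (cnj (\<phi> (y - x)) * (- c * e y) + cnj (\<phi>' (y - x)) * e y) + \<psi>' y * (cnj (\<phi> (y - x)) * e y)) =
      (\<lambda>y. - c * U y + (U1 y + U2 y))"
    unfolding U_def U1_def U2_def by (simp add: fun_eq_iff algebra_simps)
  finally have d: "has_dir_deriv U b (\<lambda>y. - c * U y + (U1 y + U2 y))" .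
  have "(LINT y|lborel. - c * U y + (U1 y + U2 y)) = 0"
    by (rule has_dir_deriv_integral_eq_0[OF d iU]) (intro Bochner_Integration.integrable_add integrable_mult_right iU iU1 iU2)
  then have "c * (LINT y|lborel. U y) = (LINT y|lborel. U1 y) + (LINT y|lborel. U2 y)"
    using iU iU1 iU2 by (simp add: algebra_simps add_eq_0_iff2)
  then have "norm c * norm (st \<psi> \<phi> (x, \<xi>)) \<le> norm (st \<psi>' \<phi> (x, \<xi>)) + norm (st \<psi> \<phi>' (x, \<xi>))"
    unfolding st_def U_def U1_def U2_def e_def by (simp add: norm_mult[symmetric] norm_triangle_ineq)
  moreover have "\<bar>b \<bullet> \<xi>\<bar> \<le> norm c"
    unfolding c_def using pi_gt3 mult_right_mono[of 1 "2 * pi" "\<bar>b \<bullet> \<xi>\<bar>"] by (simp add: norm_mult)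
  from this have "\<bar>b \<bullet> \<xi>\<bar> * norm (st \<psi> \<phi> (x, \<xi>)) \<le> norm c * norm (st \<psi> \<phi> (x, \<xi>))" by (rule mult_right_mono) simp
  ultimately show ?thesis unfolding \<psi>'_def \<phi>'_def by (rule order_trans[rotated])
qed

text \<open>Decay in position, uniform in frequency. Peetre's inequality distributes the weight at
  \<open>x\<close> over the two functions; the surplus of 2 \<open>DIM\<close> orders in \<psi>
  makes the integral converge.\<close>

lemma st_schwartz_bound:
  fixes \<psi> \<phi> :: "'b::euclidean_space \<Rightarrow> complex"
  assumes p: "schwartz \<psi>" and q: "schwartz \<phi>"
  shows "\<exists>C. \<forall>x \<xi>. norm (st \<psi> \<phi> (x, \<xi>)) \<le> C * (1 / wt x ^ N)"
proof -
  let ?D = "2 * DIM('b)"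
  obtain C1 where C1: "0 \<le> C1" "\<And>y. norm (\<psi> y) \<le> C1 / wt y ^ (N + ?D)" using schwartz_decay[OF p, of "N + ?D"] by blast
  obtain C2 where C2: "0 \<le> C2" "\<And>y. norm (\<phi> y) \<le> C2 / wt y ^ N" using schwartz_decay[OF q, of N] by blast
  have iw: "integrable lborel (\<lambda>y::'b. 1 / wt (y - 0) ^ ?D)" by (rule integrable_inverse_wt_power) simp
  have "norm (st \<psi> \<phi> (x, \<xi>)) \<le> (C1 * C2 * (LINT y|lborel. 1 / wt (y - 0 :: 'b) ^ ?D)) * (1 / wt x ^ N)" for x \<xi>
  proof -
    let ?U = "\<lambda>y. \<psi> y * (cnj (\<phi> (y - x)) * cis (- 2 * pi * (y \<bullet> \<xi>)))"
    have "norm (st \<psi> \<phi> (x, \<xi>)) \<le> (LINT y|lborel. norm (?U y))" unfolding st_def fst_conv snd_conv by (rule integral_norm_bound)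
    also have "\<dots> \<le> (LINT y|lborel. (C1 * C2 * (1 / wt x ^ N)) * (1 / wt (y - 0 :: 'b) ^ ?D))"
    proof (rule integral_mono)
      show "integrable lborel (\<lambda>y. norm (?U y))" by (intro integrable_norm st_integrable L2_borel_schwartz p q)
      show "integrable lborel (\<lambda>y. (C1 * C2 * (1 / wt x ^ N)) * (1 / wt (y - 0 :: 'b) ^ ?D))"
        using iw by (rule integrable_mult_right)
      fix y :: 'b
      have w: "wt x ^ N \<le> wt y ^ N * wt (y - x) ^ N" using wt_power_le_mult_diff[of x N y] by (simp add: wt_minus_commute)
      have "norm (?U y) \<le> (C1 / wt y ^ (N + ?D)) * (C2 / wt (y - x) ^ N)"
      proof -
        have "norm (?U y) = norm (\<psi> y) * norm (\<phi> (y - x))" by (simp add: norm_mult)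
        also have "\<dots> \<le> (C1 / wt y ^ (N + ?D)) * (C2 / wt (y - x) ^ N)"
          by (intro mult_mono C1 C2 divide_nonneg_nonneg) auto
        finally show ?thesis .
      qed
      also have "\<dots> = C1 * C2 * (1 / (wt y ^ N * wt (y - x) ^ N)) * (1 / wt (y - 0) ^ ?D)"
        by (simp add: power_add)
      also have "\<dots> \<le> C1 * C2 * (1 / wt x ^ N) * (1 / wt (y - 0) ^ ?D)"
        using w C1(1) C2(1) by (intro mult_right_mono mult_left_mono divide_left_mono mult_pos_pos) auto
      finally show "norm (?U y) \<le> (C1 * C2 * (1 / wt x ^ N)) * (1 / wt (y - 0) ^ ?D)" .
    qed
    also have "\<dots> = (C1 * C2 * (LINT y|lborel. 1 / wt (y - 0 :: 'b) ^ ?D)) * (1 / wt x ^ N)"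
      by (subst integral_mult_right_zero) simp
    finally show ?thesis .
  qed
  then show ?thesis by blast
qed

lemma wt_Pair_le: "wt (x, y) \<le> wt x * wt y"
proof -
  have "norm (x, y) \<le> norm x + norm y" by (rule norm_Pair_le)
  then show ?thesis using mult_nonneg_nonneg[OF norm_ge_zero norm_ge_zero, of x y] unfolding wt_def distrib_left distrib_right
    by linarith
qed

text \<open>The abstract integration by parts rule is applied with the position as parameter, to the
  class of all STFTs of Schwartz functions. Decay in each variable separately then gives decay in
  the pair, as the weight of a pair is at most the product of the weights.\<close>

lemma st_schwartz_decay:
  fixes \<psi> \<phi> :: "'b::euclidean_space \<Rightarrow> complex"
  assumes p: "schwartz \<psi>" and q: "schwartz \<phi>"
  obtains C where "0 \<le> C" "\<And>z. norm (st \<psi> \<phi> z) \<le> C / wt z ^ N"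
proof -
  let ?J = "{(\<lambda>x \<xi>. st \<psi> \<phi> (x, \<xi>)) | \<psi> \<phi>. schwartz \<psi> \<and> schwartz (\<phi> :: 'b \<Rightarrow> complex)}"
  obtain C where C: "0 \<le> C" "\<And>x \<xi>. wt \<xi> ^ N * norm (st \<psi> \<phi> (x, \<xi>)) \<le> C * (1 / wt x ^ N)"
  proof (rule frequency_decay[of "\<lambda>x. 1 / wt x ^ N" ?J "\<lambda>x \<xi>. st \<psi> \<phi> (x, \<xi>)" N])
    show "\<exists>C. \<forall>i \<Omega>. norm (j i \<Omega>) \<le> C * (1 / wt i ^ N)" if "j \<in> ?J" for j
    proof -
      from that obtain \<psi> \<phi> where "j = (\<lambda>x \<xi>. st \<psi> \<phi> (x, \<xi>))" "schwartz \<psi>" "schwartz \<phi>" by blast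
      then show ?thesis using st_schwartz_bound by simp
    qed
    show "\<exists>j1\<in>?J. \<exists>j2\<in>?J. \<exists>j3\<in>?J. \<forall>i \<Omega>. \<bar>v \<bullet> \<Omega>\<bar> * norm (j i \<Omega>) \<le> norm (j1 i \<Omega>) + norm (j2 i \<Omega>) + norm (j3 i \<Omega>)"
      if j: "j \<in> ?J" and v: "v \<in> Basis" for j v
    proof -
      from j obtain \<psi> \<phi> where j: "j = (\<lambda>x \<xi>. st \<psi> \<phi> (x, \<xi>))" "schwartz \<psi>" "schwartz \<phi>" by blast
      let ?j1 = "\<lambda>x \<xi>. st (\<lambda>y. frechet_derivative \<psi> (at y) v) \<phi> (x, \<xi>)"
      let ?j2 = "\<lambda>x \<xi>. st \<psi> (\<lambda>y. frechet_derivative \<phi> (at y) v) (x, \<xi>)"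
      have J: "?j1 \<in> ?J" "?j2 \<in> ?J" using schwartz_dderiv[OF j(2) v] schwartz_dderiv[OF j(3) v] j(2,3) by blast+
      \<comment> \<open>\<open>frequency_decay\<close> expects three terms while only two arise
        here, so the second is listed twice.\<close>
      have le: "\<bar>v \<bullet> \<Omega>\<bar> * norm (j i \<Omega>) \<le> norm (?j1 i \<Omega>) + norm (?j2 i \<Omega>) + norm (?j2 i \<Omega>)" for i \<Omega>
        unfolding j(1) by (rule order_trans[OF schwartz_product_st_step[OF j(2,3) v]]) simp
      show ?thesis by (rule bexI[OF bexI[OF bexI[OF _ J(2)] J(2)] J(1)]) (use le in blast)
    qed
  qed (use p q in \<open>auto\<close>)
  have "norm (st \<psi> \<phi> z) \<le> C / wt z ^ N" for z
  proof -
    obtain x \<xi> where z: "z = (x, \<xi>)" by (cases z)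
    have "wt z ^ N * norm (st \<psi> \<phi> z) \<le> (wt x * wt \<xi>) ^ N * norm (st \<psi> \<phi> z)"
      unfolding z using wt_Pair_le by (intro mult_right_mono power_mono) auto
    also have "\<dots> = wt x ^ N * (wt \<xi> ^ N * norm (st \<psi> \<phi> (x, \<xi>)))" by (simp add: z power_mult_distrib)
    also have "\<dots> \<le> wt x ^ N * (C * (1 / wt x ^ N))" by (intro mult_left_mono C) auto
    finally show ?thesis by (simp add: pos_le_divide_eq mult.commute)
  qed
  then show ?thesis using C(1) that by blast
qed

section \<open>Time-frequency shifts and the functions paired with the symbol\<close>

definition tf_shift :: "'b::euclidean_space \<times> 'b \<Rightarrow> ('b \<Rightarrow> complex) \<Rightarrow> 'b \<Rightarrow> complex" where
  "tf_shift w \<psi> y = cis (2 * pi * (y \<bullet> snd w)) * \<psi> (y - fst w)"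

lemma borel_measurable_tf_shift: "\<psi> \<in> borel_measurable borel \<Longrightarrow> tf_shift w \<psi> \<in> borel_measurable borel"
  unfolding tf_shift_def[abs_def]
  by (intro borel_measurable_times borel_measurable_shift borel_measurable_char)

lemma L2_borel_tf_shift:
  fixes \<psi> :: "'b::euclidean_space \<Rightarrow> complex"
  assumes "L2_borel \<psi>"
  shows "L2_borel (tf_shift w \<psi>)"
proof -
  have "\<psi> \<in> borel_measurable borel" using assms by (simp add: L2_borel_def)
  note [measurable] = this
  have "(\<lambda>y. (norm (\<psi> y))\<^sup>2) \<in> borel_measurable borel" by measurable
  from lborel_translate(1)[OF this, of "- fst w"]
  show ?thesis using assms borel_measurable_tf_shift[of \<psi> w] unfolding L2_borel_def by (simp add: tf_shift_def norm_mult)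
qed

text \<open>Covariance of the STFT: substituting y + u for y produces a phase, and otherwise only
  the difference of the phase-space points remains.\<close>

lemma norm_st_tf_shift:
  fixes \<psi> \<phi> :: "'b::euclidean_space \<Rightarrow> complex"
  assumes m: "\<psi> \<in> borel_measurable borel" "\<phi> \<in> borel_measurable borel"
  shows "norm (st (tf_shift w \<psi>) \<phi> z) = norm (st \<psi> \<phi> (z - w))"
proof -
  obtain x \<xi> where z: "z = (x, \<xi>)" by (cases z)
  obtain u \<eta> where w: "w = (u, \<eta>)" by (cases w)
  let ?F = "\<lambda>y. tf_shift w \<psi> y * (cnj (\<phi> (y - x)) * cis (- 2 * pi * (y \<bullet> \<xi>)))"
  have mF: "?F \<in> borel_measurable borel"
    by (intro borel_measurable_times borel_measurable_tf_shift borel_measurable_window m borel_measurable_cnj borel_measurable_shift borel_measurable_char)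
  have "st (tf_shift w \<psi>) \<phi> z = (LINT y|lborel. ?F (y + u))"
    unfolding lborel_translate(2)[OF mF] by (simp add: st_def z)
  also have "\<dots> = (LINT y|lborel. cis (2 * pi * (u \<bullet> (\<eta> - \<xi>))) * (\<psi> y * (cnj (\<phi> (y - (x - u))) * cis (- 2 * pi * (y \<bullet> (\<xi> - \<eta>))))))"
  proof (rule Bochner_Integration.integral_cong[OF refl])
    fix y
    have "cis (2 * pi * ((y + u) \<bullet> \<eta>)) * cis (- 2 * pi * ((y + u) \<bullet> \<xi>)) = cis (2 * pi * (u \<bullet> (\<eta> - \<xi>))) * cis (- 2 * pi * (y \<bullet> (\<xi> - \<eta>)))"
      unfolding cis_mult by (intro arg_cong[of _ _ cis]) (simp add: inner_simps algebra_simps)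
    from arg_cong[OF this, of "\<lambda>t. t * (\<psi> y * cnj (\<phi> (y - (x - u))))"]
    show "?F (y + u) = cis (2 * pi * (u \<bullet> (\<eta> - \<xi>))) * (\<psi> y * (cnj (\<phi> (y - (x - u))) * cis (- 2 * pi * (y \<bullet> (\<xi> - \<eta>)))))"
      unfolding tf_shift_def w fst_conv snd_conv add_diff_cancel_right' diff_diff_eq2 by (simp only: mult_ac)
  qed
  also have "\<dots> = cis (2 * pi * (u \<bullet> (\<eta> - \<xi>))) * st \<psi> \<phi> (z - w)"
    unfolding st_def z w by simp
  finally show ?thesis by (simp add: norm_mult)
qed

text \<open>\<open>stp f h \<psi> \<phi> \<Gamma>\<close> is the STFT, with window the conjugate of \<open>\<Gamma>\<close>, of the function that is paired with the
  symbol in the weak definition of the localization operator.\<close>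

definition stp :: "('b::euclidean_space \<Rightarrow> complex) \<Rightarrow> ('b \<Rightarrow> complex) \<Rightarrow> ('b \<Rightarrow> complex) \<Rightarrow> ('b \<Rightarrow> complex) \<Rightarrow>
    ('b \<times> 'b \<Rightarrow> complex) \<Rightarrow> 'b \<times> 'b \<Rightarrow> 'b \<times> 'b \<Rightarrow> complex" where
  "stp f h \<psi> \<phi> \<Gamma> X \<Omega> = (LINT z|lborel. cnj (st f \<psi> z) * st h \<phi> z * (\<Gamma> (z - X) * cis (- 2 * pi * (z \<bullet> \<Omega>))))"

lemma stp_integrable:
  fixes f h \<psi> \<phi> :: "'b::euclidean_space \<Rightarrow> complex"
  assumes f: "L2_borel f" and h: "L2_borel h" and s: "schwartz \<psi>" "schwartz \<phi>" "schwartz \<Gamma>"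
  shows "integrable lborel (\<lambda>z. cnj (st f \<psi> z) * st h \<phi> z * (\<Gamma> (z - X) * cis (- 2 * pi * (z \<bullet> \<Omega>))))"
proof -
  let ?D = "2 * DIM('b \<times> 'b)"
  obtain A where A: "0 \<le> A" "\<And>z. norm (st f \<psi> z) \<le> A" using st_bounded[OF f s(1)] by blast
  obtain B where B: "0 \<le> B" "\<And>z. norm (st h \<phi> z) \<le> B" using st_bounded[OF h s(2)] by blast
  obtain C where C: "0 \<le> C" "\<And>z. norm (\<Gamma> z) \<le> C / wt z ^ ?D" using schwartz_decay[OF s(3), of ?D] by blast
  have i: "integrable lborel (\<lambda>z::'b\<times>'b. (A * B * C) * (1 / wt (z - X) ^ ?D))"
    by (intro integrable_mult_right integrable_inverse_wt_power) simp
  show ?thesis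
  proof (rule Bochner_Integration.integrable_bound[OF i])
    have m: "f \<in> borel_measurable borel" "h \<in> borel_measurable borel" using f h by (simp_all add: L2_borel_def)
    have "(\<lambda>z. cnj (st f \<psi> z) * st h \<phi> z * (\<Gamma> (z - X) * cis (- 2 * pi * (z \<bullet> \<Omega>)))) \<in> borel_measurable borel"
      by (intro borel_measurable_times borel_measurable_cnj st_borel borel_measurable_shift borel_measurable_char
         schwartz_borel[OF s(1)] schwartz_borel[OF s(2)] schwartz_borel[OF s(3)] m)
    then show "(\<lambda>z. cnj (st f \<psi> z) * st h \<phi> z * (\<Gamma> (z - X) * cis (- 2 * pi * (z \<bullet> \<Omega>)))) \<in> borel_measurable lborel" by simp
    show "AE z in lborel. norm (cnj (st f \<psi> z) * st h \<phi> z * (\<Gamma> (z - X) * cis (- 2 * pi * (z \<bullet> \<Omega>)))) \<le> norm ((A * B * C) * (1 / wt (z - X) ^ ?D))"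
    proof (rule AE_I2)
      fix z
      have "norm (cnj (st f \<psi> z) * st h \<phi> z * (\<Gamma> (z - X) * cis (- 2 * pi * (z \<bullet> \<Omega>)))) = norm (st f \<psi> z) * norm (st h \<phi> z) * norm (\<Gamma> (z - X))"
        by (simp add: norm_mult)
      also have "\<dots> \<le> A * B * (C / wt (z - X) ^ ?D)" by (intro mult_mono A B C mult_nonneg_nonneg) auto
      also have "\<dots> = (A * B * C) * (1 / wt (z - X) ^ ?D)" by simp
      also have "\<dots> \<le> norm ((A * B * C) * (1 / wt (z - X) ^ ?D))" unfolding real_norm_def by (rule abs_ge_self)
      finally show "norm (cnj (st f \<psi> z) * st h \<phi> z * (\<Gamma> (z - X) * cis (- 2 * pi * (z \<bullet> \<Omega>)))) \<le> norm ((A * B * C) * (1 / wt (z - X) ^ ?D))" .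
    qed
  qed
qed

text \<open>The derivative of the integrand falls on one of three windows or on the character. The
  new windows are chosen before \<open>f\<close>, \<open>h\<close>, \<open>X\<close> and \<Omega>,
  which keeps the iterated estimates uniform over all shifted test functions
  \<open>h\<close>.\<close>

lemma stp_step:
  fixes \<psi> \<phi> :: "'b::euclidean_space \<Rightarrow> complex" and v :: "'b \<times> 'b"
  assumes s: "schwartz \<psi>" "schwartz \<phi>" "schwartz \<Gamma>" and v: "v \<in> Basis"
  obtains \<psi>' \<phi>' \<Gamma>' where "schwartz \<psi>'" "schwartz \<phi>'" "schwartz \<Gamma>'"
    "\<And>f h X \<Omega>. L2_borel f \<Longrightarrow> L2_borel h \<Longrightarrow> \<bar>v \<bullet> \<Omega>\<bar> * norm (stp f h \<psi> \<phi> \<Gamma> X \<Omega>) \<le>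
       norm (stp f h \<psi>' \<phi> \<Gamma> X \<Omega>) + norm (stp f h \<psi> \<phi>' \<Gamma> X \<Omega>) + norm (stp f h \<psi> \<phi> \<Gamma>' X \<Omega>)"
proof -
  obtain \<psi>' \<phi>' where s': "schwartz \<psi>'" "schwartz \<phi>'"
    and d: "\<And>f h. L2_borel f \<Longrightarrow> L2_borel h \<Longrightarrow> has_dir_deriv (\<lambda>z. cnj (st f \<psi> z) * st h \<phi> z) v
       (\<lambda>z. cnj (st f \<psi>' z) * st h \<phi> z + cnj (st f \<psi> z) * st h \<phi>' z)"
    using st_product_has_dir_deriv[OF s(1,2) v] by blast
  define \<Gamma>' where "\<Gamma>' = (\<lambda>z. frechet_derivative \<Gamma> (at z) v)"
  have G': "schwartz \<Gamma>'" unfolding \<Gamma>'_def by (rule schwartz_dderiv[OF s(3) v])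
  show ?thesis
  proof (rule that[OF s' G'])
    fix f h :: "'b \<Rightarrow> complex" and X \<Omega> :: "'b \<times> 'b" assume f: "L2_borel f" and h: "L2_borel h"
    define e where "e = (\<lambda>z::'b\<times>'b. cis (- 2 * pi * (z \<bullet> \<Omega>)))"
    define c where "c = 2 * of_real pi * \<i> * complex_of_real (v \<bullet> \<Omega>)"
    define U where "U = (\<lambda>z. cnj (st f \<psi> z) * st h \<phi> z * (\<Gamma> (z - X) * e z))"
    define U1 where "U1 = (\<lambda>z. cnj (st f \<psi>' z) * st h \<phi> z * (\<Gamma> (z - X) * e z))"
    define U2 where "U2 = (\<lambda>z. cnj (st f \<psi> z) * st h \<phi>' z * (\<Gamma> (z - X) * e z))"
    define U3 where "U3 = (\<lambda>z. cnj (st f \<psi> z) * st h \<phi> z * (\<Gamma>' (z - X) * e z))"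
    have iU: "integrable lborel U" "integrable lborel U1" "integrable lborel U2" "integrable lborel U3"
      unfolding U_def U1_def U2_def U3_def e_def by (intro stp_integrable f h s s' G')+
    have he: "has_dir_deriv e v (\<lambda>y. - c * e y)" unfolding e_def c_def by (rule has_dir_deriv_char)
    have "has_dir_deriv U v (\<lambda>z. (cnj (st f \<psi> z) * st h \<phi> z) * (\<Gamma> (z - X) * (- c * e z) + \<Gamma>' (z - X) * e z) +
        (cnj (st f \<psi>' z) * st h \<phi> z + cnj (st f \<psi> z) * st h \<phi>' z) * (\<Gamma> (z - X) * e z))"
      unfolding U_def \<Gamma>'_def
      by (intro has_dir_deriv_mult[OF d[OF f h]] has_dir_deriv_mult[OF _ he] has_dir_deriv_shift[OF has_dir_deriv_schwartz[OF s(3)]])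
    also have "(\<lambda>z. (cnj (st f \<psi> z) * st h \<phi> z) * (\<Gamma> (z - X) * (- c * e z) + \<Gamma>' (z - X) * e z) +
        (cnj (st f \<psi>' z) * st h \<phi> z + cnj (st f \<psi> z) * st h \<phi>' z) * (\<Gamma> (z - X) * e z)) =
       (\<lambda>z. - c * U z + (U1 z + (U2 z + U3 z)))"
      unfolding U_def U1_def U2_def U3_def by (simp add: fun_eq_iff algebra_simps)
    finally have dU: "has_dir_deriv U v (\<lambda>z. - c * U z + (U1 z + (U2 z + U3 z)))" .
    have "(LINT z|lborel. - c * U z + (U1 z + (U2 z + U3 z))) = 0"
      by (rule has_dir_deriv_integral_eq_0[OF dU iU(1)]) (intro Bochner_Integration.integrable_add integrable_mult_right iU)
    then have "c * (LINT z|lborel. U z) = (LINT z|lborel. U1 z) + (LINT z|lborel. U2 z) + (LINT z|lborel. U3 z)"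
      using iU by (simp add: algebra_simps add_eq_0_iff2)
    then have "norm c * norm (stp f h \<psi> \<phi> \<Gamma> X \<Omega>) = norm (stp f h \<psi>' \<phi> \<Gamma> X \<Omega> + stp f h \<psi> \<phi>' \<Gamma> X \<Omega> + stp f h \<psi> \<phi> \<Gamma>' X \<Omega>)"
      unfolding stp_def U_def U1_def U2_def U3_def e_def by (simp add: norm_mult[symmetric])
    also have "\<dots> \<le> norm (stp f h \<psi>' \<phi> \<Gamma> X \<Omega>) + norm (stp f h \<psi> \<phi>' \<Gamma> X \<Omega>) + norm (stp f h \<psi> \<phi> \<Gamma>' X \<Omega>)"
      by (intro norm_triangle_le add_mono order_refl norm_triangle_ineq)
    finally have 1: "norm c * norm (stp f h \<psi> \<phi> \<Gamma> X \<Omega>) \<le> \<dots>" .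
    have "\<bar>v \<bullet> \<Omega>\<bar> \<le> norm c"
      unfolding c_def using pi_gt3 mult_right_mono[of 1 "2 * pi" "\<bar>v \<bullet> \<Omega>\<bar>"] by (simp add: norm_mult)
    then have "\<bar>v \<bullet> \<Omega>\<bar> * norm (stp f h \<psi> \<phi> \<Gamma> X \<Omega>) \<le> norm c * norm (stp f h \<psi> \<phi> \<Gamma> X \<Omega>)"
      by (rule mult_right_mono) simp
    then show "\<bar>v \<bullet> \<Omega>\<bar> * norm (stp f h \<psi> \<phi> \<Gamma> X \<Omega>) \<le>
       norm (stp f h \<psi>' \<phi> \<Gamma> X \<Omega>) + norm (stp f h \<psi> \<phi>' \<Gamma> X \<Omega>) + norm (stp f h \<psi> \<phi> \<Gamma>' X \<Omega>)"
      using 1 by (rule order_trans)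
  qed
qed

subsection \<open>Eigenfunctions\<close>

lemma L2_borel_representative:
  fixes f :: "'b::euclidean_space \<Rightarrow> complex"
  assumes "L2 f"
  obtains g where "L2_borel g" "AE x in lebesgue. f x = g x"
proof -
  have m: "f \<in> borel_measurable lebesgue" and i: "integrable lebesgue (\<lambda>x. (cmod (f x))\<^sup>2)"
    using assms by (auto simp: L2_def)
  have mr: "(\<lambda>x. Re (f x)) \<in> borel_measurable (completion lborel)"
    and mi: "(\<lambda>x. Im (f x)) \<in> borel_measurable (completion lborel)"
    using m by (simp_all add: borel_measurable_complex_iff)
  obtain r where r: "r \<in> borel_measurable lborel" "AE x in lborel. Re (f x) = r x"
    using completion_ex_borel_measurable_real[OF mr] by blast
  obtain s where s: "s \<in> borel_measurable lborel" "AE x in lborel. Im (f x) = s x"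
    using completion_ex_borel_measurable_real[OF mi] by blast
  define g where "g = (\<lambda>x. Complex (r x) (s x))"
  have mg: "g \<in> borel_measurable borel"
    using r(1) s(1) by (simp add: g_def borel_measurable_complex_iff)
  have "AE x in lborel. f x = g x"
    using r(2) s(2) by eventually_elim (simp add: g_def complex_eq_iff)
  then have ae: "AE x in lebesgue. f x = g x" by (rule AE_completion)
  have mgl: "(\<lambda>x. (norm (g x))\<^sup>2) \<in> borel_measurable lborel" using mg by simp
  have "integrable lebesgue (\<lambda>x. (norm (g x))\<^sup>2)"
  proof (rule integrable_cong_AE_imp[OF i])
    show "(\<lambda>x. (norm (g x))\<^sup>2) \<in> borel_measurable lebesgue" using mgl by (rule measurable_completion)
    show "AE x in lebesgue. (norm (f x))\<^sup>2 = (norm (g x))\<^sup>2" using ae by eventually_elim simp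
  qed
  then have "integrable lborel (\<lambda>x. (norm (g x))\<^sup>2)" using integrable_completion[OF mgl] by simp
  then show ?thesis using mg ae by (intro that[of g]) (auto simp: L2_borel_def)
qed

lemma fun_distr_representative:
  fixes f g :: "'b::euclidean_space \<Rightarrow> complex"
  assumes f: "f \<in> borel_measurable lebesgue" and g: "g \<in> borel_measurable borel"
    and ae: "AE x in lebesgue. f x = g x" and k: "k \<in> borel_measurable borel"
  shows "fun_distr f k = (LINT y|lborel. g y * k y)"
proof -
  have kl: "k \<in> borel_measurable lebesgue" using k by (intro measurable_completion) simp
  have gl: "g \<in> borel_measurable lebesgue" using g by (intro measurable_completion) simp
  have "fun_distr f k = (LINT y|lebesgue. g y * k y)"
    unfolding fun_distr_def
  proof (rule integral_cong_AE)
    show "AE x in lebesgue. f x * k x = g x * k x" using ae by eventually_elim simp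
  qed (intro borel_measurable_times f gl kl)+
  also have "\<dots> = (LINT y|lborel. g y * k y)"
  proof (rule integral_completion)
    have "(\<lambda>y. g y * k y) \<in> borel_measurable borel" by (intro borel_measurable_times g k)
    then show "(\<lambda>y. g y * k y) \<in> borel_measurable lborel" by simp
  qed
  finally show ?thesis .
qed

lemma L2_of_borel:
  assumes "L2_borel g"
  shows "L2 g"
proof -
  have m: "g \<in> borel_measurable lborel" using assms by (simp add: L2_borel_def)
  note [measurable] = this
  have m2: "(\<lambda>x. (norm (g x))\<^sup>2) \<in> borel_measurable lborel" by measurable
  show ?thesis unfolding L2_def
    using assms measurable_completion[OF m] integrable_completion[OF m2] by (simp add: L2_borel_def)
qed

lemma stft_eq_st:
  fixes f g :: "'b::euclidean_space \<Rightarrow> complex"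
  assumes "f \<in> borel_measurable lebesgue" "g \<in> borel_measurable borel" "AE x in lebesgue. f x = g x"
    "\<psi> \<in> borel_measurable borel"
  shows "stft (fun_distr f) \<psi> x \<xi> = st g \<psi> (x, \<xi>)"
  unfolding stft_def st_def fst_conv snd_conv
  by (rule fun_distr_representative[OF assms(1-3)]) (rule borel_measurable_window[OF assms(4)])

text \<open>The available bound for the integral of \<open>g\<close> times a test function is not
  homogeneous in the latter. Homogeneity is recovered by dividing the test function by its seminorm;
  when that seminorm is 0 the test function vanishes.\<close>

lemma tempered_fun_distr:
  fixes f :: "'b::euclidean_space \<Rightarrow> complex"
  assumes "L2 f"
  shows "tempered (fun_distr f)"
proof -
  have f: "f \<in> borel_measurable lebesgue" using assms by (simp add: L2_def)
  obtain g where g: "L2_borel g" and ae: "AE x in lebesgue. f x = g x"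
    using L2_borel_representative[OF assms] by blast
  have mg: "g \<in> borel_measurable borel" using g by (simp add: L2_borel_def)
  note eq = fun_distr_representative[OF f mg ae]
  let ?d = "DIM('b)"
  have int: "integrable lborel (\<lambda>y. g y * \<phi> y)" if s: "schwartz \<phi>" for \<phi>
  proof -
    obtain C where "\<And>y. norm (\<phi> y) \<le> C / wt y ^ ?d" using schwartz_decay[OF s, of ?d] by blast
    then show ?thesis by (intro L2_borel_mult(1)[OF g schwartz_borel[OF s], of C 0]) simp
  qed
  define A where "A = (LINT y|lborel. (norm (g y))\<^sup>2) + 1\<^sup>2 * (LINT y|lborel. 1 / wt (y :: 'b) ^ (2 * ?d))"
  have bound: "norm (fun_distr f \<phi>) \<le> A * schwartz_seminorm ?d \<phi>" if s: "schwartz \<phi>" for \<phi>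
  proof -
    define n where "n = schwartz_seminorm ?d \<phi>"
    have n: "wt y ^ ?d * norm (\<phi> y) \<le> n" for y unfolding n_def by (rule schwartz_seminorm_ge[OF s])
    have n0: "0 \<le> n" by (rule order_trans[OF _ n[of 0]]) simp
    have e: "fun_distr f \<phi> = (LINT y|lborel. g y * \<phi> y)" by (rule eq[OF schwartz_borel[OF s]])
    show ?thesis
    proof (cases "n = 0")
      case True
      have "\<phi> y = 0" for y
      proof -
        have "wt y ^ ?d * norm (\<phi> y) = 0" using n[of y] True by (intro antisym) auto
        then show ?thesis by simp
      qed
      then show ?thesis unfolding e n_def[symmetric] True by simp
    next
      case False
      then have np: "0 < n" using n0 by simp
      have "norm (LINT y|lborel. g y * ((1 / of_real n) * \<phi> y)) \<le> A"
        unfolding A_def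
      proof (rule L2_borel_mult(2)[OF g, where x = 0])
        show "(\<lambda>y. 1 / of_real n * \<phi> y) \<in> borel_measurable borel"
          by (intro schwartz_borel schwartz_cmult s)
        show "norm (1 / of_real n * \<phi> y) \<le> 1 / wt (y - 0) ^ ?d" for y
          using n[of y] np by (simp add: norm_mult norm_divide field_simps)
      qed
      moreover have "(LINT y|lborel. g y * ((1 / of_real n) * \<phi> y)) = (1 / of_real n) * (LINT y|lborel. g y * \<phi> y)"
        by (subst integral_mult_right_zero[symmetric]) (simp add: mult.left_commute)
      ultimately show ?thesis unfolding e n_def[symmetric] using np by (simp add: norm_mult norm_divide field_simps)
    qed
  qed
  have add: "fun_distr f (\<lambda>x. \<phi> x + \<psi> x) = fun_distr f \<phi> + fun_distr f \<psi>" if "schwartz \<phi>" "schwartz \<psi>" for \<phi> \<psi>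
    using that int by (simp add: eq schwartz_borel schwartz_add distrib_left Bochner_Integration.integral_add)
  have mult: "fun_distr f (\<lambda>x. c * \<phi> x) = c * fun_distr f \<phi>" if "schwartz \<phi>" for c \<phi>
  proof -
    have "fun_distr f (\<lambda>x. c * \<phi> x) = (LINT y|lborel. c * (g y * \<phi> y))"
      using that by (simp add: eq schwartz_borel schwartz_cmult mult.left_commute)
    then show ?thesis using that by (simp add: eq schwartz_borel)
  qed
  show ?thesis unfolding tempered_def using add mult bound by blast
qed

text \<open>Covers every \<open>f\<close>: a Bochner integral that does not exist has the default
  value 0. It applies directly to the integral in \<open>dual_pair\<close>.\<close>

lemma norm_integral_le_nn_integral:
  fixes f :: "'c \<Rightarrow> complex"
  shows "ennreal (norm (integral\<^sup>L M f)) \<le> (\<integral>\<^sup>+x. ennreal (norm (f x)) \<partial>M)"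
  by (cases "integrable M f") (auto simp: integral_norm_bound_ennreal not_integrable_integral_eq)

section \<open>Estimating the pairing and gaining one power of the envelope\<close>

lemma wt_power_add_div_le:
  assumes "wt x ^ (K + N) * r \<le> B"
  shows "wt x ^ K * r \<le> B * (1 / wt x ^ N)"
  using assms by (simp add: power_add pos_le_divide_eq algebra_simps)

text \<open>The shifted test function concentrates at \<open>w\<close> and \<Gamma> at
  \<open>X\<close>, so their product is small unless \<open>X\<close> is near \<open>w\<close>. Slow
  variation lets the bound for the STFT of \<open>f\<close> be evaluated at \<open>w\<close>. This
  is the estimate without frequency decay.\<close>

lemma stp_tf_shift_bound:
  fixes f \<psi> \<phi> \<psi>0 :: "'b::euclidean_space \<Rightarrow> complex"
  assumes f: "L2_borel f" and s: "schwartz \<psi>" "schwartz \<phi>" "schwartz \<Gamma>" "schwartz \<psi>0"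
    and F: "\<And>z. norm (st f \<psi> z) \<le> C1 * b z ^ k" and C1: "0 \<le> C1"
    and b0: "\<And>z. 0 \<le> b z" and b: "\<And>X Y. b X \<le> b Y * wt (X - Y) ^ K"
  shows "\<exists>C. \<forall>w X \<Omega>. norm (stp f (tf_shift w \<psi>0) \<psi> \<phi> \<Gamma> X \<Omega>) \<le> C * (b w ^ k / wt (X - w) ^ N)"
proof -
  let ?D = "2 * DIM('b \<times> 'b)"
  \<comment> \<open>Of the decay in z - w, the order K k pays for replacing b(z)^k by b(w)^k. The
    order N combines with that of \<Gamma> at z - X into decay in X - w, and the rest makes the
    integral over \<open>z\<close> converge.\<close>
  obtain C2 where C2: "0 \<le> C2" "\<And>z. norm (st \<psi>0 \<phi> z) \<le> C2 / wt z ^ (K * k + N + ?D)"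
    using st_schwartz_decay[OF s(4,2)] by blast
  obtain C3 where C3: "0 \<le> C3" "\<And>z. norm (\<Gamma> z) \<le> C3 / wt z ^ N"
    using schwartz_decay[OF s(3), of N] by blast
  define I where "I = (LINT z|lborel. 1 / wt (z :: 'b \<times> 'b) ^ ?D)"
  have iw: "integrable lborel (\<lambda>z::'b\<times>'b. 1 / wt (z - w) ^ ?D)" for w by (rule integrable_inverse_wt_power) simp
  have I: "(LINT z|lborel. 1 / wt (z - w :: 'b \<times> 'b) ^ ?D) = I" for w
    using lborel_translate(2)[of "\<lambda>z::'b\<times>'b. 1 / wt z ^ ?D" "- w"] by (simp add: I_def)
  have "norm (stp f (tf_shift w \<psi>0) \<psi> \<phi> \<Gamma> X \<Omega>) \<le> (C1 * C2 * C3 * I) * (b w ^ k / wt (X - w) ^ N)" for w X \<Omega>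
  proof -
    let ?U = "\<lambda>z. cnj (st f \<psi> z) * st (tf_shift w \<psi>0) \<phi> z * (\<Gamma> (z - X) * cis (- 2 * pi * (z \<bullet> \<Omega>)))"
    have "norm (stp f (tf_shift w \<psi>0) \<psi> \<phi> \<Gamma> X \<Omega>) \<le> (LINT z|lborel. norm (?U z))"
      unfolding stp_def by (rule integral_norm_bound)
    also have "\<dots> \<le> (LINT z|lborel. (C1 * C2 * C3 * (b w ^ k / wt (X - w) ^ N)) * (1 / wt (z - w :: 'b \<times> 'b) ^ ?D))"
    proof (rule integral_mono)
      show "integrable lborel (\<lambda>z. norm (?U z))"
        by (intro integrable_norm stp_integrable f L2_borel_tf_shift L2_borel_schwartz s)
      show "integrable lborel (\<lambda>z. (C1 * C2 * C3 * (b w ^ k / wt (X - w) ^ N)) * (1 / wt (z - w :: 'b \<times> 'b) ^ ?D))"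
        using iw by (rule integrable_mult_right)
      fix z :: "'b \<times> 'b"
      define p where "p = wt (z - w)"
      define q where "q = wt (z - X)"
      define r where "r = wt (X - w)"
      have pos: "0 < p" "0 < q" "0 < r" by (simp_all add: p_def q_def r_def)
      have rpq: "r ^ N \<le> p ^ N * q ^ N"
      proof -
        have "wt (X - w) ^ N \<le> wt (z - w) ^ N * wt ((X - w) - (z - w)) ^ N" by (rule wt_power_le_mult_diff)
        then show ?thesis unfolding p_def q_def r_def by (simp add: wt_minus_commute)
      qed
      have "norm (?U z) = norm (st f \<psi> z) * norm (st \<psi>0 \<phi> (z - w)) * norm (\<Gamma> (z - X))"
        by (simp add: norm_mult norm_st_tf_shift schwartz_borel s)
      also have "\<dots> \<le> (C1 * (b w ^ k * p ^ (K * k))) * (C2 / p ^ (K * k + N + ?D)) * (C3 / q ^ N)"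
      proof (intro mult_mono)
        have "b z ^ k \<le> (b w * wt (z - w) ^ K) ^ k" by (intro power_mono b b0)
        then have "b z ^ k \<le> b w ^ k * p ^ (K * k)" by (simp add: power_mult_distrib power_mult p_def)
        then show "norm (st f \<psi> z) \<le> C1 * (b w ^ k * p ^ (K * k))"
          using F[of z] mult_left_mono[OF _ C1] order_trans by blast
        show "norm (st \<psi>0 \<phi> (z - w)) \<le> C2 / p ^ (K * k + N + ?D)" unfolding p_def by (rule C2)
        show "norm (\<Gamma> (z - X)) \<le> C3 / q ^ N" unfolding q_def by (rule C3)
      qed (use C1 C2(1) C3(1) b0[of w] pos in \<open>auto intro!: mult_nonneg_nonneg divide_nonneg_nonneg\<close>)
      also have "\<dots> = (C1 * C2 * C3 * b w ^ k) * (1 / (p ^ N * q ^ N)) * (1 / p ^ ?D)"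
        using pos by (simp add: power_add mult_ac)
      also have "\<dots> \<le> (C1 * C2 * C3 * b w ^ k) * (1 / r ^ N) * (1 / p ^ ?D)"
        using pos rpq C1 C2(1) C3(1) b0[of w]
        by (intro mult_right_mono mult_left_mono divide_left_mono mult_pos_pos mult_nonneg_nonneg) auto
      finally show "norm (?U z) \<le> (C1 * C2 * C3 * (b w ^ k / wt (X - w) ^ N)) * (1 / wt (z - w) ^ ?D)"
        by (simp add: p_def r_def)
    qed
    also have "\<dots> = (C1 * C2 * C3 * I) * (b w ^ k / wt (X - w) ^ N)"
      unfolding integral_mult_right_zero I by (simp only: mult_ac)
    finally show ?thesis .
  qed
  then show ?thesis by blast
qed

text \<open>The parameter in \<open>frequency_decay\<close> is the pair (w, X), so the constant is
  uniform in both. Integration by parts replaces \<psi> by other Schwartz windows, hence the assumed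
  bound on the STFT of \<open>f\<close> has to hold for all of them.\<close>

lemma stp_tf_shift_decay:
  fixes f \<psi> \<phi> \<psi>0 :: "'b::euclidean_space \<Rightarrow> complex"
  assumes f: "L2_borel f" and s: "schwartz \<psi>" "schwartz \<phi>" "schwartz \<Gamma>" "schwartz \<psi>0"
    and F: "\<And>\<psi>. schwartz \<psi> \<Longrightarrow> \<exists>C\<ge>0. \<forall>z. norm (st f \<psi> z) \<le> C * b z ^ k"
    and b0: "\<And>z. 0 \<le> b z" and b: "\<And>X Y. b X \<le> b Y * wt (X - Y) ^ K"
  obtains C where "0 \<le> C" "\<And>w X \<Omega>. wt \<Omega> ^ M * norm (stp f (tf_shift w \<psi>0) \<psi> \<phi> \<Gamma> X \<Omega>) \<le> C * (b w ^ k / wt (X - w) ^ N)"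
proof -
  let ?j = "\<lambda>\<psi> \<phi> \<Gamma> (w, X) \<Omega>. stp f (tf_shift w \<psi>0) \<psi> \<phi> \<Gamma> X \<Omega>"
  let ?J = "{?j \<psi> \<phi> \<Gamma> | \<psi> \<phi> \<Gamma>. schwartz \<psi> \<and> schwartz \<phi> \<and> schwartz \<Gamma>}"
  let ?\<beta> = "\<lambda>(w, X). b w ^ k / wt (X - w) ^ N"
  obtain C where C: "0 \<le> C" "\<And>i \<Omega>. wt \<Omega> ^ M * norm (?j \<psi> \<phi> \<Gamma> i \<Omega>) \<le> C * ?\<beta> i"
  proof (rule frequency_decay[of ?\<beta> ?J "?j \<psi> \<phi> \<Gamma>" M])
    show "0 \<le> ?\<beta> i" for i using b0 by (auto split: prod.split)
    show "\<exists>C. \<forall>i \<Omega>. norm (j i \<Omega>) \<le> C * ?\<beta> i" if "j \<in> ?J" for j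
    proof -
      from that obtain \<psi> \<phi> \<Gamma> where j: "j = ?j \<psi> \<phi> \<Gamma>" "schwartz \<psi>" "schwartz \<phi>" "schwartz \<Gamma>" by blast
      obtain C1 where "0 \<le> C1" "\<And>z. norm (st f \<psi> z) \<le> C1 * b z ^ k" using F[OF j(2)] by blast
      from stp_tf_shift_bound[OF f j(2,3,4) s(4) this(2,1) b0 b] show ?thesis unfolding j(1) by auto
    qed
    show "\<exists>j1\<in>?J. \<exists>j2\<in>?J. \<exists>j3\<in>?J. \<forall>i \<Omega>. \<bar>v \<bullet> \<Omega>\<bar> * norm (j i \<Omega>) \<le> norm (j1 i \<Omega>) + norm (j2 i \<Omega>) + norm (j3 i \<Omega>)"
      if j: "j \<in> ?J" and v: "v \<in> Basis" for j v
    proof -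
      from j obtain \<psi> \<phi> \<Gamma> where j: "j = ?j \<psi> \<phi> \<Gamma>" "schwartz \<psi>" "schwartz \<phi>" "schwartz \<Gamma>" by blast
      obtain \<psi>' \<phi>' \<Gamma>' where s': "schwartz \<psi>'" "schwartz \<phi>'" "schwartz \<Gamma>'"
        and le: "\<And>f h X \<Omega>. L2_borel f \<Longrightarrow> L2_borel h \<Longrightarrow> \<bar>v \<bullet> \<Omega>\<bar> * norm (stp f h \<psi> \<phi> \<Gamma> X \<Omega>) \<le>
          norm (stp f h \<psi>' \<phi> \<Gamma> X \<Omega>) + norm (stp f h \<psi> \<phi>' \<Gamma> X \<Omega>) + norm (stp f h \<psi> \<phi> \<Gamma>' X \<Omega>)"
        using stp_step[OF j(2,3,4) v] by blast
      have J: "?j \<psi>' \<phi> \<Gamma> \<in> ?J" "?j \<psi> \<phi>' \<Gamma> \<in> ?J" "?j \<psi> \<phi> \<Gamma>' \<in> ?J" using j(2-4) s' by blast+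
      have "\<forall>i \<Omega>. \<bar>v \<bullet> \<Omega>\<bar> * norm (j i \<Omega>) \<le> norm (?j \<psi>' \<phi> \<Gamma> i \<Omega>) + norm (?j \<psi> \<phi>' \<Gamma> i \<Omega>) + norm (?j \<psi> \<phi> \<Gamma>' i \<Omega>)"
        unfolding j(1) using le[OF f L2_borel_tf_shift[OF L2_borel_schwartz[OF s(4)]]] by auto
      then show ?thesis by (rule bexI[OF bexI[OF bexI[OF _ J(3)] J(2)] J(1)])
    qed
    show "?j \<psi> \<phi> \<Gamma> \<in> ?J" using s by blast
  qed auto
  show ?thesis
  proof (rule that[OF C(1)])
    fix w X \<Omega> :: "'b \<times> 'b"
    show "wt \<Omega> ^ M * norm (stp f (tf_shift w \<psi>0) \<psi> \<phi> \<Gamma> X \<Omega>) \<le> C * (b w ^ k / wt (X - w) ^ N)"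
      using C(2)[of \<Omega> "(w, X)"] by simp
  qed
qed

lemma nn_integral_inverse_wt:
  obtains I where "0 \<le> I" "\<And>w :: 'b::euclidean_space. (\<integral>\<^sup>+x. ennreal (1 / wt (x - w) ^ (2 * DIM('b))) \<partial>lborel) = ennreal I"
proof -
  let ?D = "2 * DIM('b)"
  have i: "integrable lborel (\<lambda>x::'b. 1 / wt (x - w) ^ ?D)" for w by (rule integrable_inverse_wt_power) simp
  have "(\<integral>\<^sup>+x. ennreal (1 / wt (x - w) ^ ?D) \<partial>lborel) = ennreal (LINT x|lborel. 1 / wt (x :: 'b) ^ ?D)" for w :: 'b
    using nn_integral_eq_integral[OF i[of w]] lborel_translate(2)[of "\<lambda>z::'b. 1 / wt z ^ ?D" "- w"] by simp
  moreover have "0 \<le> (LINT x|lborel. 1 / wt (x :: 'b) ^ ?D)" by (rule integral_nonneg_AE) simp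
  ultimately show ?thesis using that by blast
qed

text \<open>The source of the additional power: |V(X, \<Omega>)| \<le> b(w)
  \<open>wt (X - w) ^ K\<close> \<open>wt \<Omega> ^ K\<close>. Both polynomial factors are
  cancelled by the first K orders of the assumed decay, and the remaining 2 \<open>DIM\<close>
  orders make the integrals over X and \<Omega> finite, each equal to \<open>I\<close>. The constant
  \<open>B\<close> is independent of \<open>w\<close> and \<open>k\<close>.\<close>

lemma dual_pair_bound:
  fixes a :: "('b::euclidean_space \<times> 'b \<Rightarrow> complex) \<Rightarrow> complex"
  assumes V: "\<And>X \<Omega>. norm (stft a gauss X \<Omega>) \<le> b X * wt \<Omega> ^ K"
    and b0: "\<And>X. 0 \<le> b X" and b: "\<And>X Y. b X \<le> b Y * wt (X - Y) ^ K"
  obtains B where "0 \<le> B" "\<And>\<Psi> (C::real) w (k::nat). 0 \<le> C \<Longrightarrow>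
     (\<And>X \<Omega>. wt \<Omega> ^ (K + 2 * DIM('b \<times> 'b)) * norm (stft (fun_distr \<Psi>) gauss X \<Omega>) \<le>
        C * (b w ^ k / wt (X - w) ^ (K + 2 * DIM('b \<times> 'b)))) \<Longrightarrow>
     norm (dual_pair a \<Psi>) \<le> B * C * b w ^ Suc k"
proof -
  let ?D = "2 * DIM('b \<times> 'b)"
  obtain I where I: "0 \<le> I" "\<And>w :: 'b \<times> 'b. (\<integral>\<^sup>+x. ennreal (1 / wt (x - w) ^ ?D) \<partial>lborel) = ennreal I"
    using nn_integral_inverse_wt by blast
  define c where "c = complex_of_real (LINT x|lebesgue. (cmod (gauss (x :: 'b \<times> 'b)))\<^sup>2)"
  have "norm (dual_pair a \<Psi>) \<le> (I * I / norm c) * C * b w ^ Suc k"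
    if C: "0 \<le> C" and \<Psi>: "\<And>X \<Omega>. wt \<Omega> ^ (K + ?D) * norm (stft (fun_distr \<Psi>) gauss X \<Omega>) \<le> C * (b w ^ k / wt (X - w) ^ (K + ?D))"
    for \<Psi> C w k
  proof -
    define G where "G = (\<lambda>Z. stft a gauss (fst Z) (snd Z) * cnj (stft (fun_distr \<Psi>) gauss (fst Z) (snd Z)))"
    define A where "A = C * b w ^ Suc k"
    have A0: "0 \<le> A" unfolding A_def using C b0 by simp
    have G: "norm (G (X, \<Omega>)) \<le> A * (1 / wt (X - w) ^ ?D) * (1 / wt (\<Omega> - 0 :: 'b \<times> 'b) ^ ?D)" for X \<Omega>
    proof -
      define t where "t = norm (stft (fun_distr \<Psi>) gauss X \<Omega>)"
      have t: "wt \<Omega> ^ K * t \<le> C * (b w ^ k / wt (X - w) ^ (K + ?D)) * (1 / wt \<Omega> ^ ?D)"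
        by (rule wt_power_add_div_le) (use \<Psi> in \<open>simp add: t_def\<close>)
      have "norm (G (X, \<Omega>)) \<le> b X * wt \<Omega> ^ K * t"
        unfolding G_def t_def by (simp add: norm_mult mult_right_mono V)
      also have "\<dots> = b X * (wt \<Omega> ^ K * t)" by simp
      also have "\<dots> \<le> (b w * wt (X - w) ^ K) * (C * (b w ^ k / wt (X - w) ^ (K + ?D)) * (1 / wt \<Omega> ^ ?D))"
        by (rule mult_mono[OF b t]) (use b0[of w] in \<open>auto simp: t_def\<close>)
      also have "\<dots> = A * (1 / wt (X - w) ^ ?D) * (1 / wt (\<Omega> - 0 :: 'b \<times> 'b) ^ ?D)"
        by (simp add: A_def power_add)
      finally show ?thesis .
    qed
    let ?H = "\<lambda>Z :: ('b \<times> 'b) \<times> ('b \<times> 'b). ennreal A * (ennreal (1 / wt (fst Z - w) ^ ?D) * ennreal (1 / wt (snd Z - 0 :: 'b \<times> 'b) ^ ?D))"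
    have mw: "(\<lambda>X :: 'b \<times> 'b. 1 / wt (X - u) ^ ?D) \<in> borel_measurable borel" for u
      by (intro borel_measurable_continuous_onI continuous_intros) auto
    have m1: "(\<lambda>Z :: ('b \<times> 'b) \<times> ('b \<times> 'b). ennreal (1 / wt (fst Z - w) ^ ?D)) \<in> borel_measurable borel"
      by (intro measurable_compose[OF _ measurable_ennreal] borel_measurable_continuous_comp[OF mw] continuous_intros)
    have m2: "(\<lambda>Z :: ('b \<times> 'b) \<times> ('b \<times> 'b). ennreal (1 / wt (snd Z - 0 :: 'b \<times> 'b) ^ ?D)) \<in> borel_measurable borel"
      by (intro measurable_compose[OF _ measurable_ennreal] borel_measurable_continuous_comp[OF mw] continuous_intros)
    have m3: "(\<lambda>X. ennreal (1 / wt (X - u) ^ ?D)) \<in> borel_measurable borel" for u :: "'b \<times> 'b"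
      by (rule measurable_compose[OF mw measurable_ennreal])
    have "ennreal (norm (LINT Z|lebesgue. G Z)) \<le> (\<integral>\<^sup>+Z. ennreal (norm (G Z)) \<partial>lebesgue)"
      by (rule norm_integral_le_nn_integral)
    also have "\<dots> \<le> (\<integral>\<^sup>+Z. ?H Z \<partial>lebesgue)"
    proof (intro nn_integral_mono)
      fix Z :: "('b \<times> 'b) \<times> ('b \<times> 'b)"
      have "ennreal (norm (G Z)) \<le> ennreal (A * (1 / wt (fst Z - w) ^ ?D) * (1 / wt (snd Z - 0 :: 'b \<times> 'b) ^ ?D))"
        using G[of "fst Z" "snd Z"] by (intro ennreal_leI) simp
      also have "\<dots> = ?H Z" using A0 by (subst ennreal_mult[symmetric], simp, simp)+ (simp add: mult.assoc)
      finally show "ennreal (norm (G Z)) \<le> ?H Z" .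
    qed
    also have "\<dots> = (\<integral>\<^sup>+Z. ?H Z \<partial>lborel)" by (rule nn_integral_completion)
    also have "\<dots> = ennreal A * (\<integral>\<^sup>+Z. ennreal (1 / wt (fst Z - w) ^ ?D) * ennreal (1 / wt (snd Z - 0 :: 'b \<times> 'b) ^ ?D) \<partial>lborel)"
      by (rule nn_integral_cmult) (use borel_measurable_times_ennreal[OF m1 m2] in simp)
    also have "(\<integral>\<^sup>+Z. ennreal (1 / wt (fst Z - w) ^ ?D) * ennreal (1 / wt (snd Z - 0 :: 'b \<times> 'b) ^ ?D) \<partial>lborel) =
       (\<integral>\<^sup>+X. (\<integral>\<^sup>+\<Omega>. ennreal (1 / wt (X - w) ^ ?D) * ennreal (1 / wt (\<Omega> - 0 :: 'b \<times> 'b) ^ ?D) \<partial>lborel) \<partial>lborel)"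
      using nn_integral_lborel_pair(1)[OF borel_measurable_times_ennreal[OF m1 m2]] by simp
    also have "\<dots> = (\<integral>\<^sup>+X. ennreal (1 / wt (X - w) ^ ?D) * ennreal I \<partial>lborel)"
    proof (rule nn_integral_cong)
      fix X
      have "(\<integral>\<^sup>+\<Omega>. ennreal (1 / wt (X - w) ^ ?D) * ennreal (1 / wt (\<Omega> - 0 :: 'b \<times> 'b) ^ ?D) \<partial>lborel) =
        ennreal (1 / wt (X - w) ^ ?D) * (\<integral>\<^sup>+\<Omega>. ennreal (1 / wt (\<Omega> - 0 :: 'b \<times> 'b) ^ ?D) \<partial>lborel)"
        by (rule nn_integral_cmult) (use m3[of 0] in simp)
      then show "(\<integral>\<^sup>+\<Omega>. ennreal (1 / wt (X - w) ^ ?D) * ennreal (1 / wt (\<Omega> - 0 :: 'b \<times> 'b) ^ ?D) \<partial>lborel) = ennreal (1 / wt (X - w) ^ ?D) * ennreal I"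
        unfolding I(2) .
    qed
    also have "\<dots> = (\<integral>\<^sup>+X. ennreal (1 / wt (X - w) ^ ?D) \<partial>lborel) * ennreal I"
      by (rule nn_integral_multc) (use m3[of w] in simp)
    also have "\<dots> = ennreal I * ennreal I" unfolding I(2) ..
    also have "ennreal A * (ennreal I * ennreal I) = ennreal (A * (I * I))"
      using A0 I(1) by (simp add: ennreal_mult)
    finally have "norm (LINT Z|lebesgue. G Z) \<le> A * (I * I)"
      using A0 I(1) by (subst (asm) ennreal_le_iff) auto
    then have "norm (LINT Z|lebesgue. G Z) / norm c \<le> A * (I * I) / norm c"
      by (rule divide_right_mono) simp
    then show ?thesis
      unfolding dual_pair_def G_def[symmetric] c_def[symmetric] norm_divide A_def by (simp add: mult_ac)
  qed
  moreover have "0 \<le> I * I / norm c" using I(1) by simp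
  ultimately show ?thesis using that by blast
qed

text \<open>The window \<psi> enters the step only through the test function, where its L2 pairing
  with \<open>f\<close> is the value of the STFT at \<open>w\<close>. The induction hypothesis is
  applied to other windows, namely \<phi>1 and those arising from it by integration by
  parts.\<close>

lemma eigenfunction_st_bound:
  fixes a :: "('a::euclidean_space \<times> 'a \<Rightarrow> complex) \<Rightarrow> complex" and f g \<phi>1 \<phi>2 :: "'a \<Rightarrow> complex"
  assumes V: "\<And>X \<Omega>. norm (stft a gauss X \<Omega>) \<le> b X * wt \<Omega> ^ K"
    and b0: "\<And>X. 0 \<le> b X" and b: "\<And>X Y. b X \<le> b Y * wt (X - Y) ^ K"
    and s: "schwartz \<phi>1" "schwartz \<phi>2" and lam: "lam \<noteq> 0"
    and f: "f \<in> borel_measurable lebesgue" and g: "L2_borel g" and ae: "AE x in lebesgue. f x = g x"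
    and eigen: "\<And>h. L2 h \<Longrightarrow> loc_form a \<phi>1 \<phi>2 f h = lam * L2_inner f h"
    and \<psi>: "schwartz \<psi>"
  shows "\<exists>C\<ge>0. \<forall>z. norm (st g \<psi> z) \<le> C * b z ^ k"
  using \<psi>
proof (induction k arbitrary: \<psi>)
  case 0
  then show ?case using st_bounded[OF g 0] by (metis mult.right_neutral power_0)
next
  case (Suc k)
  let ?M = "K + 2 * DIM('a \<times> 'a)"
  have mg: "g \<in> borel_measurable borel" using g by (simp add: L2_borel_def)
  obtain B where B: "0 \<le> B" "\<And>\<Psi> (C::real) w (k::nat). 0 \<le> C \<Longrightarrow>
     (\<And>X \<Omega>. wt \<Omega> ^ ?M * norm (stft (fun_distr \<Psi>) gauss X \<Omega>) \<le> C * (b w ^ k / wt (X - w) ^ ?M)) \<Longrightarrow>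
     norm (dual_pair a \<Psi>) \<le> B * C * b w ^ Suc k"
    using dual_pair_bound[OF V b0 b] by blast
  \<comment> \<open>\<open>stp\<close> does not conjugate its last window, whereas
    \<open>stft\<close> does.\<close>
  let ?\<Gamma> = "\<lambda>z :: 'a \<times> 'a. cnj (gauss z)"
  have s\<Gamma>: "schwartz ?\<Gamma>" by (intro schwartz_cnj schwartz_gauss)
  obtain C where C: "0 \<le> C" "\<And>w X \<Omega>. wt \<Omega> ^ ?M * norm (stp g (tf_shift w \<psi>) \<phi>1 \<phi>2 ?\<Gamma> X \<Omega>) \<le> C * (b w ^ k / wt (X - w) ^ ?M)"
    using stp_tf_shift_decay[OF g s s\<Gamma> Suc.prems Suc.IH b0 b, of ?M ?M] by blast
  have "norm (st g \<psi> w) \<le> (B * C / norm lam) * b w ^ Suc k" for w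
  proof -
    define h where "h = tf_shift w \<psi>"
    have h: "L2_borel h" unfolding h_def by (intro L2_borel_tf_shift L2_borel_schwartz Suc.prems)
    have mh: "h \<in> borel_measurable borel" using h by (simp add: L2_borel_def)
    have mhl: "h \<in> borel_measurable lebesgue" using mh by (intro measurable_completion) simp
    define \<Psi> where "\<Psi> = (\<lambda>z. cnj (st g \<phi>1 z) * st h \<phi>2 z)"
    have m\<Psi>: "\<Psi> \<in> borel_measurable borel"
      unfolding \<Psi>_def by (intro borel_measurable_times borel_measurable_cnj st_borel mg mh schwartz_borel[OF s(1)] schwartz_borel[OF s(2)])
    have loc: "loc_form a \<phi>1 \<phi>2 f h = dual_pair a \<Psi>"
      unfolding loc_form_def \<Psi>_def
      by (simp add: stft_eq_st[OF f mg ae schwartz_borel[OF s(1)]] stft_eq_st[OF mhl mh _ schwartz_borel[OF s(2)]])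
    have inner: "L2_inner f h = st g \<psi> w"
    proof -
      have mc: "(\<lambda>x. cnj (h x)) \<in> borel_measurable borel" by (rule borel_measurable_cnj[OF mh])
      have "L2_inner f h = fun_distr f (\<lambda>x. cnj (h x))" unfolding L2_inner_def fun_distr_def ..
      also have "\<dots> = (LINT y|lborel. g y * cnj (h y))" by (rule fun_distr_representative[OF f mg ae mc])
      also have "\<dots> = st g \<psi> w" unfolding st_def h_def tf_shift_def by (simp add: cis_cnj mult.commute)
      finally show ?thesis .
    qed
    have stp: "stft (fun_distr \<Psi>) gauss X \<Omega> = stp g h \<phi>1 \<phi>2 ?\<Gamma> X \<Omega>" for X \<Omega>
    proof -
      have "(\<lambda>y. \<Psi> y * (cnj (gauss (y - X)) * cis (- 2 * pi * (y \<bullet> \<Omega>)))) \<in> borel_measurable borel"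
        by (intro borel_measurable_times m\<Psi> borel_measurable_cnj borel_measurable_shift borel_measurable_char schwartz_borel[OF schwartz_gauss])
      then have "(\<lambda>y. \<Psi> y * (cnj (gauss (y - X)) * cis (- 2 * pi * (y \<bullet> \<Omega>)))) \<in> borel_measurable lborel" by simp
      from integral_completion[OF this] show ?thesis
        unfolding stft_def fun_distr_def stp_def \<Psi>_def .
    qed
    have "norm lam * norm (st g \<psi> w) = norm (dual_pair a \<Psi>)"
      using eigen[OF L2_of_borel[OF h]] unfolding loc inner by (simp add: norm_mult)
    also have "\<dots> \<le> B * C * b w ^ Suc k"
      by (rule B(2)[OF C(1)]) (unfold stp h_def, rule C(2))
    finally show ?thesis using lam by (simp add: field_simps)
  qed
  moreover have "0 \<le> B * C / norm lam" using B(1) C(1) by simp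
  ultimately show ?case by blast
qed

theorem theorem3p8:
  fixes a :: "('a::euclidean_space \<times> 'a \<Rightarrow> complex) \<Rightarrow> complex"
    and \<phi>1 \<phi>2 f :: "'a \<Rightarrow> complex" and p :: real and lam :: complex
  assumes "0 < p" and "mod_space_inf p a"
    and "schwartz \<phi>1" and "schwartz \<phi>2" and "\<phi>1 \<noteq> (\<lambda>_. 0)" and "\<phi>2 \<noteq> (\<lambda>_. 0)"
    and "loc_point_spectrum a \<phi>1 \<phi>2 - {0} \<noteq> {}"
    and "lam \<in> loc_point_spectrum a \<phi>1 \<phi>2 - {0}"
    and "loc_eigenpair a \<phi>1 \<phi>2 lam f"
  shows "\<forall>\<gamma>>0. mod_space \<gamma> \<gamma> (fun_distr f)"
proof (intro allI impI)
  fix \<gamma> :: real assume \<gamma>: "0 < \<gamma>"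
  have L2f: "L2 f" and eigen: "\<And>h. L2 h \<Longrightarrow> loc_form a \<phi>1 \<phi>2 f h = lam * L2_inner f h"
    using assms(9) by (auto simp: loc_eigenpair_def)
  have mf: "f \<in> borel_measurable lebesgue" using L2f by (simp add: L2_def)
  have lam: "lam \<noteq> 0" using assms(8) by simp
  obtain g where g: "L2_borel g" and ae: "AE x in lebesgue. f x = g x"
    using L2_borel_representative[OF L2f] by blast
  have mg: "g \<in> borel_measurable borel" using g by (simp add: L2_borel_def)
  obtain b K where b0: "\<And>X. 0 \<le> b X" and b: "\<And>X Y. b X \<le> b Y * wt (X - Y) ^ K"
    and V: "\<And>X \<Omega>. norm (stft a gauss X \<Omega>) \<le> b X * wt \<Omega> ^ K"
    and bp: "(\<integral>\<^sup>+X. ennreal (b X powr p) \<partial>lborel) < \<infinity>"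
    using stft_envelope[OF assms(1,2)] by blast
  have mb: "b \<in> borel_measurable borel"
    by (rule borel_measurable_continuous_onI[OF slowly_varying_continuous[OF b]])
  note bound = eigenfunction_st_bound[OF V b0 b assms(3,4) lam mf g ae eigen schwartz_gauss]
  obtain k :: nat where k: "p \<le> real k * \<gamma>"
    using real_arch_simple[of "p / \<gamma>"] \<gamma> by (auto simp: pos_divide_le_eq)
  obtain C0 where C0: "0 \<le> C0" "\<And>z. norm (st g gauss z) \<le> C0 * b z ^ 0"
    using bound[of 0] by blast
  obtain C where C: "0 \<le> C" "\<And>z. norm (st g gauss z) \<le> C * b z ^ k"
    using bound[of k] by blast
  define D where "D = C0 powr \<gamma> + C powr \<gamma>"
  have D0: "0 \<le> D" by (simp add: D_def)
  \<comment> \<open>Two powers of the envelope give one integrable majorant. Where b \<le> 1, the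
    bound with b^k works because k \<gamma> \<ge> p gives b^(k\<gamma>) \<le> b^p; where b > 1, the
    plain bound by \<open>C0\<close> works because b^p \<ge> 1.\<close>
  have F: "norm (st g gauss z) powr \<gamma> \<le> D * b z powr p" for z
  proof (cases "b z \<le> 1")
    case True
    show ?thesis
    proof (cases "b z = 0")
      case True
      \<comment> \<open>At a zero of \<open>b\<close> the right-hand side is 0, so the STFT has to
        vanish there; this uses a genuine power of \<open>b\<close>, which p > 0 guarantees.\<close>
      have "k \<noteq> 0" using k assms(1) by (intro notI) simp
      then have b0: "b z ^ k = 0" using True by simp
      have "norm (st g gauss z) \<le> C * b z ^ k" by (rule C(2))
      then have "norm (st g gauss z) = 0" unfolding b0 by simp
      then show ?thesis using D0 \<gamma> by simp
    next
      case False
      then have bz: "0 < b z" using b0[of z] by simp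
      have "norm (st g gauss z) powr \<gamma> \<le> (C * b z ^ k) powr \<gamma>"
        using C(2) \<gamma> by (intro powr_mono2) auto
      also have "\<dots> = C powr \<gamma> * b z powr (real k * \<gamma>)"
        using bz by (simp add: powr_mult powr_powr powr_realpow[symmetric])
      also have "\<dots> \<le> C powr \<gamma> * b z powr p"
        using True bz k by (intro mult_left_mono powr_mono') auto
      also have "\<dots> \<le> D * b z powr p" unfolding D_def by (intro mult_right_mono) auto
      finally show ?thesis .
    qed
  next
    case False
    have "norm (st g gauss z) powr \<gamma> \<le> C0 powr \<gamma>"
      using C0(2)[of z] \<gamma> by (intro powr_mono2) auto
    also have "\<dots> \<le> D * 1" unfolding D_def by simp
    also have "\<dots> \<le> D * b z powr p"
      using False D0 assms(1) by (intro mult_left_mono ge_one_powr_ge_zero) auto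
    finally show ?thesis .
  qed
  define H where "H = (\<lambda>\<omega>. \<integral>\<^sup>+x. ennreal (b (x, \<omega>) powr p) \<partial>lborel)"
  have mbp: "(\<lambda>z. ennreal (b z powr p)) \<in> borel_measurable borel" using mb by measurable
  have mH: "H \<in> borel_measurable lborel"
  proof -
    have "(\<lambda>(\<omega>, x). ennreal (b (x, \<omega>) powr p)) \<in> borel_measurable (lborel \<Otimes>\<^sub>M lborel)"
      using borel_measurable_continuous_comp[OF mbp, of "\<lambda>z :: 'a \<times> 'a. (snd z, fst z)"]
      by (simp add: lborel_prod split_beta continuous_intros)
    then show ?thesis unfolding H_def by (intro lborel.borel_measurable_nn_integral) simp
  qed
  have intH: "(\<integral>\<^sup>+\<omega>. H \<omega> \<partial>lborel) < \<infinity>"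
    unfolding H_def using nn_integral_lborel_pair(2)[OF mbp] bp by simp
  have inner: "inner_Lp \<gamma> (stft (fun_distr f) gauss) \<omega> \<le> ennreal D * H \<omega>" for \<omega>
  proof -
    have mb1: "(\<lambda>x. ennreal (b (x, \<omega>) powr p)) \<in> borel_measurable borel"
      by (rule borel_measurable_continuous_comp[OF mbp]) (intro continuous_intros)
    have "inner_Lp \<gamma> (stft (fun_distr f) gauss) \<omega> = (\<integral>\<^sup>+x. ennreal (norm (st g gauss (x, \<omega>)) powr \<gamma>) \<partial>lborel)"
      unfolding inner_Lp_def nn_integral_completion by (simp add: stft_eq_st[OF mf mg ae schwartz_borel[OF schwartz_gauss]])
    also have "\<dots> \<le> (\<integral>\<^sup>+x. ennreal D * ennreal (b (x, \<omega>) powr p) \<partial>lborel)"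
      using F D0 by (intro nn_integral_mono) (simp add: ennreal_mult[symmetric] ennreal_leI)
    also have "\<dots> = ennreal D * H \<omega>" unfolding H_def by (rule nn_integral_cmult) (use mb1 in simp)
    finally show ?thesis .
  qed
  \<comment> \<open>\<open>mod_space\<close> reads the inner integral through
    \<open>enn2real\<close>, which sends infinity to 0. Finiteness almost everywhere is therefore a
    claim separate from the finiteness of the outer integral.\<close>
  have "AE \<omega> in lborel. H \<omega> \<noteq> \<infinity>"
    by (rule nn_integral_PInf_AE[OF mH]) (use intH in auto)
  then have "AE \<omega> in lborel. inner_Lp \<gamma> (stft (fun_distr f) gauss) \<omega> < \<infinity>"
  proof eventually_elim
    fix \<omega> :: 'a assume "H \<omega> \<noteq> \<infinity>"
    then have "ennreal D * H \<omega> < \<infinity>" by (simp add: ennreal_mult_less_top less_top)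
    then show "inner_Lp \<gamma> (stft (fun_distr f) gauss) \<omega> < \<infinity>" by (rule le_less_trans[OF inner])
  qed
  then have 1: "AE \<omega> in lebesgue. inner_Lp \<gamma> (stft (fun_distr f) gauss) \<omega> < \<infinity>" by (rule AE_completion)
  have "(\<integral>\<^sup>+\<omega>. ennreal (enn2real (inner_Lp \<gamma> (stft (fun_distr f) gauss) \<omega>) powr (\<gamma> / \<gamma>)) \<partial>lebesgue)
      \<le> (\<integral>\<^sup>+\<omega>. ennreal D * H \<omega> \<partial>lebesgue)"
  proof (intro nn_integral_mono)
    fix \<omega> :: 'a
    have "ennreal (enn2real (inner_Lp \<gamma> (stft (fun_distr f) gauss) \<omega>) powr (\<gamma> / \<gamma>)) =
       ennreal (enn2real (inner_Lp \<gamma> (stft (fun_distr f) gauss) \<omega>))" using \<gamma> by simp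
    also have "\<dots> \<le> inner_Lp \<gamma> (stft (fun_distr f) gauss) \<omega>"
      by (cases "inner_Lp \<gamma> (stft (fun_distr f) gauss) \<omega>") auto
    also have "\<dots> \<le> ennreal D * H \<omega>" by (rule inner)
    finally show "ennreal (enn2real (inner_Lp \<gamma> (stft (fun_distr f) gauss) \<omega>) powr (\<gamma> / \<gamma>)) \<le> ennreal D * H \<omega>" .
  qed
  also have "\<dots> = ennreal D * (\<integral>\<^sup>+\<omega>. H \<omega> \<partial>lborel)"
    unfolding nn_integral_completion by (rule nn_integral_cmult[OF mH])
  also have "\<dots> < \<infinity>" using intH by (simp add: ennreal_mult_less_top)
  finally show "mod_space \<gamma> \<gamma> (fun_distr f)"
    unfolding mod_space_def using tempered_fun_distr[OF L2f] 1 by blast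
qed

end
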